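(* Let the parameters $\alpha,\beta,\gamma$ in the matrix $A=\begin{pmatrix}\alpha&\beta\\ \beta&\gamma\end{pmatrix}$ be chosen elementwise as $\alpha=(8\delta)^{-1}$, $\beta=(24\delta^2)^{-1}$, $\gamma=(64\delta^3)^{-1}$, where for each $T\in\mathcal T$ $$\delta|_T:=\delta_T=\max\left\{\frac{C_{inv}^2p^2\|xn_2\|_{L_\infty(\partial_-T)}}{h_T},\ \frac{2\|n_1\|_{L_\infty(\partial T)}^2C_{inv}^4p^4}{3h_T^2}\right\},\qquad \tau|_T:=\frac{h_T^2}{4C_{INV}^2p^4}.$$ Then, for all (time-dependent) $w\in V_h$, $$a_h(w,w)\ \ge\ \frac14\,|||w|||^2 .$$
   Context: Domain and mesh. $\Omega\subset\mathbb R^2$ is a polygonal domain with coordinates $(x,y)$ and unit outward normal $\mathbf n=(n_1,n_2)$ (on $\partial T$, $\mathbf n$ denotes the unit outward normal to $T$). $\partial_0\Omega:=\{(x,y)\in\partial\Omega: n_1\neq0\}$, $\partial_-\Omega:=\{(x,y)\in\partial\Omega\setminus\partial_0\Omega: xn_2<0\}$, assumed to have positive one-dimensional Hausdorff measure, and $\partial_+\Omega:=\{(x,y)\in\partial\Omega\setminus\partial_0\Omega: xn_2\ge0\}$. $H^1_-(\Omega):=\{v\in H^1(\Omega): v|_{\partial_-\Omega}=0\}$. $\mathcal T$ is a shape-regular, locally quasi-uniform triangulation of $\Omega$ into open triangles $T$, $h_T=\mathrm{diam}(T)$, and $h$ is the mesh function $h|_T=h_T$. For $T\in\mathcal T$,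 $\partial_-T$ and $\partial_+T$ are the parts of $\partial T$ where $xn_2<0$ and $xn_2\ge0$, respectively. $V_h:=\{V\in H^1_-(\Omega): V|_T\in\mathbb P_p(T),\ T\in\mathcal T\}$, $p\ge1$, with $\mathbb P_p$ the polynomials of total degree at most $p$. Elements of $V_h$ may depend on time $t$ ($w\equiv w(t)\in V_h$, with $w_t\in V_h$ its time derivative), and the inequality is understood at each such time. $\nabla_{\mathcal T}$ is the elementwise (spatial) gradient. $(\cdot,\cdot)_\omega$, $\|\cdot\|_\omega$ are the $L_2(\omega)$ inner product and norm; the subscript is omitted for $\omega=\Omega$. Constants. $C_{INV}>0$ and $C_{inv}>0$ depend only on the shape-regularity of the mesh and are the constants in $\|\nabla v\|_T\le C_{INV}p^2h_T^{-1}\|v\|_T$ and $\|v\|_{\partial T}\le C_{inv}p\,h_T^{-1/2}\|v\|_T$, valid for $v\in\mathbb P_p(T)$, $T\in\mathcal T$. Forms and norm. $Lu:=-u_{xx}+xu_y$, $$a_h(U,V):=(U_x,V_x)+(xU_y,V)+\sum_{T\in\mathcal T}(U_t+LU,\tau(V_t+xV_y))_T+\sum_{T\in\mathcal T}(\nabla LU,A\nabla V)_T,$$ $$|||w|||^2:=\tfrac12\|w_x\|^2+\|\sqrt{\gamma\delta}\,w_y\|^2+\tfrac12\|\sqrt\tau(w_t+xw_y)\|^2+\|\sqrt A\nabla_{\mathcal T}w_x\|^2+\|\sqrt{xn_2}\,w\|_{\partial_+\Omega}^2+\sum_{T\in\mathcal T}\|\sqrt{xn_2A}\,\nabla w\|_{\partial_+T}^2,$$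 where $\|\sqrt{xn_2A}\,\nabla w\|_{\partial_+T}^2=\int_{\partial_+T}xn_2\,\nabla w\cdot A\nabla w\,ds$.
   Formalization: The formal theorem additionally assumes x n_2 ≥ 0 on ∂_0Ω (where n_1 ≠ 0), i.e. no inflow through slanted sides; without this the inequality fails, e.g. on the trapezoid (1,0),(2,0),(6,1),(1,1) with p=1 and w interpolating sin(πy) on a fine mesh. *)

theory Defs
  imports "HOL-Analysis.Analysis" "HOL-Probability.Essential_Supremum"
begin

type_synonym plane = "real \<times> real"

section \<open>One-dimensional Hausdorff measure\<close>

definition hausdorff1_content :: "real \<Rightarrow> 'a::metric_space set \<Rightarrow> ennreal" where
  "hausdorff1_content d E =
     (INF C \<in> {C :: nat \<Rightarrow> 'a set. E \<subseteq> (\<Union>i. C i) \<and> (\<forall>i. bounded (C i) \<and> diameter (C i) \<le> d)}.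
        \<Sum>i. ennreal (diameter (C i)))"

definition hausdorff1_outer :: "'a::metric_space set \<Rightarrow> ennreal" where
  "hausdorff1_outer E = (SUP d \<in> {0<..}. hausdorff1_content d E)"

text \<open>On segments this is arc length, so integrals with respect to \<open>hausdorff1\<close> over (parts of) the
  boundary of a polygon are the usual \<open>ds\<close> integrals.\<close>

definition hausdorff1 :: "'a::metric_space measure" where
  "hausdorff1 = measure_of UNIV (sets borel) hausdorff1_outer"


section \<open>\<open>L\<^sub>2\<close> and \<open>L\<^sub>\<infinity>\<close>\<close>

text \<open>Domain integrals use \<^term>\<open>lebesgue\<close> rather than \<^term>\<open>lborel\<close>: discrete functions are only
  determined inside the elements, and their values on the (null) mesh skeleton must not matter.\<close>

definition square_integrable ::
    "'a measure \<Rightarrow> 'a set \<Rightarrow> ('a \<Rightarrow> 'b::{banach, second_countable_topology}) \<Rightarrow> bool" where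
  "square_integrable M S f \<longleftrightarrow>
     set_borel_measurable M S f \<and> set_integrable M S (\<lambda>z. (norm (f z))\<^sup>2)"

definition L2_inner :: "'a measure \<Rightarrow> 'a set \<Rightarrow> ('a \<Rightarrow> 'b::real_inner) \<Rightarrow> ('a \<Rightarrow> 'b) \<Rightarrow> real" where
  "L2_inner M S f g = (LINT z:S|M. f z \<bullet> g z)"

definition L2_norm :: "'a measure \<Rightarrow> 'a set \<Rightarrow> ('a \<Rightarrow> 'b::real_normed_vector) \<Rightarrow> real" where
  "L2_norm M S f = sqrt (LINT z:S|M. (norm (f z))\<^sup>2)"

text \<open>The value is 0 if \<open>S\<close> is a null set.\<close>

definition Linf_norm :: "'a measure \<Rightarrow> 'a set \<Rightarrow> ('a \<Rightarrow> real) \<Rightarrow> real" where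
  "Linf_norm M S f = enn2real (esssup (restrict_space M S) (\<lambda>z. ennreal \<bar>f z\<bar>))"


section \<open>Partial derivatives\<close>

text \<open>Classical derivatives.  For a piecewise polynomial function they are the elementwise derivatives
  on the union of the open elements, i.e. almost everywhere; for a piecewise polynomial function in
  \<open>H\<^sup>1\<close> the first-order ones represent the weak derivatives.\<close>

definition dx :: "(plane \<Rightarrow> real) \<Rightarrow> plane \<Rightarrow> real" where
  "dx f z = deriv (\<lambda>s. f (s, snd z)) (fst z)"

definition dy :: "(plane \<Rightarrow> real) \<Rightarrow> plane \<Rightarrow> real" where
  "dy f z = deriv (\<lambda>s. f (fst z, s)) (snd z)"

definition grad :: "(plane \<Rightarrow> real) \<Rightarrow> plane \<Rightarrow> plane" where
  "grad f z = (dx f z, dy f z)"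

definition C1 :: "(plane \<Rightarrow> real) set" where
  "C1 = {f. (\<forall>z. f differentiable (at z)) \<and> continuous_on UNIV (grad f)}"


section \<open>Polygonal domains and their boundary parts\<close>

text \<open>The condition \<open>\<Omega> = interior (closure \<Omega>)\<close> excludes slits, on which there is no outward normal.\<close>

definition polygonal_domain :: "plane set \<Rightarrow> bool" where
  "polygonal_domain \<Omega> \<longleftrightarrow>
     open \<Omega> \<and> connected \<Omega> \<and> \<Omega> \<noteq> {} \<and> bounded \<Omega> \<and> \<Omega> = interior (closure \<Omega>) \<and>
     (\<exists>E. finite E \<and> frontier \<Omega> = (\<Union>(a, b)\<in>E. closed_segment a b))"

definition is_outward_normal :: "plane set \<Rightarrow> plane \<Rightarrow> plane \<Rightarrow> bool" where
  "is_outward_normal S z n \<longleftrightarrow>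
     norm n = 1 \<and> (\<exists>e>0. S \<inter> ball z e = {q \<in> ball z e. (q - z) \<bullet> n < 0})"

text \<open>At corners, which form a null set, there is no normal and the value is set to 0.\<close>

definition outward_normal :: "plane set \<Rightarrow> plane \<Rightarrow> plane" where
  "outward_normal S z =
     (if \<exists>n. is_outward_normal S z n then (THE n. is_outward_normal S z n) else 0)"

definition n1 :: "plane set \<Rightarrow> plane \<Rightarrow> real" where
  "n1 S z = fst (outward_normal S z)"

definition xn2 :: "plane set \<Rightarrow> plane \<Rightarrow> real" where
  "xn2 S z = fst z * snd (outward_normal S z)"

definition bdry0 :: "plane set \<Rightarrow> plane set" where
  "bdry0 \<Omega> = {z \<in> frontier \<Omega>. n1 \<Omega> z \<noteq> 0}"

definition bdry_minus :: "plane set \<Rightarrow> plane set" where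
  "bdry_minus \<Omega> = {z \<in> frontier \<Omega> - bdry0 \<Omega>. xn2 \<Omega> z < 0}"

definition bdry_plus :: "plane set \<Rightarrow> plane set" where
  "bdry_plus \<Omega> = {z \<in> frontier \<Omega> - bdry0 \<Omega>. xn2 \<Omega> z \<ge> 0}"

text \<open>For elements, unlike for \<open>\<Omega>\<close>, the part with \<open>n\<^sub>1 \<noteq> 0\<close> is not removed.\<close>

definition elem_bdry_minus :: "plane set \<Rightarrow> plane set" where
  "elem_bdry_minus T = {z \<in> frontier T. xn2 T z < 0}"

definition elem_bdry_plus :: "plane set \<Rightarrow> plane set" where
  "elem_bdry_plus T = {z \<in> frontier T. xn2 T z \<ge> 0}"


section \<open>The spaces \<open>H\<^sup>1(\<Omega>)\<close> and \<open>H\<^sup>1\<^sub>-(\<Omega>)\<close>\<close>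

definition test_functions :: "plane set \<Rightarrow> (plane \<Rightarrow> real) set" where
  "test_functions \<Omega> = {\<phi> \<in> C1. \<exists>K. compact K \<and> K \<subseteq> \<Omega> \<and> (\<forall>z. z \<notin> K \<longrightarrow> \<phi> z = 0)}"

definition weak_gradient :: "plane set \<Rightarrow> (plane \<Rightarrow> real) \<Rightarrow> (plane \<Rightarrow> plane) \<Rightarrow> bool" where
  "weak_gradient \<Omega> v G \<longleftrightarrow>
     (\<forall>\<phi>\<in>test_functions \<Omega>.
        (LINT z:\<Omega>|lebesgue. v z * dx \<phi> z) = - (LINT z:\<Omega>|lebesgue. fst (G z) * \<phi> z) \<and>
        (LINT z:\<Omega>|lebesgue. v z * dy \<phi> z) = - (LINT z:\<Omega>|lebesgue. snd (G z) * \<phi> z))"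

definition H1 :: "plane set \<Rightarrow> (plane \<Rightarrow> real) set" where
  "H1 \<Omega> = {v. square_integrable lebesgue \<Omega> v \<and>
     (\<exists>G. square_integrable lebesgue \<Omega> G \<and> weak_gradient \<Omega> v G)}"

text \<open>The trace on \<open>\<partial>\<Omega>\<close> is the continuous extension to \<open>H\<^sup>1(\<Omega>)\<close> of the restriction map for functions
  that are smooth up to the boundary.\<close>

definition has_trace :: "plane set \<Rightarrow> (plane \<Rightarrow> real) \<Rightarrow> (plane \<Rightarrow> real) \<Rightarrow> bool" where
  "has_trace \<Omega> v g \<longleftrightarrow>
     square_integrable lebesgue \<Omega> v \<and>
     square_integrable hausdorff1 (frontier \<Omega>) g \<and>
     (\<exists>G \<phi>. square_integrable lebesgue \<Omega> G \<and> weak_gradient \<Omega> v G \<and>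
        (\<forall>k::nat. \<phi> k \<in> C1) \<and>
        (\<lambda>k. L2_norm lebesgue \<Omega> (\<lambda>z. \<phi> k z - v z)) \<longlonglongrightarrow> 0 \<and>
        (\<lambda>k. L2_norm lebesgue \<Omega> (\<lambda>z. grad (\<phi> k) z - G z)) \<longlonglongrightarrow> 0 \<and>
        (\<lambda>k. L2_norm hausdorff1 (frontier \<Omega>) (\<lambda>z. \<phi> k z - g z)) \<longlonglongrightarrow> 0)"

definition bdry_trace :: "plane set \<Rightarrow> (plane \<Rightarrow> real) \<Rightarrow> plane \<Rightarrow> real" where
  "bdry_trace \<Omega> v = (SOME g. has_trace \<Omega> v g)"

text \<open>The conjunct \<open>has_trace \<Omega> v (bdry_trace \<Omega> v)\<close> only says that \<open>v\<close> has a trace, so that the choice in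
  \<open>bdry_trace\<close> is meaningful; by the trace theorem it holds for all \<open>v \<in> H1 \<Omega>\<close>.\<close>

definition H1_minus :: "plane set \<Rightarrow> (plane \<Rightarrow> real) set" where
  "H1_minus \<Omega> = {v \<in> H1 \<Omega>. has_trace \<Omega> v (bdry_trace \<Omega> v) \<and>
     (AE z in hausdorff1. z \<in> bdry_minus \<Omega> \<longrightarrow> bdry_trace \<Omega> v z = 0)}"


section \<open>Meshes and the finite element space\<close>

definition open_triangle :: "plane set \<Rightarrow> bool" where
  "open_triangle T \<longleftrightarrow> (\<exists>K. 2 simplex K \<and> T = interior K)"

definition mesh :: "plane set \<Rightarrow> plane set set \<Rightarrow> bool" where
  "mesh \<Omega> \<T> \<longleftrightarrow>
     (\<forall>T\<in>\<T>. open_triangle T) \<and> triangulation (closure ` \<T>) \<and> \<Union>(closure ` \<T>) = closure \<Omega>"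

definition inradius :: "plane set \<Rightarrow> real" where
  "inradius T = Sup {r. \<exists>z. ball z r \<subseteq> T}"

definition shape_regular :: "real \<Rightarrow> plane set set \<Rightarrow> bool" where
  "shape_regular \<kappa> \<T> \<longleftrightarrow> (\<forall>T\<in>\<T>. diameter T \<le> \<kappa> * inradius T)"

definition locally_quasi_uniform :: "real \<Rightarrow> plane set set \<Rightarrow> bool" where
  "locally_quasi_uniform \<kappa> \<T> \<longleftrightarrow>
     (\<forall>T\<in>\<T>. \<forall>T'\<in>\<T>. closure T \<inter> closure T' \<noteq> {} \<longrightarrow> diameter T \<le> \<kappa> * diameter T')"

definition polys :: "nat \<Rightarrow> (plane \<Rightarrow> real) set" where
  "polys p = {q. \<exists>c :: nat \<Rightarrow> nat \<Rightarrow> real.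
     \<forall>x y. q (x, y) = (\<Sum>(i, j)\<in>{(i, j). i + j \<le> p}. c i j * x ^ i * y ^ j)}"

definition Vh :: "plane set \<Rightarrow> plane set set \<Rightarrow> nat \<Rightarrow> (plane \<Rightarrow> real) set" where
  "Vh \<Omega> \<T> p = {V \<in> H1_minus \<Omega>. \<forall>T\<in>\<T>. \<exists>q\<in>polys p. \<forall>z\<in>T. V z = q z}"


section \<open>Inverse estimates\<close>

definition inverse_estimate :: "plane set set \<Rightarrow> nat \<Rightarrow> real \<Rightarrow> bool" where
  "inverse_estimate \<T> p C_INV \<longleftrightarrow> (\<forall>T\<in>\<T>. \<forall>v\<in>polys p.
     L2_norm lebesgue T (grad v) \<le> C_INV * (real p)\<^sup>2 / diameter T * L2_norm lebesgue T v)"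

definition trace_inverse_estimate :: "plane set set \<Rightarrow> nat \<Rightarrow> real \<Rightarrow> bool" where
  "trace_inverse_estimate \<T> p C_inv \<longleftrightarrow> (\<forall>T\<in>\<T>. \<forall>v\<in>polys p.
     L2_norm hausdorff1 (frontier T) v \<le> C_inv * real p / sqrt (diameter T) * L2_norm lebesgue T v)"


section \<open>Bilinear form and norm\<close>

text \<open>The symmetric matrix with rows \<open>(a, b)\<close> and \<open>(b, c)\<close>, acting on vectors.\<close>

definition sym_mat :: "real \<Rightarrow> real \<Rightarrow> real \<Rightarrow> plane \<Rightarrow> plane" where
  "sym_mat a b c v = (a * fst v + b * snd v, b * fst v + c * snd v)"

definition Lop :: "(plane \<Rightarrow> real) \<Rightarrow> plane \<Rightarrow> real" where
  "Lop u z = - dx (dx u) z + fst z * dy u z"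

text \<open>\<open>Ut\<close> and \<open>Vt\<close> are the time derivatives of \<open>U\<close> and \<open>V\<close> at the time considered; \<open>\<tau>\<close> and \<open>A\<close> are
  elementwise constant and given as functions of the element.\<close>

definition a_h ::
    "plane set \<Rightarrow> plane set set \<Rightarrow> (plane set \<Rightarrow> real) \<Rightarrow> (plane set \<Rightarrow> plane \<Rightarrow> plane) \<Rightarrow>
     (plane \<Rightarrow> real) \<Rightarrow> (plane \<Rightarrow> real) \<Rightarrow> (plane \<Rightarrow> real) \<Rightarrow> (plane \<Rightarrow> real) \<Rightarrow> real" where
  "a_h \<Omega> \<T> \<tau> A U Ut V Vt =
     L2_inner lebesgue \<Omega> (dx U) (dx V)
   + L2_inner lebesgue \<Omega> (\<lambda>z. fst z * dy U z) V
   + (\<Sum>T\<in>\<T>. L2_inner lebesgue T (\<lambda>z. Ut z + Lop U z) (\<lambda>z. \<tau> T * (Vt z + fst z * dy V z)))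
   + (\<Sum>T\<in>\<T>. L2_inner lebesgue T (grad (Lop U)) (\<lambda>z. A T (grad V z)))"

text \<open>Boundary values on \<open>\<partial>T\<close>, taken from inside \<open>T\<close>, of a function that is polynomial on \<open>T\<close>.\<close>

definition inner_trace :: "plane set \<Rightarrow> (plane \<Rightarrow> 'b::t2_space) \<Rightarrow> plane \<Rightarrow> 'b" where
  "inner_trace T f z = Lim (at z within T) f"

text \<open>For a positive semidefinite \<open>A\<close>, \<open>\<parallel>\<surd>A v\<parallel>\<^sup>2\<close> is the integral of \<open>v \<bullet> A v\<close>.\<close>

definition triple_norm_sq ::
    "plane set \<Rightarrow> plane set set \<Rightarrow> (plane set \<Rightarrow> real) \<Rightarrow> (plane set \<Rightarrow> real) \<Rightarrow> (plane set \<Rightarrow> real) \<Rightarrow>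
     (plane set \<Rightarrow> plane \<Rightarrow> plane) \<Rightarrow> (plane \<Rightarrow> real) \<Rightarrow> (plane \<Rightarrow> real) \<Rightarrow> real" where
  "triple_norm_sq \<Omega> \<T> \<gamma> \<delta> \<tau> A w wt =
     1/2 * (L2_norm lebesgue \<Omega> (dx w))\<^sup>2
   + (\<Sum>T\<in>\<T>. (L2_norm lebesgue T (\<lambda>z. sqrt (\<gamma> T * \<delta> T) * dy w z))\<^sup>2)
   + 1/2 * (\<Sum>T\<in>\<T>. (L2_norm lebesgue T (\<lambda>z. sqrt (\<tau> T) * (wt z + fst z * dy w z)))\<^sup>2)
   + (\<Sum>T\<in>\<T>. LINT z:T|lebesgue. grad (dx w) z \<bullet> A T (grad (dx w) z))
   + (L2_norm hausdorff1 (bdry_plus \<Omega>) (\<lambda>z. sqrt (xn2 \<Omega> z) * bdry_trace \<Omega> w z))\<^sup>2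
   + (\<Sum>T\<in>\<T>. LINT z:elem_bdry_plus T|hausdorff1.
        xn2 T z * (inner_trace T (grad w) z \<bullet> A T (inner_trace T (grad w) z)))"

end

theory Submission
  imports Defs
begin

text \<open>
  The form \<open>a\<^sub>h(w,w)\<close> is a sum of element contributions plus the transport term \<open>(x w\<^sub>y, w)\<close>, and
  each of the two is treated by integration by parts.

  Since \<open>x w\<^sub>y w = \<partial>\<^sub>y(x w\<^sup>2/2)\<close>, the divergence theorem turns the transport term into
  half the integral of \<open>x n\<^sub>2 w\<^sup>2\<close> over the boundary. This vanishes on the inflow part, where the trace of \<open>w\<close>
  is zero, and is nonnegative elsewhere, so that it bounds half the outflow term of the norm
  (\<open>transport_term_eq_trace\<close>, \<open>outflow_le_boundary_integral\<close>). The trace is a limit of restrictions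
  of smooth functions \<open>\<phi>\<^sub>k\<close>, for which the divergence theorem holds; the limit of their
  \<open>y\<close>-derivatives is recognized as the elementwise derivative by testing with functions that vanish
  on the boundary of an element (\<open>gradient_on_piece\<close>).

  On an element, \<open>w\<close> is a polynomial. In the stabilization term only
  \<open>- \<tau> (w\<^sub>x\<^sub>x, w\<^sub>t + x w\<^sub>y)\<close> has no sign; Young's inequality, the inverse estimate and the
  choice of \<open>\<tau>\<close> bound it by \<open>\<tau>/2 \<parallel>w\<^sub>t + x w\<^sub>y\<parallel>\<^sup>2 + 1/8 \<parallel>w\<^sub>x\<parallel>\<^sup>2\<close>
  (\<open>stabilization_term_ge\<close>). Integration by parts in the gradient term (\<open>gradient_term_eq\<close>) yields
  \<open>\<parallel>\<surd>A \<nabla>w\<^sub>x\<parallel>\<^sup>2\<close>, the term \<open>\<beta> \<parallel>w\<^sub>y\<parallel>\<^sup>2\<close> that controls \<open>w\<^sub>y\<close>, the mixed term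
  \<open>\<alpha> (w\<^sub>x, w\<^sub>y)\<close> and two boundary integrals, with weights \<open>n\<^sub>1\<close> and \<open>x n\<^sub>2/2\<close>.
  By the trace estimate and the two lower bounds on \<open>\<delta>\<close>, the first one is at most
  \<open>3/4 \<parallel>\<surd>A \<nabla>w\<^sub>x\<parallel>\<^sup>2 + \<delta>/2 \<parallel>\<surd>A \<nabla>w\<parallel>\<^sup>2\<close> and the inflow part of the second one is
  at least \<open>- \<delta>/2 \<parallel>\<surd>A \<nabla>w\<parallel>\<^sup>2\<close> (\<open>normal_x_term_le\<close>, \<open>transport_boundary_term_ge\<close>). What remains is
  pointwise a quadratic form in \<open>w\<^sub>x\<close> and \<open>w\<^sub>y/\<delta>\<close>, and the constants in \<open>\<alpha>\<close>, \<open>\<beta>\<close>, \<open>\<gamma>\<close>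
  make it dominate the corresponding part of the norm (\<open>pointwise_coercivity\<close>).

  Boundary integrals are taken with respect to Hausdorff measure, which is a
  Borel measure by Caratheodory's criterion and equals arc length on lines. On almost every vertical
  line, the boundary of a polygonal domain consists of finitely many points, each in the relative
  interior of a boundary segment. The fundamental theorem of calculus on the line and Fubini's theorem
  therefore express \<open>\<integral> \<partial>\<^sub>y f\<close> by signed values of \<open>f\<close> on the boundary, and the sign times
  \<open>dx\<close> is \<open>n\<^sub>2 ds\<close> (\<open>divergence_theorem_y\<close>). The \<open>x\<close>-version follows by exchanging coordinates.
\<close>


section \<open>Hausdorff measure of dimension one\<close>

lemma hausdorff1_content_le:
  assumes "E \<subseteq> (\<Union>i. C i)" "\<And>i. bounded (C i)" "\<And>i. diameter (C i) \<le> d"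
  shows "hausdorff1_content d E \<le> (\<Sum>i. ennreal (diameter (C i)))"
  unfolding hausdorff1_content_def by (rule INF_lower) (use assms in auto)

lemma hausdorff1_content_mono:
  "E \<subseteq> F \<Longrightarrow> hausdorff1_content d E \<le> hausdorff1_content d F"
  unfolding hausdorff1_content_def by (rule INF_superset_mono) auto

lemma hausdorff1_content_antimono:
  "d \<le> d' \<Longrightarrow> hausdorff1_content d' E \<le> hausdorff1_content d E"
  unfolding hausdorff1_content_def by (rule INF_superset_mono) (auto intro: order_trans)

lemma hausdorff1_content_empty: "0 \<le> d \<Longrightarrow> hausdorff1_content d {} = 0"
  using hausdorff1_content_le[of "{}" "\<lambda>i. {}" d] by simp

lemma hausdorff1_content_UN_le:
  fixes E :: "nat \<Rightarrow> 'a::metric_space set"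
  shows "hausdorff1_content d (\<Union>i. E i) \<le> (\<Sum>i. hausdorff1_content d (E i))"
proof (rule ennreal_le_epsilon)
  fix e :: real assume "0 < e" and fin: "(\<Sum>i. hausdorff1_content d (E i)) < top"
  then have lt: "hausdorff1_content d (E n) < hausdorff1_content d (E n) + e * (1/2)^Suc n" for n
    by (auto simp add: less_top dest!: ennreal_suminf_lessD)
  have "\<exists>C. E n \<subseteq> (\<Union>i. C i) \<and> (\<forall>i. bounded (C i) \<and> diameter (C i) \<le> d) \<and>
      (\<Sum>i. ennreal (diameter (C i))) < hausdorff1_content d (E n) + e * (1/2)^Suc n" for n
    using lt[of n] unfolding hausdorff1_content_def[of d "E n"] INF_less_iff by auto
  then obtain C where C: "\<And>n. E n \<subseteq> (\<Union>i. C n i)" "\<And>n i. bounded (C n i)"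
      "\<And>n i. diameter (C n i) \<le> d"
    and sum_le: "\<And>n. (\<Sum>i. ennreal (diameter (C n i))) \<le> hausdorff1_content d (E n) + e * (1/2)^Suc n"
    by (metis less_imp_le)
  define B where "B = case_prod C o prod_decode"
  have "(\<Union>i. E i) \<subseteq> (\<Union>i. B i)"
    using C(1) by (auto simp add: B_def subset_eq) (metis prod.case prod_encode_inverse)
  then have "hausdorff1_content d (\<Union>i. E i) \<le> (\<Sum>i. ennreal (diameter (B i)))"
    by (rule hausdorff1_content_le) (auto simp: B_def C split: prod.split)
  also have "\<dots> = (\<Sum>n. \<Sum>i. ennreal (diameter (C n i)))"
    unfolding B_def comp_def
    using suminf_ennreal_2dimen[of "\<lambda>n. \<Sum>i. ennreal (diameter (C n i))" "\<lambda>p. ennreal (diameter (case_prod C p))"]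
    by simp
  also have "\<dots> \<le> (\<Sum>n. hausdorff1_content d (E n) + e * (1/2) ^ Suc n)"
    by (intro suminf_le sum_le) auto
  also have "\<dots> = (\<Sum>n. hausdorff1_content d (E n)) + (\<Sum>n. ennreal e * ennreal ((1/2) ^ Suc n))"
    using \<open>0 < e\<close> by (subst suminf_add[symmetric])
      (auto simp del: ennreal_suminf_cmult simp add: ennreal_mult[symmetric])
  also have "\<dots> = (\<Sum>n. hausdorff1_content d (E n)) + e"
    unfolding ennreal_suminf_cmult
    by (subst suminf_ennreal_eq[OF zero_le_power power_half_series]) auto
  finally show "hausdorff1_content d (\<Union>i. E i) \<le> (\<Sum>n. hausdorff1_content d (E n)) + e" .
qed

lemma hausdorff1_content_le_outer: "0 < d \<Longrightarrow> hausdorff1_content d E \<le> hausdorff1_outer E"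
  unfolding hausdorff1_outer_def by (rule SUP_upper) auto

lemma hausdorff1_outer_mono: "E \<subseteq> F \<Longrightarrow> hausdorff1_outer E \<le> hausdorff1_outer F"
  unfolding hausdorff1_outer_def by (rule SUP_mono) (auto intro: hausdorff1_content_mono)

lemma hausdorff1_outer_empty: "hausdorff1_outer {} = 0"
proof -
  have "hausdorff1_outer {} \<le> 0"
    unfolding hausdorff1_outer_def by (rule SUP_least) (simp add: hausdorff1_content_empty)
  then show ?thesis by simp
qed

lemma hausdorff1_outer_UN_le:
  fixes E :: "nat \<Rightarrow> 'a::metric_space set"
  shows "hausdorff1_outer (\<Union>i. E i) \<le> (\<Sum>i. hausdorff1_outer (E i))"
proof -
  have "hausdorff1_content d (\<Union>i. E i) \<le> (\<Sum>i. hausdorff1_outer (E i))" if "0 < d" for d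
    by (rule order_trans[OF hausdorff1_content_UN_le])
       (intro suminf_le hausdorff1_content_le_outer that; simp)
  then show ?thesis unfolding hausdorff1_outer_def[of "\<Union>i. E i"] by (intro SUP_least) auto
qed

lemma hausdorff1_outer_measure_space:
  "outer_measure_space (Pow UNIV) (hausdorff1_outer :: 'a::metric_space set \<Rightarrow> ennreal)"
  unfolding outer_measure_space_def positive_def increasing_def countably_subadditive_def
  by (auto simp: hausdorff1_outer_empty intro: hausdorff1_outer_mono hausdorff1_outer_UN_le)

lemma hausdorff1_outer_Un_le:
  fixes A B :: "'a::metric_space set"
  shows "hausdorff1_outer (A \<union> B) \<le> hausdorff1_outer A + hausdorff1_outer B"
proof -
  interpret sigma_algebra "UNIV::'a set" "Pow UNIV" by (rule sigma_algebra_Pow)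
  have "subadditive (Pow UNIV) (hausdorff1_outer :: 'a set \<Rightarrow> ennreal)"
    using hausdorff1_outer_measure_space countably_subadditive_subadditive
    by (auto simp: outer_measure_space_def)
  then have "hausdorff1_outer (A \<union> (B - A)) \<le> hausdorff1_outer A + hausdorff1_outer (B - A)"
    unfolding subadditive_def by blast
  also have "\<dots> \<le> hausdorff1_outer A + hausdorff1_outer B"
    by (intro add_mono order_refl hausdorff1_outer_mono) auto
  finally show ?thesis by simp
qed

lemma hausdorff1_outer_sequential:
  "incseq (\<lambda>n. hausdorff1_content (1 / Suc n) E)"
  "hausdorff1_outer E = (SUP n. hausdorff1_content (1 / Suc n) E)"
proof -
  show "incseq (\<lambda>n. hausdorff1_content (1 / Suc n) E)"
    by (intro monoI hausdorff1_content_antimono) (simp add: frac_le)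
  show "hausdorff1_outer E = (SUP n. hausdorff1_content (1 / Suc n) E)"
  proof (rule antisym)
    have "\<exists>n. 1 / real (Suc n) \<le> d" if "0 < d" for d :: real
      using reals_Archimedean[OF that] by (metis inverse_eq_divide less_imp_le)
    then show "hausdorff1_outer E \<le> (SUP n. hausdorff1_content (1 / Suc n) E)"
      unfolding hausdorff1_outer_def
      by (intro SUP_mono) (auto intro: hausdorff1_content_antimono)
    show "(SUP n. hausdorff1_content (1 / Suc n) E) \<le> hausdorff1_outer E"
      by (intro SUP_least hausdorff1_content_le_outer) simp
  qed
qed

text \<open>A covering set that is shorter than the distance between the two sets meets only one of them,
  so a fine cover of the union splits into covers of the two parts.\<close>

lemma hausdorff1_content_separated:
  assumes sep: "\<And>x y. x \<in> A \<Longrightarrow> y \<in> B \<Longrightarrow> d < dist x y" and d: "0 \<le> d"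
  shows "hausdorff1_content d A + hausdorff1_content d B \<le> hausdorff1_content d (A \<union> B)"
  unfolding hausdorff1_content_def[of d "A \<union> B"]
proof (rule INF_greatest, clarify)
  fix C :: "nat \<Rightarrow> 'a set"
  assume C: "A \<union> B \<subseteq> (\<Union>i. C i)" "\<forall>i. bounded (C i) \<and> diameter (C i) \<le> d"
  define CA where "CA i = (if C i \<inter> A \<noteq> {} then C i else {})" for i
  define CB where "CB i = (if C i \<inter> B \<noteq> {} then C i else {})" for i
  have one: "C i \<inter> A = {} \<or> C i \<inter> B = {}" for i
  proof (rule ccontr)
    assume "\<not> ?thesis"
    then obtain x y where xy: "x \<in> A" "y \<in> B" "x \<in> C i" "y \<in> C i" by blast
    have "dist x y \<le> diameter (C i)" using xy C(2) by (intro diameter_bounded_bound) auto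
    with sep[OF xy(1,2)] C(2) show False by (meson linorder_not_less order_trans)
  qed
  have "hausdorff1_content d A \<le> (\<Sum>i. ennreal (diameter (CA i)))"
  proof (rule hausdorff1_content_le)
    show "A \<subseteq> (\<Union>i. CA i)" using C(1) by (fastforce simp: CA_def)
  qed (use C d in \<open>auto simp: CA_def\<close>)
  moreover have "hausdorff1_content d B \<le> (\<Sum>i. ennreal (diameter (CB i)))"
  proof (rule hausdorff1_content_le)
    show "B \<subseteq> (\<Union>i. CB i)" using C(1) by (fastforce simp: CB_def)
  qed (use C d in \<open>auto simp: CB_def\<close>)
  ultimately have "hausdorff1_content d A + hausdorff1_content d B
      \<le> (\<Sum>i. ennreal (diameter (CA i))) + (\<Sum>i. ennreal (diameter (CB i)))"
    by (rule add_mono)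
  also have "\<dots> = (\<Sum>i. ennreal (diameter (CA i)) + ennreal (diameter (CB i)))"
    by (rule suminf_add) auto
  also have "\<dots> \<le> (\<Sum>i. ennreal (diameter (C i)))"
    using one by (intro suminf_le) (auto simp: CA_def CB_def)
  finally show "hausdorff1_content d A + hausdorff1_content d B \<le> (\<Sum>i. ennreal (diameter (C i)))" .
qed

text \<open>Sets at positive distance are separated for all sufficiently fine covers, hence in the limit.\<close>

lemma hausdorff1_outer_separated:
  assumes sep: "\<And>x y. x \<in> A \<Longrightarrow> y \<in> B \<Longrightarrow> e \<le> dist x y" and e: "0 < e"
  shows "hausdorff1_outer A + hausdorff1_outer B \<le> hausdorff1_outer (A \<union> B)"
proof -
  obtain N where N: "1 / real (Suc N) < e"
    using reals_Archimedean[OF e] by (auto simp: inverse_eq_divide)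
  have bound: "hausdorff1_content (1 / Suc n) A + hausdorff1_content (1 / Suc n) B
      \<le> hausdorff1_outer (A \<union> B)" for n
  proof -
    define m where "m = max n N"
    have "1 / real (Suc m) \<le> 1 / real (Suc N)" "1 / real (Suc m) \<le> 1 / real (Suc n)"
      by (auto simp: m_def frac_le)
    then have "hausdorff1_content (1 / Suc n) A + hausdorff1_content (1 / Suc n) B
        \<le> hausdorff1_content (1 / Suc m) A + hausdorff1_content (1 / Suc m) B"
      by (intro add_mono hausdorff1_content_antimono)
    also have "\<dots> \<le> hausdorff1_content (1 / Suc m) (A \<union> B)"
      by (rule hausdorff1_content_separated)
        (use sep N \<open>1 / real (Suc m) \<le> 1 / real (Suc N)\<close> in \<open>force+\<close>)
    also have "\<dots> \<le> hausdorff1_outer (A \<union> B)"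
      by (rule hausdorff1_content_le_outer) simp
    finally show ?thesis .
  qed
  have "hausdorff1_outer A + hausdorff1_outer B
      = (SUP n. hausdorff1_content (1 / Suc n) A + hausdorff1_content (1 / Suc n) B)"
    unfolding hausdorff1_outer_sequential(2)[of A] hausdorff1_outer_sequential(2)[of B]
    by (rule ennreal_SUP_add[symmetric]; rule hausdorff1_outer_sequential(1))
  also have "\<dots> \<le> hausdorff1_outer (A \<union> B)" by (rule SUP_least) (rule bound)
  finally show ?thesis .
qed

text \<open>Caratheodory's criterion: the parts \<open>A n\<close> of \<open>X - F\<close> at distance at least \<open>1 / (n + 1)\<close> from
  \<open>F\<close> can be separated from \<open>F\<close>. Their measures converge to that of \<open>X - F\<close>, because the layers
  \<open>A (n + 1) - A n\<close> with even \<open>n\<close>, and likewise those with odd \<open>n\<close>, are separated from each other,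
  so that the measures of all layers have a finite sum.\<close>

lemma closed_hausdorff1_outer_splits:
  fixes F :: "'a::metric_space set"
  assumes F: "closed F"
  shows "hausdorff1_outer (X \<inter> F) + hausdorff1_outer (X - F) \<le> hausdorff1_outer X"
proof (cases "F = {} \<or> hausdorff1_outer X = top")
  case True
  then show ?thesis by (auto simp: hausdorff1_outer_empty)
next
  case False
  let ?H = "hausdorff1_outer :: 'a set \<Rightarrow> ennreal"
  have F0: "F \<noteq> {}" and fin: "?H X < top" using False by (auto simp: less_top)
  define A where "A n = {x \<in> X. 1 / Suc n \<le> infdist x F}" for n :: nat
  define D where "D n = A (Suc n) - A n" for n
  have A_mono: "A m \<subseteq> A n" if "m \<le> n" for m n
  proof -
    have "1 / real (Suc n) \<le> 1 / real (Suc m)" using that by (simp add: frac_le)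
    then show ?thesis by (auto simp: A_def simp del: of_nat_Suc)
  qed
  have A_Un: "X - F \<subseteq> (\<Union>n. A n)"
  proof
    fix x assume "x \<in> X - F"
    then have "0 < infdist x F" using F F0 by (simp add: infdist_pos_not_in_closed)
    then obtain n where "1 / real (Suc n) < infdist x F"
      using reals_Archimedean by (metis inverse_eq_divide)
    with \<open>x \<in> X - F\<close> show "x \<in> (\<Union>n. A n)" by (auto simp: A_def intro!: exI[of _ n])
  qed
  have layer: "infdist x F < 1 / real (Suc n)" if "x \<in> D n" for x n
    using that by (auto simp: D_def A_def simp del: of_nat_Suc)
  have D_sub: "D n \<subseteq> A (Suc n)" for n by (auto simp: D_def)
  have A_sep: "1 / real (Suc n) \<le> dist x y" if "x \<in> A n" "y \<in> F" for x y n
    using that infdist_le[of y F x] by (auto simp: A_def dist_commute simp del: of_nat_Suc)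
  have AD_sep: "1 / real (Suc n) - 1 / real (Suc (Suc n)) \<le> dist x y"
    if "x \<in> A n" "y \<in> D m" "Suc n \<le> m" for x y n m
  proof -
    have "1 / real (Suc m) \<le> 1 / real (Suc (Suc n))" using that by (simp add: frac_le)
    then show ?thesis
      using infdist_triangle[of x F y] layer[OF that(2)] that(1) by (auto simp: A_def dist_commute)
  qed
  have gap: "0 < 1 / real (Suc n) - 1 / real (Suc (Suc n))" for n by (simp add: frac_less2)
  have alternate: "(\<Sum>k<N. ?H (D (2 * k + j))) \<le> ?H X" for N j
  proof -
    have "(\<Sum>k<N. ?H (D (2 * k + j))) \<le> ?H (\<Union>k<N. D (2 * k + j))" for N
    proof (induction N)
      case (Suc N)
      have "(\<Sum>k<Suc N. ?H (D (2 * k + j))) \<le> ?H (\<Union>k<N. D (2 * k + j)) + ?H (D (2 * N + j))"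
        using Suc by (simp add: add_mono)
      also have "\<dots> \<le> ?H ((\<Union>k<N. D (2 * k + j)) \<union> D (2 * N + j))"
      proof (cases "N = 0")
        case True then show ?thesis by (simp add: hausdorff1_outer_empty)
      next
        case False
        \<comment> \<open>the earlier layers lie in \<open>A n\<close>, the new one outside \<open>A (n + 1)\<close>\<close>
        define n where "n = 2 * (N - 1) + j + 1"
        show ?thesis
        proof (rule hausdorff1_outer_separated[OF _ gap[of n]])
          fix x y assume x: "x \<in> (\<Union>k<N. D (2 * k + j))" and y: "y \<in> D (2 * N + j)"
          from x obtain k where k: "k < N" "x \<in> A (Suc (2 * k + j))" using D_sub by auto
          have "Suc (2 * k + j) \<le> n" using k(1) unfolding n_def by linarith
          then have "x \<in> A n" using k(2) A_mono by blast
          moreover have "Suc n \<le> 2 * N + j" using False by (auto simp: n_def)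
          ultimately show "1 / real (Suc n) - 1 / real (Suc (Suc n)) \<le> dist x y"
            using AD_sep y by blast
        qed
      qed
      also have "\<dots> = ?H (\<Union>k<Suc N. D (2 * k + j))" by (simp add: lessThan_Suc Un_commute)
      finally show ?case .
    qed simp
    also have "?H (\<Union>k<N. D (2 * k + j)) \<le> ?H X"
      by (rule hausdorff1_outer_mono) (auto simp: D_def A_def)
    finally show ?thesis .
  qed
  have sum_bound: "(\<Sum>k<N. ?H (D k)) \<le> ?H X + ?H X" for N
  proof -
    have "(\<Sum>k<N. ?H (D k)) \<le> (\<Sum>k<2 * N. ?H (D k))" by (rule sum_mono2) auto
    also have "\<dots> = (\<Sum>k<N. ?H (D (2 * k + 0))) + (\<Sum>k<N. ?H (D (2 * k + 1)))"
      by (induction N) (auto simp: algebra_simps)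
    also have "\<dots> \<le> ?H X + ?H X" by (intro add_mono alternate)
    finally show ?thesis .
  qed
  have sum_fin: "(\<Sum>k. ?H (D k)) < top"
  proof -
    have "(\<Sum>k. ?H (D k)) \<le> ?H X + ?H X"
      unfolding suminf_eq_SUP by (rule SUP_least) (rule sum_bound)
    also have "\<dots> < top" using fin by (simp add: less_top)
    finally show ?thesis .
  qed
  have cover: "?H (X - F) \<le> ?H (A n) + (\<Sum>k. ?H (D (k + n)))" for n
  proof -
    have "X - F \<subseteq> A n \<union> (\<Union>k. D (k + n))"
    proof
      fix x assume "x \<in> X - F"
      then obtain m where m: "x \<in> A m" using A_Un by blast
      define l where "l = (LEAST m. x \<in> A m)"
      have l: "x \<in> A l" "\<And>i. i < l \<Longrightarrow> x \<notin> A i"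
        unfolding l_def using m by (auto intro: LeastI dest: not_less_Least)
      show "x \<in> A n \<union> (\<Union>k. D (k + n))"
      proof (cases "l \<le> n")
        case True then show ?thesis using A_mono l by blast
      next
        case False
        then have "x \<in> D ((l - 1 - n) + n)" using l by (cases l) (auto simp: D_def)
        then show ?thesis by blast
      qed
    qed
    then have "?H (X - F) \<le> ?H (A n \<union> (\<Union>k. D (k + n)))" by (rule hausdorff1_outer_mono)
    also have "\<dots> \<le> ?H (A n) + ?H (\<Union>k. D (k + n))" by (rule hausdorff1_outer_Un_le)
    also have "\<dots> \<le> ?H (A n) + (\<Sum>k. ?H (D (k + n)))"
      by (intro add_mono order_refl hausdorff1_outer_UN_le)
    finally show ?thesis .
  qed
  have split_n: "?H (X \<inter> F) + ?H (A n) \<le> ?H X" for n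
  proof -
    have "?H (X \<inter> F) + ?H (A n) \<le> ?H (X \<inter> F \<union> A n)"
    proof (rule hausdorff1_outer_separated)
      show "1 / real (Suc n) \<le> dist x y" if "x \<in> X \<inter> F" "y \<in> A n" for x y
        using A_sep[of y n x] that by (metis IntD2 dist_commute)
    qed simp
    also have "\<dots> \<le> ?H X" by (rule hausdorff1_outer_mono) (auto simp: A_def)
    finally show ?thesis .
  qed
  show ?thesis
  proof (rule ennreal_le_epsilon)
    fix e :: real assume "0 < e"
    have "(\<lambda>n. \<Sum>k<n. ?H (D k)) \<longlonglongrightarrow> (\<Sum>k. ?H (D k))"
      by (rule summable_LIMSEQ) simp
    then have "\<exists>n. (\<Sum>k. ?H (D k)) \<le> (\<Sum>k<n. ?H (D k)) + e"
    proof (cases "(\<Sum>k. ?H (D k)) = 0")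
      case False
      then have "(\<Sum>k. ?H (D k)) - e < (\<Sum>k. ?H (D k))"
        using sum_fin \<open>0 < e\<close> by (intro ennreal_between) (auto simp: less_top zero_less_iff_neq_zero)
      then obtain n where "(\<Sum>k. ?H (D k)) - e < (\<Sum>k<n. ?H (D k))"
        using order_tendstoD(1)[OF \<open>(\<lambda>n. \<Sum>k<n. ?H (D k)) \<longlonglongrightarrow> _\<close>]
        by (auto simp: eventually_sequentially)
      then have "(\<Sum>k. ?H (D k)) - e \<le> (\<Sum>k<n. ?H (D k))" by (rule less_imp_le)
      then show ?thesis by (auto simp: ennreal_minus_le_iff add.commute)
    qed simp
    then obtain n where n: "(\<Sum>k. ?H (D k)) \<le> (\<Sum>k<n. ?H (D k)) + e" by blast
    have fin_n: "(\<Sum>k<n. ?H (D k)) < top" using sum_bound[of n] fin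
      by (meson ennreal_add_less_top le_less_trans)
    have "(\<Sum>k<n. ?H (D k)) + (\<Sum>k. ?H (D (k + n))) \<le> (\<Sum>k<n. ?H (D k)) + e"
      using n suminf_offset[of "\<lambda>k. ?H (D k)" n] by (simp add: add.commute)
    then have "(\<Sum>k<n. ?H (D k)) = top \<or> (\<Sum>k. ?H (D (k + n))) \<le> e"
      unfolding ennreal_add_left_cancel_le by (simp only: infinity_ennreal_def)
    then have tail: "(\<Sum>k. ?H (D (k + n))) \<le> e" using less_imp_neq[OF fin_n] by blast
    have "?H (X \<inter> F) + ?H (X - F) \<le> ?H (X \<inter> F) + (?H (A n) + e)"
      using order_trans[OF cover add_left_mono[OF tail]] by (rule add_left_mono)
    also have "\<dots> \<le> ?H X + e"
      using split_n[of n] by (simp add: add.assoc[symmetric] add_right_mono)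
    finally show "?H (X \<inter> F) + ?H (X - F) \<le> ?H X + e" .
  qed
qed

lemma measure_space_hausdorff1_outer:
  "measure_space UNIV (sets borel) (hausdorff1_outer :: 'a::metric_space set \<Rightarrow> ennreal)"
proof -
  let ?H = "hausdorff1_outer :: 'a set \<Rightarrow> ennreal"
  define L where "L = lambda_system UNIV (Pow UNIV) ?H"
  interpret sigma_algebra "UNIV :: 'a set" "Pow UNIV" by (rule sigma_algebra_Pow)
  have ms: "measure_space UNIV L ?H"
    unfolding L_def by (rule caratheodory_lemma[OF hausdorff1_outer_measure_space])
  have "F \<in> L" if "closed F" for F :: "'a set"
    unfolding L_def lambda_system_eq
    using closed_hausdorff1_outer_splits[OF that]
      hausdorff1_outer_Un_le[where A = "x \<inter> F" and B = "x - F" for x]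
    by (auto simp: Int_Diff_Un intro!: antisym)
  then have "sigma_sets UNIV {F. closed F} \<subseteq> L"
    using ms by (intro sigma_algebra.sigma_sets_subset) (auto simp: measure_space_def)
  then have "sets (borel :: 'a measure) \<subseteq> L" by (simp add: borel_eq_closed)
  moreover have "sigma_algebra UNIV (sets (borel :: 'a measure))"
    using sets.sigma_algebra_axioms[of "borel :: 'a measure"] by simp
  ultimately show ?thesis
    using ms unfolding measure_space_def positive_def countably_additive_def by blast
qed

lemma sets_hausdorff1 [measurable_cong, simp]:
  "sets (hausdorff1 :: 'a::metric_space measure) = sets borel"
proof -
  have "sigma_sets UNIV (sets (borel :: 'a measure)) = sets borel"
    using sets.sigma_sets_eq[of "borel :: 'a measure"] unfolding space_borel .
  then show ?thesis unfolding hausdorff1_def by (simp add: sets_measure_of_conv)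
qed

lemma space_hausdorff1 [simp]: "space hausdorff1 = UNIV"
  unfolding hausdorff1_def by (simp add: space_measure_of_conv)

lemma emeasure_hausdorff1:
  fixes A :: "'a::metric_space set"
  assumes "A \<in> sets borel"
  shows "emeasure hausdorff1 A = hausdorff1_outer A"
proof (rule emeasure_measure_of[OF hausdorff1_def])
  show "A \<in> sets hausdorff1" using assms by simp
qed (use measure_space_hausdorff1_outer[where ?'a = 'a] in \<open>auto simp: measure_space_def\<close>)

lemma diameter_le_metric:
  assumes "0 \<le> d" "\<And>x y. x \<in> S \<Longrightarrow> y \<in> S \<Longrightarrow> dist x y \<le> d"
  shows "diameter S \<le> d"
  unfolding diameter_def using assms by (auto intro!: cSUP_least)

text \<open>Lower bound: the preimage of a covering set of diameter \<open>r\<close> lies in an interval of length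
  \<open>r / L\<close>.\<close>

lemma hausdorff1_outer_similarity_ge:
  fixes g :: "real \<Rightarrow> 'a::metric_space"
  assumes g: "\<And>s t. dist (g s) (g t) = L * \<bar>s - t\<bar>" and L: "0 < L" and A: "A \<in> sets borel"
  shows "ennreal L * emeasure lborel A \<le> hausdorff1_outer (g ` A)"
proof -
  have "ennreal L * emeasure lborel A \<le> hausdorff1_content 1 (g ` A)"
    unfolding hausdorff1_content_def
  proof (rule INF_greatest, clarify)
    fix C :: "nat \<Rightarrow> 'a set"
    assume C: "g ` A \<subseteq> (\<Union>i. C i)" "\<forall>i. bounded (C i) \<and> diameter (C i) \<le> 1"
    have close: "\<bar>s - t\<bar> \<le> diameter (C i) / L" if "g s \<in> C i" "g t \<in> C i" for s t i
      using diameter_bounded_bound[OF _ that] C(2) g[of s t] L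
      by (simp add: pos_le_divide_eq mult.commute)
    have I: "\<exists>a b. g -` C i \<subseteq> {a..b} \<and> L * (b - a) \<le> diameter (C i) \<and> a \<le> b" for i
    proof (cases "g -` C i = {}")
      case True
      then show ?thesis using C(2) by (intro exI[of _ 0]) (auto simp: diameter_ge_0)
    next
      case False
      let ?P = "g -` C i"
      obtain t0 where t0: "g t0 \<in> C i" using False by auto
      have bdd: "bdd_below ?P" "bdd_above ?P"
        using close[of _ i t0] t0
        by (auto intro!: bdd_belowI[of _ "t0 - diameter (C i) / L"]
            bdd_aboveI[of _ "t0 + diameter (C i) / L"] simp: abs_le_iff) (force+)
      have "Sup ?P \<le> t + diameter (C i) / L" if "t \<in> ?P" for t
        using close[of _ i t] that False by (intro cSup_least) (auto simp: abs_le_iff diff_le_eq add.commute)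
      then have "Sup ?P - diameter (C i) / L \<le> Inf ?P"
        using False by (intro cInf_greatest) (auto simp: algebra_simps)
      then have "L * (Sup ?P - Inf ?P) \<le> diameter (C i)"
        using L by (simp add: field_simps)
      moreover have "?P \<subseteq> {Inf ?P..Sup ?P}"
        using bdd by (simp add: subset_eq cInf_lower cSup_upper)
      moreover have "Inf ?P \<le> Sup ?P" by (rule cInf_le_cSup[OF False bdd(2) bdd(1)])
      ultimately show ?thesis by blast
    qed
    then obtain a b where ab: "\<And>i. g -` C i \<subseteq> {a i..b i}"
      "\<And>i. L * (b i - a i) \<le> diameter (C i)" "\<And>i. a i \<le> b i" by metis
    have "A \<subseteq> (\<Union>i. {a i..b i})"
    proof
      fix t assume "t \<in> A"
      then obtain i where "t \<in> g -` C i" using C(1) by blast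
      then show "t \<in> (\<Union>i. {a i..b i})" using ab(1) by blast
    qed
    then have "emeasure lborel A \<le> emeasure lborel (\<Union>i. {a i..b i})"
      by (rule emeasure_mono) auto
    also have "\<dots> \<le> (\<Sum>i. emeasure lborel {a i..b i})"
      by (rule emeasure_subadditive_countably) auto
    finally have "ennreal L * emeasure lborel A \<le> ennreal L * (\<Sum>i. emeasure lborel {a i..b i})"
      by (rule mult_left_mono) simp
    also have "\<dots> = (\<Sum>i. ennreal (L * (b i - a i)))"
      using ab(3) L by (simp add: ennreal_mult flip: ennreal_suminf_cmult)
    also have "\<dots> \<le> (\<Sum>i. ennreal (diameter (C i)))"
      by (intro suminf_le ennreal_leI ab(2)) auto
    finally show "ennreal L * emeasure lborel A \<le> (\<Sum>i. ennreal (diameter (C i)))" .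
  qed
  also have "\<dots> \<le> hausdorff1_outer (g ` A)" by (rule hausdorff1_content_le_outer) simp
  finally show ?thesis .
qed

text \<open>Upper bound: a subdivision of the interval into sufficiently many equal pieces is a fine cover.\<close>

lemma hausdorff1_outer_similarity_le:
  fixes g :: "real \<Rightarrow> 'a::metric_space"
  assumes g: "\<And>s t. dist (g s) (g t) = L * \<bar>s - t\<bar>" and L: "0 < L" and ab: "a \<le> b"
  shows "hausdorff1_outer (g ` {a..b}) \<le> ennreal (L * (b - a))"
  unfolding hausdorff1_outer_def
proof (rule SUP_least)
  fix d :: real assume "d \<in> {0<..}"
  then have d: "0 < d" by simp
  obtain n :: nat where "L * (b - a) / d < real n" using reals_Archimedean2 by blast
  then have "L * (b - a) < d * real n" using d by (simp add: field_simps)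
  moreover have "0 \<le> L * (b - a)" using L ab by simp
  ultimately have n0: "0 < n" using d by (intro gr0I) auto
  with \<open>L * (b - a) < d * real n\<close> have n: "0 < n" "L * (b - a) / n \<le> d"
    by (auto simp: pos_divide_le_eq)
  define c where "c i = a + real i * ((b - a) / n)" for i
  define C where "C i = (if i < n then g ` {c i..c (Suc i)} else {})" for i
  have c_step: "c (Suc i) - c i = (b - a) / n" for i
    by (simp add: c_def distrib_right add_divide_distrib)
  have dist_le: "dist x y \<le> L * (b - a) / n" if "x \<in> C i" "y \<in> C i" for x y i
  proof -
    obtain s t where st: "x = g s" "y = g t" "s \<in> {c i..c (Suc i)}" "t \<in> {c i..c (Suc i)}"
      using \<open>x \<in> C i\<close> \<open>y \<in> C i\<close> by (auto simp: C_def split: if_splits)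
    then have "\<bar>s - t\<bar> \<le> (b - a) / n" using c_step[of i] by (auto simp: abs_le_iff)
    then have "L * \<bar>s - t\<bar> \<le> L * ((b - a) / n)" using L by (intro mult_left_mono) auto
    then show ?thesis using st g by simp
  qed
  have diam: "diameter (C i) \<le> L * (b - a) / n" for i
    by (rule diameter_le_metric) (use dist_le L ab in auto)
  have bdd: "bounded (C i)" for i
    unfolding bounded_two_points using dist_le by blast
  have "{a..b} \<subseteq> (\<Union>i<n. {c i..c (Suc i)})"
  proof
    fix t assume t: "t \<in> {a..b}"
    have "\<exists>i<m. t \<in> {c i..c (Suc i)}" if "t \<le> c m" "0 < m" for m
      using that
    proof (induction m)
      case (Suc m)
      show ?case
      proof (cases "t \<le> c m \<and> 0 < m")
        case True
        then show ?thesis using Suc.IH by (auto intro: less_SucI)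
      next
        case False
        then have "c m \<le> t" using t by (auto simp: c_def)
        then show ?thesis using Suc.prems by auto
      qed
    qed simp
    moreover have "c n = b" using n by (simp add: c_def)
    ultimately show "t \<in> (\<Union>i<n. {c i..c (Suc i)})" using n t by auto
  qed
  then have "g ` {a..b} \<subseteq> (\<Union>i. C i)" by (fastforce simp: C_def)
  then have "hausdorff1_content d (g ` {a..b}) \<le> (\<Sum>i. ennreal (diameter (C i)))"
    by (rule hausdorff1_content_le) (use bdd order_trans[OF diam n(2)] in auto)
  also have "\<dots> = (\<Sum>i<n. ennreal (diameter (C i)))"
    by (rule suminf_finite) (auto simp: C_def)
  also have "\<dots> \<le> (\<Sum>i<n. ennreal (L * (b - a) / n))"
    by (intro sum_mono ennreal_leI diam)
  also have "\<dots> = ennreal (L * (b - a))"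
    using n L ab by (simp add: ennreal_of_nat_eq_real_of_nat flip: ennreal_mult)
  finally show "hausdorff1_content d (g ` {a..b}) \<le> ennreal (L * (b - a))" .
qed

text \<open>The left inverse \<open>h\<close> is there to make images of Borel sets Borel sets.\<close>

locale line_parametrization =
  fixes g :: "real \<Rightarrow> 'a::{metric_space, second_countable_topology}" and h :: "'a \<Rightarrow> real" and L :: real
  assumes dist_g: "\<And>s t. dist (g s) (g t) = L * \<bar>s - t\<bar>" and L: "0 < L"
    and h: "h \<in> borel_measurable borel" and hg: "\<And>t. h (g t) = t"
begin

lemma continuous_g: "continuous_on UNIV g"
proof (rule continuous_onI)
  fix x e :: real assume "0 < e"
  then show "\<exists>d>0. \<forall>x'\<in>UNIV. dist x' x < d \<longrightarrow> dist (g x') (g x) \<le> e"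
    using L by (intro exI[of _ "e / L"]) (auto simp: dist_g dist_real_def field_simps)
qed

lemma measurable_g [measurable]: "g \<in> borel_measurable borel"
  by (rule borel_measurable_continuous_onI[OF continuous_g])

lemma image_eq: "g ` A = {z. h z \<in> A \<and> g (h z) = z}"
  using hg by force

lemma image_measurable: "A \<in> sets borel \<Longrightarrow> g ` A \<in> sets borel"
proof -
  note h [measurable]
  assume [measurable]: "A \<in> sets borel"
  have "{z \<in> space borel. h z \<in> A \<and> g (h z) = z} \<in> sets borel" by measurable
  then show ?thesis by (simp add: image_eq)
qed

text \<open>Both sides are additive, the left one is at least the right one by the covering argument, and
  for an interval they agree.\<close>

lemma emeasure_image:
  assumes A: "A \<in> sets borel" "A \<subseteq> {a..b}"
  shows "emeasure hausdorff1 (g ` A) = ennreal L * emeasure lborel A"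
proof (cases "a \<le> b")
  case True
  let ?H = "\<lambda>A. emeasure hausdorff1 (g ` A)"
  let ?B = "{a..b} - A"
  have ge: "ennreal L * emeasure lborel X \<le> ?H X" if "X \<in> sets borel" for X
    using hausdorff1_outer_similarity_ge[OF dist_g L that]
    by (simp add: emeasure_hausdorff1 image_measurable that)
  have inj: "inj g" using hg by (metis injI)
  have "?H A + ?H ?B = ?H {a..b}"
  proof (subst plus_emeasure)
    show "g ` A \<inter> g ` ?B = {}" using inj by (auto dest: injD)
    have "g ` A \<union> g ` ?B = g ` {a..b}" using A by blast
    then show "emeasure hausdorff1 (g ` A \<union> g ` ?B) = ?H {a..b}" by simp
  qed (use A image_measurable in auto)
  also have "\<dots> \<le> ennreal (L * (b - a))"
    using hausdorff1_outer_similarity_le[OF dist_g L True]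
    by (simp add: emeasure_hausdorff1 image_measurable)
  also have "\<dots> = ennreal L * emeasure lborel {a..b}"
    using True L by (simp add: ennreal_mult)
  also have "\<dots> = ennreal L * (emeasure lborel A + emeasure lborel ?B)"
    using A by (subst plus_emeasure) (auto simp: Un_absorb1)
  finally have le: "?H A + ?H ?B \<le> ennreal L * emeasure lborel A + ennreal L * emeasure lborel ?B"
    by (simp add: distrib_left)
  have fin: "ennreal L * emeasure lborel ?B < top"
  proof -
    have "emeasure lborel ?B \<le> emeasure lborel {a..b}" using A by (intro emeasure_mono) auto
    also have "\<dots> < top" using True by simp
    finally show ?thesis by (simp add: ennreal_mult_less_top)
  qed
  have "?H A + ennreal L * emeasure lborel ?B \<le> ?H A + ?H ?B"
    using A by (intro add_left_mono ge) auto
  from order_trans[OF this le] have "ennreal L * emeasure lborel ?B + ?H A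
      \<le> ennreal L * emeasure lborel ?B + ennreal L * emeasure lborel A"
    by (simp only: add.commute)
  then have "ennreal L * emeasure lborel ?B = \<infinity> \<or> ?H A \<le> ennreal L * emeasure lborel A"
    by (simp only: ennreal_add_left_cancel_le)
  then have "?H A \<le> ennreal L * emeasure lborel A"
    using fin by (metis infinity_ennreal_def less_irrefl)
  then show ?thesis using ge[OF A(1)] by (rule antisym)
next
  case False
  then have "A = {}" using A by auto
  then show ?thesis by simp
qed

lemma density_image:
  assumes D: "D \<in> sets borel" "D \<subseteq> {a..b}"
  shows "density hausdorff1 (indicator (g ` D)) = distr (density lborel (\<lambda>t. ennreal L * indicator D t)) borel g"
    (is "?M = ?N")
proof (rule measure_eqI)
  fix B assume "B \<in> sets ?M"
  then have B [measurable]: "B \<in> sets borel" by simp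
  note D(1) [measurable] image_measurable [measurable]
  have pre [measurable]: "g -` B \<in> sets borel"
    using measurable_sets[OF measurable_g B] by simp
  have "emeasure ?M B = emeasure hausdorff1 (g ` D \<inter> B)"
    by (subst emeasure_density) (auto simp flip: indicator_inter_arith)
  also have "g ` D \<inter> B = g ` (D \<inter> g -` B)" by auto
  also have "emeasure hausdorff1 \<dots> = ennreal L * emeasure lborel (D \<inter> g -` B)"
    by (rule emeasure_image[of _ a b]) (use D in auto)
  also have "\<dots> = (\<integral>\<^sup>+t. ennreal L * indicator (D \<inter> g -` B) t \<partial>lborel)"
    by (subst nn_integral_cmult) auto
  also have "\<dots> = (\<integral>\<^sup>+t. ennreal L * indicator D t * indicator (g -` B) t \<partial>lborel)"
    by (intro nn_integral_cong) (auto simp: indicator_def)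
  also have "\<dots> = emeasure ?N B"
    by (subst emeasure_distr) (auto simp: emeasure_density)
  finally show "emeasure ?M B = emeasure ?N B" .
qed simp

lemma
  fixes f :: "'a \<Rightarrow> real"
  assumes D: "D \<in> sets borel" "D \<subseteq> {a..b}" and f: "f \<in> borel_measurable borel"
  shows integrable_image_iff:
      "set_integrable hausdorff1 (g ` D) f \<longleftrightarrow> set_integrable lborel D (\<lambda>t. L * f (g t))"
    and integral_image: "(LINT z:g ` D|hausdorff1. f z) = (LINT t:D|lborel. L * f (g t))"
proof -
  note D(1) [measurable] image_measurable [measurable] f [measurable]
  have L0: "0 \<le> L" using L by simp
  have den: "density hausdorff1 (\<lambda>z. ennreal (indicator (g ` D) z))
      = distr (density lborel (\<lambda>t. ennreal (L * indicator D t))) borel g"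
    using density_image[OF D] L0 by (simp add: ennreal_indicator ennreal_mult')
  have "set_integrable hausdorff1 (g ` D) f \<longleftrightarrow> integrable (density hausdorff1 (\<lambda>z. ennreal (indicator (g ` D) z))) f"
    unfolding set_integrable_def by (subst integrable_density) auto
  also have "\<dots> \<longleftrightarrow> integrable lborel (\<lambda>t. (L * indicator D t) *\<^sub>R f (g t))"
    unfolding den using L0 by (subst integrable_distr_eq) (auto simp: integrable_density)
  also have "\<dots> \<longleftrightarrow> set_integrable lborel D (\<lambda>t. L * f (g t))"
    unfolding set_integrable_def by (simp add: ac_simps)
  finally show "set_integrable hausdorff1 (g ` D) f \<longleftrightarrow> set_integrable lborel D (\<lambda>t. L * f (g t))" .
  have "(LINT z:g ` D|hausdorff1. f z) = integral\<^sup>L (density hausdorff1 (\<lambda>z. ennreal (indicator (g ` D) z))) f"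
    unfolding set_lebesgue_integral_def by (subst integral_density) auto
  also have "\<dots> = (\<integral>t. (L * indicator D t) *\<^sub>R f (g t) \<partial>lborel)"
    unfolding den using L0 by (subst integral_distr) (auto simp: integral_density)
  also have "\<dots> = (LINT t:D|lborel. L * f (g t))"
    unfolding set_lebesgue_integral_def by (simp add: ac_simps)
  finally show "(LINT z:g ` D|hausdorff1. f z) = (LINT t:D|lborel. L * f (g t))" .
qed

end

lemma emeasure_hausdorff1_finite: "finite A \<Longrightarrow> emeasure hausdorff1 (A :: 'a::metric_space set) = 0"
proof -
  assume "finite A"
  have sing: "emeasure hausdorff1 {x} = 0" for x :: 'a
  proof -
    have "hausdorff1_content d {x} \<le> 0" if "0 < d" for d
      using hausdorff1_content_le[of "{x}" "\<lambda>i. {x}" d] that by simp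
    then have "hausdorff1_outer {x} \<le> 0" unfolding hausdorff1_outer_def by (intro SUP_least) auto
    then show ?thesis by (simp add: emeasure_hausdorff1)
  qed
  have "A \<in> null_sets hausdorff1"
    using null_sets_UN'[OF countable_finite[OF \<open>finite A\<close>], of "\<lambda>x. {x}" hausdorff1] sing
    by (simp add: null_sets_def)
  then show ?thesis by auto
qed

lemma hausdorff1_outer_isometry_le:
  fixes s :: "'a::metric_space \<Rightarrow> 'a"
  assumes s: "\<And>x y. dist (s x) (s y) = dist x y"
  shows "hausdorff1_outer (s ` A) \<le> hausdorff1_outer A"
proof -
  have "hausdorff1_content d (s ` A) \<le> hausdorff1_content d A" for d
    unfolding hausdorff1_content_def[of d A]
  proof (rule INF_greatest, clarify)
    fix C :: "nat \<Rightarrow> 'a set"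
    assume C: "A \<subseteq> (\<Union>i. C i)" "\<forall>i. bounded (C i) \<and> diameter (C i) \<le> d"
    have diam: "diameter (s ` C i) \<le> diameter (C i)" for i
      by (rule diameter_le_metric) (use C(2) s diameter_bounded_bound[of "C i"] in \<open>auto simp: diameter_ge_0\<close>)
    have bdd: "bounded (s ` X)" if "bounded X" for X
      using that s unfolding bounded_two_points by auto
    have "hausdorff1_content d (s ` A) \<le> (\<Sum>i. ennreal (diameter (s ` C i)))"
    proof (rule hausdorff1_content_le)
      show "s ` A \<subseteq> (\<Union>i. s ` C i)" using C(1) by fastforce
    qed (use C bdd order_trans[OF diam] in auto)
    also have "\<dots> \<le> (\<Sum>i. ennreal (diameter (C i)))"
      by (intro suminf_le ennreal_leI diam) auto
    finally show "hausdorff1_content d (s ` A) \<le> (\<Sum>i. ennreal (diameter (C i)))" .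
  qed
  then show ?thesis unfolding hausdorff1_outer_def by (intro SUP_mono) auto
qed

lemma integral_hausdorff1_isometry:
  fixes s :: "'a::metric_space \<Rightarrow> 'a" and f :: "'a \<Rightarrow> real"
  assumes s: "\<And>x y. dist (s x) (s y) = dist x y" "\<And>x. s (s x) = x"
    and f: "f \<in> borel_measurable borel" and S: "S \<in> sets borel"
  shows "(LINT z:s ` S|hausdorff1. f z) = (LINT z:S|hausdorff1. f (s z))"
proof -
  have "continuous_on UNIV s"
    by (rule continuous_onI) (use s(1) in \<open>auto intro: less_imp_le\<close>)
  then have [measurable]: "s \<in> borel_measurable borel" by (rule borel_measurable_continuous_onI)
  note f [measurable] S [measurable]
  have im: "s ` X = s -` X" for X
  proof
    show "s -` X \<subseteq> s ` X" using s(2) by (auto intro!: image_eqI[where x = "s y" for y])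
  qed (use s(2) in auto)
  have eq: "hausdorff1_outer (s ` X) = hausdorff1_outer X" for X
    using hausdorff1_outer_isometry_le[OF s(1), of X] hausdorff1_outer_isometry_le[OF s(1), of "s ` X"] s(2)
    by (auto simp: image_image)
  have distr: "distr hausdorff1 borel s = hausdorff1"
  proof (rule measure_eqI)
    fix X assume "X \<in> sets (distr hausdorff1 borel s)"
    then have [measurable]: "X \<in> sets borel" by simp
    have "s -` X \<in> sets borel" using measurable_sets[of s borel borel X] by simp
    then show "emeasure (distr hausdorff1 borel s) X = emeasure hausdorff1 X"
      using eq[of X] by (subst emeasure_distr) (auto simp: emeasure_hausdorff1 im)
  qed simp
  have [measurable]: "s ` S \<in> sets borel"
    unfolding im using measurable_sets[of s borel borel S] by simp
  have "(LINT z:s ` S|hausdorff1. f z) = integral\<^sup>L (distr hausdorff1 borel s) (\<lambda>z. indicator (s ` S) z *\<^sub>R f z)"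
    unfolding distr set_lebesgue_integral_def ..
  also have "\<dots> = (\<integral>z. indicator (s ` S) (s z) *\<^sub>R f (s z) \<partial>hausdorff1)"
    by (rule integral_distr) (auto simp: measurable_cong_sets[OF sets_hausdorff1 refl])
  also have "\<dots> = (LINT z:S|hausdorff1. f (s z))"
    unfolding set_lebesgue_integral_def using s(2)
    by (intro Bochner_Integration.integral_cong) (auto simp: indicator_def im)
  finally show ?thesis .
qed

section \<open>Outward normals\<close>

lemma is_outward_normalE:
  assumes "is_outward_normal S z n"
  obtains e where "norm n = 1" "0 < e" "\<And>q. dist z q < e \<Longrightarrow> q \<in> S \<longleftrightarrow> (q - z) \<bullet> n < 0"
  using assms unfolding is_outward_normal_def by (auto simp: set_eq_iff)

lemma small_multiple_in_ball:
  fixes v :: "'a::real_normed_vector"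
  assumes "0 < e"
  obtains t where "0 < t" "dist z (z + t *\<^sub>R v) < e" "dist z (z - t *\<^sub>R v) < e"
proof
  have "0 < norm v + 1" by (simp add: add_nonneg_pos)
  moreover have "norm v < norm v + 1" by simp
  ultimately have "norm v / (norm v + 1) < 1" by (simp only: divide_less_eq_1) simp
  then have "e * (norm v / (norm v + 1)) < e * 1" using assms by (intro mult_strict_left_mono)
  then show "dist z (z + (e / (norm v + 1)) *\<^sub>R v) < e" "dist z (z - (e / (norm v + 1)) *\<^sub>R v) < e"
    using assms by (simp_all add: dist_norm)
  show "0 < e / (norm v + 1)" using assms \<open>0 < norm v + 1\<close> by simp
qed

text \<open>A small step in the direction \<open>n - m\<close> would leave one of the two half discs and enter the other.\<close>

lemma is_outward_normal_unique:
  assumes n: "is_outward_normal S z n" and m: "is_outward_normal S z m"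
  shows "n = m"
proof (rule ccontr)
  assume "n \<noteq> m"
  obtain e where e: "norm n = 1" "0 < e" "\<And>q. dist z q < e \<Longrightarrow> q \<in> S \<longleftrightarrow> (q - z) \<bullet> n < 0"
    using is_outward_normalE[OF n] by blast
  obtain e' where e': "norm m = 1" "0 < e'" "\<And>q. dist z q < e' \<Longrightarrow> q \<in> S \<longleftrightarrow> (q - z) \<bullet> m < 0"
    using is_outward_normalE[OF m] by blast
  have "0 < (n - m) \<bullet> (n - m)" using \<open>n \<noteq> m\<close> by simp
  then have nm: "n \<bullet> m < 1" "n \<bullet> n = 1" "m \<bullet> m = 1"
    using e(1) e'(1) by (auto simp: inner_diff inner_commute norm_eq_1)
  obtain t where t: "0 < t" "dist z (z + t *\<^sub>R (n - m)) < min e e'"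
    using small_multiple_in_ball[of "min e e'" z "n - m"] e(2) e'(2) by auto
  have "0 < t * (1 - n \<bullet> m)" using t nm by simp
  moreover have "(t *\<^sub>R (n - m)) \<bullet> n = t * (1 - n \<bullet> m)" "(t *\<^sub>R (n - m)) \<bullet> m = - (t * (1 - n \<bullet> m))"
    using nm by (simp_all add: inner_diff_left inner_commute algebra_simps)
  ultimately show False
    using e(3)[of "z + t *\<^sub>R (n - m)"] e'(3)[of "z + t *\<^sub>R (n - m)"] t(2)
    by (simp del: inner_scaleR_left)
qed

lemma outward_normal_eq: "is_outward_normal S z n \<Longrightarrow> outward_normal S z = n"
  unfolding outward_normal_def using is_outward_normal_unique by (metis the_equality)

lemma outward_normal_eq_0: "(\<And>n. \<not> is_outward_normal S z n) \<Longrightarrow> outward_normal S z = 0"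
  unfolding outward_normal_def by simp

lemma norm_outward_normal_le: "norm (outward_normal S z) \<le> 1"
proof (cases "\<exists>n. is_outward_normal S z n")
  case True
  then obtain n where "is_outward_normal S z n" by blast
  then show ?thesis using outward_normal_eq by (auto simp: is_outward_normal_def)
next
  case False
  then have "outward_normal S z = 0" by (intro outward_normal_eq_0) blast
  then show ?thesis by simp
qed

lemma frontier_if_is_outward_normal:
  assumes n: "is_outward_normal S z n"
  shows "z \<in> frontier S"
proof -
  obtain e where e: "norm n = 1" "0 < e" "\<And>q. dist z q < e \<Longrightarrow> q \<in> S \<longleftrightarrow> (q - z) \<bullet> n < 0"
    using is_outward_normalE[OF n] by blast
  have "z \<notin> S" using e(3)[of z] e(2) by simp
  moreover have "\<exists>q\<in>S. dist q z < d" if "0 < d" for d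
  proof -
    obtain t where t: "0 < t" "dist z (z - t *\<^sub>R n) < min d e"
      using small_multiple_in_ball[of "min d e" z n] \<open>0 < d\<close> e(2) by auto
    then have "z - t *\<^sub>R n \<in> S" using e(1) e(3)[of "z - t *\<^sub>R n"] by (simp add: dot_square_norm)
    then show ?thesis using t by (intro bexI[of _ "z - t *\<^sub>R n"]) (auto simp: dist_commute)
  qed
  ultimately show ?thesis
    by (auto simp: frontier_def closure_approachable dest: subsetD[OF interior_subset])
qed

text \<open>The normal is locally constant along the boundary, and the set of points with a normal is
  relatively open in the boundary.\<close>

lemma is_outward_normal_near:
  assumes n: "is_outward_normal S z n"
  obtains e where "0 < e" "\<And>w. w \<in> frontier S \<Longrightarrow> dist z w < e \<Longrightarrow> is_outward_normal S w n"
proof -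
  obtain e where e: "norm n = 1" "0 < e" "\<And>q. dist z q < e \<Longrightarrow> q \<in> S \<longleftrightarrow> (q - z) \<bullet> n < 0"
    using is_outward_normalE[OF n] by blast
  have "is_outward_normal S w n" if w: "w \<in> frontier S" "dist z w < e" for w
  proof -
    have "\<not> (w - z) \<bullet> n < 0"
    proof
      assume "(w - z) \<bullet> n < 0"
      moreover have "open {q. dist z q < e \<and> (q - z) \<bullet> n < 0}"
        by (intro open_Collect_conj open_Collect_less continuous_intros)
      moreover have "{q. dist z q < e \<and> (q - z) \<bullet> n < 0} \<subseteq> S" using e(3) by auto
      ultimately have "w \<in> interior S" using w(2) by (auto simp: interior_def)
      with w(1) show False by (simp add: frontier_def)
    qed
    moreover have "\<not> 0 < (w - z) \<bullet> n"
    proof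
      assume "0 < (w - z) \<bullet> n"
      moreover have "open {q. dist z q < e \<and> 0 < (q - z) \<bullet> n}"
        by (intro open_Collect_conj open_Collect_less continuous_intros)
      moreover have "{q. dist z q < e \<and> 0 < (q - z) \<bullet> n} \<inter> S = {}" using e(3) by force
      ultimately have "w \<notin> closure S"
        using w(2) open_Int_closure_eq_empty[of "{q. dist z q < e \<and> 0 < (q - z) \<bullet> n}" S] by auto
      with w(1) show False by (simp add: frontier_def)
    qed
    ultimately have "(w - z) \<bullet> n = 0" by linarith
    then have shift: "(q - z) \<bullet> n = (q - w) \<bullet> n" for q by (simp add: inner_diff_left)
    have "S \<inter> ball w (e - dist z w) = {q \<in> ball w (e - dist z w). (q - w) \<bullet> n < 0}"
    proof -
      have "dist z q < e" if "dist w q < e - dist z w" for q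
        using dist_triangle[of z q w] that by linarith
      then show ?thesis using e(3) by (auto simp: shift)
    qed
    then show ?thesis using e(1) w(2) unfolding is_outward_normal_def by (intro conjI exI[of _ "e - dist z w"]) auto
  qed
  then show thesis using that e(2) by blast
qed

lemma borel_measurable_outward_normal [measurable]: "outward_normal S \<in> borel_measurable borel"
proof -
  define N where "N = {z. \<exists>n. is_outward_normal S z n}"
  define U where "U = \<Union>{ball z e | z e. \<exists>n. \<forall>w\<in>frontier S. dist z w < e \<longrightarrow> is_outward_normal S w n}"
  have "N = frontier S \<inter> U"
  proof (intro equalityI subsetI)
    fix z assume "z \<in> N"
    then obtain n where n: "is_outward_normal S z n" by (auto simp: N_def)
    obtain e where "0 < e" "\<And>w. w \<in> frontier S \<Longrightarrow> dist z w < e \<Longrightarrow> is_outward_normal S w n"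
      using is_outward_normal_near[OF n] by blast
    then show "z \<in> frontier S \<inter> U"
      using frontier_if_is_outward_normal[OF n] centre_in_ball[of z e] unfolding U_def by blast
  next
    fix z assume "z \<in> frontier S \<inter> U"
    then show "z \<in> N" unfolding N_def U_def mem_Collect_eq by (auto simp: mem_ball simp del: split_paired_Ex)
  qed
  moreover have "open U" unfolding U_def by auto
  ultimately have N [measurable]: "N \<in> sets borel"
    by (auto intro: borel_closed borel_open)
  have "continuous_on N (outward_normal S)"
    unfolding continuous_on_iff
  proof (intro ballI allI impI)
    fix z and d :: real assume "z \<in> N" "0 < d"
    then obtain n where n: "is_outward_normal S z n" by (auto simp: N_def)
    obtain e where e: "0 < e" "\<And>w. w \<in> frontier S \<Longrightarrow> dist z w < e \<Longrightarrow> is_outward_normal S w n"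
      using is_outward_normal_near[OF n] by blast
    have "outward_normal S w = outward_normal S z" if "w \<in> N" "dist w z < e" for w
    proof -
      have "w \<in> frontier S" using \<open>w \<in> N\<close> frontier_if_is_outward_normal unfolding N_def by blast
      then show ?thesis using e(2) that(2) n by (metis dist_commute outward_normal_eq)
    qed
    then show "\<exists>e>0. \<forall>w\<in>N. dist w z < e \<longrightarrow> dist (outward_normal S w) (outward_normal S z) < d"
      using \<open>0 < d\<close> e(1) by (intro exI[of _ e]) auto
  qed
  then have "(\<lambda>z. if z \<in> N then outward_normal S z else 0) \<in> borel_measurable borel"
    by (intro borel_measurable_continuous_on_if N) auto
  moreover have "(\<lambda>z. if z \<in> N then outward_normal S z else 0) = outward_normal S"
  proof
    show "(if z \<in> N then outward_normal S z else 0) = outward_normal S z" for z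
      using outward_normal_eq_0[of S z] unfolding N_def by (metis mem_Collect_eq)
  qed
  ultimately show ?thesis by simp
qed

lemma borel_measurable_fst_snd [measurable]:
  "(fst :: plane \<Rightarrow> real) \<in> borel_measurable borel" "(snd :: plane \<Rightarrow> real) \<in> borel_measurable borel"
  by (intro borel_measurable_continuous_onI continuous_intros)+

lemma borel_measurable_n1 [measurable]: "n1 S \<in> borel_measurable borel"
  unfolding n1_def[abs_def] by measurable

lemma borel_measurable_xn2 [measurable]: "xn2 S \<in> borel_measurable borel"
  unfolding xn2_def[abs_def] by measurable

lemma abs_n1_le: "\<bar>n1 S z\<bar> \<le> 1"
  using norm_outward_normal_le[of S z] norm_fst_le[of "fst (outward_normal S z)" "snd (outward_normal S z)"]
  by (simp add: n1_def)

lemma abs_snd_outward_normal_le: "\<bar>snd (outward_normal S z)\<bar> \<le> 1"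
  using norm_outward_normal_le[of S z] norm_snd_le[of "snd (outward_normal S z)" "fst (outward_normal S z)"]
  by simp


section \<open>The fundamental theorem of calculus on open subsets of the line\<close>

text \<open>By splitting the interval at the points of \<open>F\<close>, one is left with intervals that are contained
  in \<open>U\<close> or disjoint from it. A point of \<open>F\<close> with \<open>U\<close> on both sides or on neither contributes nothing.\<close>

lemma integral_deriv_open_subset:
  fixes f f' :: "real \<Rightarrow> real" and U F :: "real set"
  assumes f: "\<And>x. (f has_real_derivative f' x) (at x)" "continuous_on UNIV f'" and U: "open U"
    and "finite F" "a < b" "F \<subseteq> {a<..<b}" "frontier U \<inter> {a<..<b} \<subseteq> F"
  shows "(LINT t:U \<inter> {a<..<b}|lborel. f' t) =
      of_bool (\<forall>\<^sub>F t in at_left b. t \<in> U) * f b - of_bool (\<forall>\<^sub>F t in at_right a. t \<in> U) * f a +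
      (\<Sum>y\<in>F. (of_bool (\<forall>\<^sub>F t in at_left y. t \<in> U) - of_bool (\<forall>\<^sub>F t in at_right y. t \<in> U)) * f y)"
    (is "?I U a b = ?R b - ?L a + sum ?J F")
  using assms(4-7)
proof (induction "card F" arbitrary: F a b rule: less_induct)
  case less
  show ?case
  proof (cases "F = {}")
    case True
    have "connected {a<..<b}" by simp
    then have cases: "{a<..<b} \<inter> U = {} \<or> {a<..<b} - U = {}"
      using connected_Int_frontier[of "{a<..<b}" U] less.prems(4) True by blast
    have near: "\<forall>\<^sub>F t in at_left b. t \<in> {a<..<b}" "\<forall>\<^sub>F t in at_right a. t \<in> {a<..<b}"
      using less.prems(2) eventually_at_left_real eventually_at_right_real by auto
    show ?thesis
    proof (cases "{a<..<b} \<inter> U = {}")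
      case disj: True
      have outside: "\<not> (\<forall>\<^sub>F t in G. t \<in> U)" if "\<forall>\<^sub>F t in G. t \<in> {a<..<b}" "G \<noteq> bot" for G
      proof
        assume "\<forall>\<^sub>F t in G. t \<in> U"
        with that(1) have "\<forall>\<^sub>F t in G. False" by eventually_elim (use disj in auto)
        with that(2) show False by (simp add: eventually_False)
      qed
      have "\<not> (\<forall>\<^sub>F t in at_left b. t \<in> U)" "\<not> (\<forall>\<^sub>F t in at_right a. t \<in> U)"
        by (rule outside[OF near(1)], simp, rule outside[OF near(2)], simp)
      moreover have "U \<inter> {a<..<b} = {}" using disj by auto
      ultimately show ?thesis using True by (simp add: set_lebesgue_integral_def)
    next
      case False
      then have sub: "{a<..<b} \<subseteq> U" using cases by auto
      have "\<forall>\<^sub>F t in at_left b. t \<in> U" "\<forall>\<^sub>F t in at_right a. t \<in> U"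
        using near sub by (auto elim!: eventually_mono simp del: greaterThanLessThan_iff)
      moreover have "U \<inter> {a<..<b} = {a<..<b}" using sub by auto
      moreover have "(LINT t:{a<..<b}|lborel. f' t) = f b - f a"
        using interval_integral_FTC_finite[of a b f' f] f less.prems(2)
        by (auto simp: interval_lebesgue_integral_def einterval_iff less_imp_le
            has_real_derivative_iff_has_vector_derivative continuous_on_subset
            has_vector_derivative_at_within einterval_eq)
      ultimately show ?thesis using True by simp
    qed
  next
    case False
    then obtain c where c: "c \<in> F" by auto
    define F1 where "F1 = F \<inter> {a<..<c}"
    define F2 where "F2 = F \<inter> {c<..<b}"
    have ac: "a < c" "c < b" using c less.prems(3) by auto
    have F: "F = F1 \<union> F2 \<union> {c}" "F1 \<inter> F2 = {}" "c \<notin> F1" "c \<notin> F2"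
      using less.prems(3) c by (auto simp: F1_def F2_def)
    have fin: "finite F1" "finite F2" using less.prems(1) by (auto simp: F1_def F2_def)
    have card: "card F1 < card F" "card F2 < card F"
      by (rule psubset_card_mono[OF less.prems(1)], use F c in blast)+
    have integrable: "set_integrable lborel A f'" if "A \<subseteq> {a..b}" "A \<in> sets borel" for A
    proof -
      have "set_integrable lborel {a..b} f'"
        by (rule borel_integrable_atLeastAtMost'[OF continuous_on_subset[OF f(2)]]) simp
      then show ?thesis by (rule set_integrable_subset) (use that in auto)
    qed
    have "?I U a b = (LINT t:(U \<inter> {a<..<c}) \<union> (U \<inter> {c<..<b})|lborel. f' t)"
    proof (rule set_integral_cong_set)
      show "AE t in lborel. t \<in> U \<inter> {a<..<c} \<union> U \<inter> {c<..<b} \<longleftrightarrow> t \<in> U \<inter> {a<..<b}"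
        using AE_lborel_singleton[of c] by eventually_elim (use ac in auto)
      have meas: "set_borel_measurable lborel A f'" if "A \<in> sets borel" "A \<subseteq> {a..b}" for A
        using borel_measurable_integrable[OF integrable[OF that(2,1), unfolded set_integrable_def]]
        by (simp add: set_borel_measurable_def)
      show "set_borel_measurable lborel (U \<inter> {a<..<b}) f'" by (rule meas) (use U in auto)
      show "set_borel_measurable lborel (U \<inter> {a<..<c} \<union> U \<inter> {c<..<b}) f'"
        by (rule meas) (use U ac in auto)
    qed
    also have "\<dots> = ?I U a c + ?I U c b"
      using U ac by (intro set_integral_Un integrable) auto
    also have "?I U a c = ?R c - ?L a + sum ?J F1"
      by (rule less.hyps[OF card(1)]) (use less.prems ac fin in \<open>auto simp: F1_def\<close>)
    also have "?I U c b = ?R b - ?L c + sum ?J F2"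
      by (rule less.hyps[OF card(2)]) (use less.prems ac fin in \<open>auto simp: F2_def\<close>)
    also have "(?R c - ?L a + sum ?J F1) + (?R b - ?L c + sum ?J F2)
        = ?R b - ?L a + (sum ?J F1 + sum ?J F2 + ?J c)"
      by (simp add: algebra_simps)
    also have "sum ?J F1 + sum ?J F2 + ?J c = sum ?J F"
      using F fin by (simp add: sum.union_disjoint)
    finally show ?thesis .
  qed
qed

section \<open>The divergence theorem on domains with polygonal boundary\<close>

locale polygonal_boundary =
  fixes \<Omega> :: "plane set" and E :: "(plane \<times> plane) set"
  assumes open_dom: "open \<Omega>" and bounded_dom: "bounded \<Omega>" and finite_E: "finite E"
    and frontier_eq: "frontier \<Omega> = (\<Union>(a, b)\<in>E. closed_segment a b)"
begin

definition slope :: "plane \<times> plane \<Rightarrow> real" where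
  "slope s = (snd (snd s) - snd (fst s)) / (fst (snd s) - fst (fst s))"

definition Lines :: "(real \<times> real) set" where
  "Lines = (\<lambda>s. (slope s, snd (fst s) - slope s * fst (fst s))) ` {s \<in> E. fst (fst s) \<noteq> fst (snd s)}"

definition line :: "real \<times> real \<Rightarrow> real \<Rightarrow> plane" where
  "line l x = (x, fst l * x + snd l)"

definition crossing :: "real set" where
  "crossing = {x. \<exists>l\<in>Lines. \<exists>k\<in>Lines. l \<noteq> k \<and> line l x = line k x}"

text \<open>On a vertical line through none of these abscissae the boundary consists of finitely many
  points, each in the relative interior of all boundary segments through it, which have the same
  direction there.\<close>

definition exceptional :: "real set" where
  "exceptional = (fst \<circ> fst) ` E \<union> (fst \<circ> snd) ` E \<union> crossing"

definition speed :: "real \<times> real \<Rightarrow> real" where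
  "speed l = sqrt (1 + (fst l)\<^sup>2)"

definition on_line :: "real \<times> real \<Rightarrow> real set" where
  "on_line l = {x. x \<notin> exceptional \<and> line l x \<in> frontier \<Omega>}"

definition below :: "plane \<Rightarrow> bool" where
  "below z \<longleftrightarrow> (\<forall>\<^sub>F t in at_left (snd z). (fst z, t) \<in> \<Omega>)"

definition above :: "plane \<Rightarrow> bool" where
  "above z \<longleftrightarrow> (\<forall>\<^sub>F t in at_right (snd z). (fst z, t) \<in> \<Omega>)"

text \<open>The sign with which the value at a boundary point enters the fundamental theorem of calculus on
  its vertical line.\<close>

definition jump :: "plane \<Rightarrow> real" where
  "jump z = of_bool (below z) - of_bool (above z)"

lemma finite_Lines: "finite Lines"
  unfolding Lines_def using finite_E by simp

lemma finite_exceptional: "finite exceptional"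
proof -
  have "finite {x. l \<noteq> k \<and> line l x = line k x}" for l k
  proof (cases "fst l = fst k")
    case True
    then have "{x. l \<noteq> k \<and> line l x = line k x} = {}" by (auto simp: line_def prod_eq_iff)
    then show ?thesis by (metis finite.emptyI)
  next
    case False
    have "x = (snd k - snd l) / (fst l - fst k)" if "line l x = line k x" for x
      using that False by (simp add: line_def field_simps)
    then have "{x. l \<noteq> k \<and> line l x = line k x} \<subseteq> {(snd k - snd l) / (fst l - fst k)}" by auto
    then show ?thesis by (rule finite_subset) simp
  qed
  then have "finite (\<Union>l\<in>Lines. \<Union>k\<in>Lines. {x. l \<noteq> k \<and> line l x = line k x})"
    using finite_Lines by auto
  then have "finite crossing"
    by (rule finite_subset[rotated]) (auto simp: crossing_def)
  then show ?thesis using finite_E by (simp add: exceptional_def)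
qed

lemma speed_pos: "0 < speed l"
  by (auto simp: speed_def intro: add_pos_nonneg)

lemma dist_line: "dist (line l s) (line l t) = speed l * \<bar>s - t\<bar>"
proof -
  have "(dist (line l s) (line l t))\<^sup>2 = (speed l * \<bar>s - t\<bar>)\<^sup>2"
    by (simp add: dist_prod_def line_def speed_def dist_real_def power_mult_distrib)
      (simp add: power2_eq_square algebra_simps)
  then show ?thesis
    using speed_pos[of l] by (simp add: power2_eq_iff_nonneg)
qed

lemma line_parametrization: "line_parametrization (line l) fst (speed l)"
proof
  show "fst (line l t) = t" for t by (simp add: line_def)
qed (simp_all add: dist_line speed_pos)

lemma continuous_line: "continuous_on UNIV (line l)"
  unfolding line_def by (intro continuous_intros)

lemma fst_line [simp]: "fst (line l x) = x"
  by (simp add: line_def)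

lemma segment_on_line:
  assumes "s \<in> E" "fst (fst s) \<noteq> fst (snd s)"
  obtains l where "l \<in> Lines"
    "\<And>z. z \<in> closed_segment (fst s) (snd s)
      \<longleftrightarrow> z = line l (fst z) \<and> fst z \<in> closed_segment (fst (fst s)) (fst (snd s))"
proof -
  obtain a b c d where s: "s = ((a, b), (c, d))" by (metis surj_pair)
  have ac: "a \<noteq> c" using assms(2) s by simp
  define l where "l = (slope s, snd (fst s) - slope s * fst (fst s))"
  have "line l x = (x, slope s * (x - a) + b)" for x
    by (simp add: line_def l_def s right_diff_distrib)
  moreover have "slope s = (d - b) / (c - a)" by (simp add: slope_def s)
  ultimately have l: "line l x = (x, (d - b) / (c - a) * (x - a) + b)" for x by simp
  have "z \<in> closed_segment (a, b) (c, d) \<longleftrightarrow> z = line l (fst z) \<and> fst z \<in> closed_segment a c" for z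
  proof
    assume "z \<in> closed_segment (a, b) (c, d)"
    then obtain u where u: "0 \<le> u" "u \<le> 1" "z = ((1 - u) * a + u * c, (1 - u) * b + u * d)"
      by (auto simp: closed_segment_def)
    have "fst z - a = u * (c - a)" by (simp add: u(3) algebra_simps)
    then have "(d - b) / (c - a) * (fst z - a) = u * (d - b)" using ac by simp
    then have on_l: "line l (fst z) = (fst z, u * (d - b) + b)" by (simp only: l)
    have "z = (fst z, u * (d - b) + b)" using u(3) by (simp add: prod_eq_iff algebra_simps)
    then have "z = line l (fst z)" by (simp only: on_l)
    moreover have "fst z \<in> closed_segment a c" using u by (auto simp: closed_segment_def)
    ultimately show "z = line l (fst z) \<and> fst z \<in> closed_segment a c" ..
  next
    assume z: "z = line l (fst z) \<and> fst z \<in> closed_segment a c"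
    then obtain u where u: "0 \<le> u" "u \<le> 1" "fst z = (1 - u) * a + u * c"
      by (auto simp: closed_segment_def)
    have "fst z - a = u * (c - a)" by (simp add: u(3) algebra_simps)
    then have "(d - b) / (c - a) * (fst z - a) = u * (d - b)" using ac by simp
    then have "snd z = u * (d - b) + b" using z l by (metis snd_conv)
    then have "z = (1 - u) *\<^sub>R (a, b) + u *\<^sub>R (c, d)"
      using u(3) by (simp add: prod_eq_iff algebra_simps)
    then show "z \<in> closed_segment (a, b) (c, d)" using u(1,2) by (auto simp: closed_segment_def)
  qed
  then show thesis using assms s by (intro that[of l]) (auto simp: Lines_def l_def)
qed

text \<open>A boundary segment through a point over a nonexceptional abscissa is not vertical and has the
  point in its relative interior; two such segments lie on the same line, since otherwise the point
  would be a crossing. All other segments stay away from the point.\<close>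

lemma frontier_locally_line:
  assumes z: "z \<in> frontier \<Omega>" "fst z \<notin> exceptional"
  obtains l where "l \<in> Lines" "z = line l (fst z)"
    "\<forall>\<^sub>F q in nhds z. q \<in> frontier \<Omega> \<longleftrightarrow> q = line l (fst q)"
proof -
  have seg: "\<exists>l\<in>Lines. z = line l (fst z) \<and>
      (\<forall>\<^sub>F q in nhds z. q \<in> closed_segment (fst s) (snd s) \<longleftrightarrow> q = line l (fst q))"
    if s: "s \<in> E" "z \<in> closed_segment (fst s) (snd s)" for s
  proof -
    let ?a = "fst (fst s)" and ?b = "fst (snd s)"
    have ab: "fst z \<noteq> ?a" "fst z \<noteq> ?b" using z(2) s(1) by (force simp: exceptional_def)+
    have "fst z \<in> closed_segment ?a ?b"
      using s(2) by (auto simp: closed_segment_def)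
    then have "?a \<noteq> ?b" using ab by auto
    from segment_on_line[OF s(1) this] obtain l where l: "l \<in> Lines"
      "\<And>z. z \<in> closed_segment (fst s) (snd s)
        \<longleftrightarrow> z = line l (fst z) \<and> fst z \<in> closed_segment ?a ?b" by blast
    have "fst z \<in> {min ?a ?b<..<max ?a ?b}"
      using \<open>fst z \<in> closed_segment ?a ?b\<close> ab by (auto simp: closed_segment_eq_real_ivl split: if_splits)
    moreover have "open (fst -` {min ?a ?b<..<max ?a ?b} :: plane set)"
      by (intro open_vimage_fst) simp
    ultimately have "\<forall>\<^sub>F q in nhds z. q \<in> fst -` {min ?a ?b<..<max ?a ?b}"
      by (intro eventually_nhds_in_open) auto
    then have "\<forall>\<^sub>F q in nhds z. fst q \<in> closed_segment ?a ?b"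
      by eventually_elim (auto simp: closed_segment_eq_real_ivl)
    then have "\<forall>\<^sub>F q in nhds z. q \<in> closed_segment (fst s) (snd s) \<longleftrightarrow> q = line l (fst q)"
      by eventually_elim (use l(2) in blast)
    then show ?thesis using l s(2) by blast
  qed
  obtain s0 where s0: "s0 \<in> E" "z \<in> closed_segment (fst s0) (snd s0)"
    using z(1) unfolding frontier_eq by auto
  obtain l where l: "l \<in> Lines" "z = line l (fst z)"
    "\<forall>\<^sub>F q in nhds z. q \<in> closed_segment (fst s0) (snd s0) \<longleftrightarrow> q = line l (fst q)"
    using seg[OF s0] by blast
  have "\<forall>\<^sub>F q in nhds z. q \<in> closed_segment (fst s) (snd s) \<longrightarrow> q = line l (fst q)" if s: "s \<in> E" for s
  proof (cases "z \<in> closed_segment (fst s) (snd s)")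
    case True
    from seg[OF s this] obtain k where k: "k \<in> Lines" "z = line k (fst z)"
      "\<forall>\<^sub>F q in nhds z. q \<in> closed_segment (fst s) (snd s) \<longleftrightarrow> q = line k (fst q)" by blast
    have "k = l"
    proof (rule ccontr)
      assume "k \<noteq> l"
      moreover have "line k (fst z) = line l (fst z)" using k(2) l(2) by simp
      ultimately have "fst z \<in> exceptional"
        using k(1) l(1) unfolding exceptional_def crossing_def by blast
      with z(2) show False ..
    qed
    then show ?thesis using k(3) by (auto elim: eventually_mono)
  next
    case False
    have "\<forall>\<^sub>F q in nhds z. q \<in> - closed_segment (fst s) (snd s)"
      by (rule eventually_nhds_in_open) (use False in auto)
    then show ?thesis by eventually_elim simp
  qed
  then have "\<forall>\<^sub>F q in nhds z. \<forall>s\<in>E. q \<in> closed_segment (fst s) (snd s) \<longrightarrow> q = line l (fst q)"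
    by (intro eventually_ball_finite finite_E) auto
  with l(3) have "\<forall>\<^sub>F q in nhds z. q \<in> frontier \<Omega> \<longleftrightarrow> q = line l (fst q)"
    by eventually_elim (use s0(1) in \<open>auto simp: frontier_eq case_prod_unfold\<close>)
  with l(1,2) show thesis by (rule that)
qed

text \<open>Near such a point the domain is a half disc, a disc without its diameter, or empty; only in the
  first case is there a normal.\<close>

lemma normal_is_jump:
  assumes z: "z = line l (fst z)"
    and loc: "\<forall>\<^sub>F q in nhds z. q \<in> frontier \<Omega> \<longleftrightarrow> q = line l (fst q)"
  shows "speed l * snd (outward_normal \<Omega> z) = jump z"
proof -
  obtain e where e: "0 < e" and loc_e: "\<And>q. dist z q < e \<Longrightarrow> q \<in> frontier \<Omega> \<longleftrightarrow> q = line l (fst q)"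
    using loc unfolding eventually_nhds_metric by (metis dist_commute)
  define nu :: plane where "nu = (- fst l / speed l, 1 / speed l)"
  have sp: "speed l * speed l = 1 + (fst l)\<^sup>2" "speed l \<noteq> 0"
    using speed_pos[of l] by (simp_all add: speed_def)
  have "0 < 1 + fst l * fst l" by (simp add: add_pos_nonneg)
  then have nu: "norm nu = 1"
    using sp speed_pos[of l] by (simp add: nu_def norm_prod_def power_divide add_divide_distrib[symmetric] power2_eq_square add.commute)
  have snd_z: "snd z = fst l * fst z + snd l" using z by (simp add: line_def prod_eq_iff)
  have dot: "(q - z) \<bullet> nu = (snd q - (fst l * fst q + snd l)) / speed l" for q
  proof -
    have "(q - z) \<bullet> nu = (fst q - fst z) * (- fst l / speed l) + (snd q - snd z) * (1 / speed l)"
      by (simp add: nu_def inner_prod_def)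
    also have "\<dots> = (snd q - (fst l * fst q + snd l)) / speed l"
      using sp(2) by (simp add: snd_z field_simps)
    finally show ?thesis .
  qed
  have on: "q = line l (fst q) \<longleftrightarrow> (q - z) \<bullet> nu = 0" for q
    unfolding dot using sp by (simp add: line_def prod_eq_iff)
  have open_\<Omega>: "q \<notin> \<Omega>" if "q \<in> frontier \<Omega>" for q
    using that open_dom by (simp add: frontier_def interior_open)
  define Lo where "Lo = ball z e \<inter> {q. (q - z) \<bullet> nu < 0}"
  define Up where "Up = ball z e \<inter> {q. (q - z) \<bullet> nu > 0}"
  have "convex {q. (q - z) \<bullet> nu < 0}" "convex {q. (q - z) \<bullet> nu > 0}"
    using convex_halfspace_lt[of nu "nu \<bullet> z"] convex_halfspace_gt[of "nu \<bullet> z" nu]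
    by (simp_all add: inner_diff_left inner_commute[of nu])
  then have conn: "connected Lo" "connected Up"
    unfolding Lo_def Up_def by (auto intro!: convex_connected convex_Int)
  have "Lo \<inter> frontier \<Omega> = {}" "Up \<inter> frontier \<Omega> = {}"
    using loc_e on by (auto simp: Lo_def Up_def)
  then have Lo: "Lo \<subseteq> \<Omega> \<or> Lo \<inter> \<Omega> = {}" and Up: "Up \<subseteq> \<Omega> \<or> Up \<inter> \<Omega> = {}"
    using connected_Int_frontier[OF conn(1), of \<Omega>] connected_Int_frontier[OF conn(2), of \<Omega>] by auto
  have split: "q = line l (fst q) \<or> q \<in> Lo \<or> q \<in> Up" if "dist z q < e" for q
    using that on[of q] by (auto simp: Lo_def Up_def)
  have vert: "dist z (fst z, t) = \<bar>t - snd z\<bar>" "((fst z, t) - z) \<bullet> nu = (t - snd z) / speed l" for t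
    by (simp_all add: dist_prod_def dist_real_def abs_minus_commute dot snd_z)
  have left: "\<forall>\<^sub>F t in at_left (snd z). (fst z, t) \<in> Lo"
  proof -
    have "\<forall>\<^sub>F t in at_left (snd z). t \<in> {snd z - e<..<snd z}"
      by (rule eventually_at_left_real) (use e in simp)
    then show ?thesis
      by eventually_elim (use speed_pos[of l] in \<open>auto simp: Lo_def vert divide_less_0_iff\<close>)
  qed
  have right: "\<forall>\<^sub>F t in at_right (snd z). (fst z, t) \<in> Up"
  proof -
    have "\<forall>\<^sub>F t in at_right (snd z). t \<in> {snd z<..<snd z + e}"
      by (rule eventually_at_right_real) (use e in simp)
    then show ?thesis
      by eventually_elim (use speed_pos[of l] in \<open>auto simp: Up_def vert zero_less_divide_iff\<close>)
  qed
  have below: "below z \<longleftrightarrow> Lo \<subseteq> \<Omega>"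
  proof
    assume "below z"
    with left have "\<forall>\<^sub>F t in at_left (snd z). (fst z, t) \<in> Lo \<inter> \<Omega>"
      unfolding below_def by eventually_elim auto
    then have "Lo \<inter> \<Omega> \<noteq> {}" using eventually_happens' trivial_limit_at_left_real by blast
    with Lo show "Lo \<subseteq> \<Omega>" by blast
  next
    assume "Lo \<subseteq> \<Omega>"
    with left show "below z" unfolding below_def by (auto elim: eventually_mono)
  qed
  have above: "above z \<longleftrightarrow> Up \<subseteq> \<Omega>"
  proof
    assume "above z"
    with right have "\<forall>\<^sub>F t in at_right (snd z). (fst z, t) \<in> Up \<inter> \<Omega>"
      unfolding above_def by eventually_elim auto
    then have "Up \<inter> \<Omega> \<noteq> {}" using eventually_happens' trivial_limit_at_right_real by blast
    with Up show "Up \<subseteq> \<Omega>" by blast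
  next
    assume "Up \<subseteq> \<Omega>"
    with right show "above z" unfolding above_def by (auto elim: eventually_mono)
  qed
  have mem: "q \<in> \<Omega> \<longleftrightarrow> (if (q - z) \<bullet> nu < 0 then below z else if (q - z) \<bullet> nu > 0 then above z else False)"
    if "dist z q < e" for q
  proof (cases "(q - z) \<bullet> nu" "0::real" rule: linorder_cases)
    case less
    then have "q \<in> Lo" using that by (simp add: Lo_def)
    then have "q \<in> \<Omega> \<longleftrightarrow> below z" using Lo below by blast
    then show ?thesis using less by simp
  next
    case equal
    then have "q \<notin> \<Omega>" using loc_e[OF that] on open_\<Omega> by blast
    then show ?thesis using equal by simp
  next
    case greater
    then have "q \<in> Up" using that by (simp add: Up_def)
    then have "q \<in> \<Omega> \<longleftrightarrow> above z" using Up above by blast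
    then show ?thesis using greater by simp
  qed
  consider "below z" "\<not> above z" | "\<not> below z" "above z" | "below z = above z" by blast
  then show ?thesis
  proof cases
    case 1
    have "\<Omega> \<inter> ball z e = {q \<in> ball z e. (q - z) \<bullet> nu < 0}"
    proof (rule set_eqI)
      show "q \<in> \<Omega> \<inter> ball z e \<longleftrightarrow> q \<in> {q \<in> ball z e. (q - z) \<bullet> nu < 0}" for q
        using mem[of q] 1 by (cases "dist z q < e") (auto simp del: mem_ball simp: mem_ball split: if_splits)
    qed
    then have "is_outward_normal \<Omega> z nu"
      unfolding is_outward_normal_def using nu e by (intro conjI exI[of _ e]) simp_all
    then show ?thesis using 1 sp by (simp add: outward_normal_eq jump_def nu_def)
  next
    case 2
    have "\<Omega> \<inter> ball z e = {q \<in> ball z e. (q - z) \<bullet> (- nu) < 0}"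
    proof (rule set_eqI)
      show "q \<in> \<Omega> \<inter> ball z e \<longleftrightarrow> q \<in> {q \<in> ball z e. (q - z) \<bullet> (- nu) < 0}" for q
        using mem[of q] 2 by (cases "dist z q < e") (auto simp del: mem_ball simp: mem_ball split: if_splits)
    qed
    then have "is_outward_normal \<Omega> z (- nu)"
      unfolding is_outward_normal_def using nu e by (intro conjI exI[of _ e]) simp_all
    then show ?thesis using 2 sp by (simp add: outward_normal_eq jump_def nu_def)
  next
    case 3
    have "\<not> is_outward_normal \<Omega> z n" for n
    proof
      assume "is_outward_normal \<Omega> z n"
      then obtain e' where e': "norm n = 1" "0 < e'" "\<And>q. dist z q < e' \<Longrightarrow> q \<in> \<Omega> \<longleftrightarrow> (q - z) \<bullet> n < 0"
        by (rule is_outward_normalE) blast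
      \<comment> \<open>a direction out of the alleged half disc that is not tangential\<close>
      define v where "v = (if n \<bullet> nu = 0 then n + nu else n)"
      have v: "0 < v \<bullet> n" "v \<bullet> nu \<noteq> 0"
        using e'(1) nu by (auto simp: v_def inner_add_left inner_commute[of nu n] norm_eq_1)
      obtain t where t: "0 < t" "dist z (z + t *\<^sub>R v) < min e e'" "dist z (z - t *\<^sub>R v) < min e e'"
        using small_multiple_in_ball[of "min e e'" z v] e e'(2) by auto
      have "z - t *\<^sub>R v \<in> \<Omega>" "z + t *\<^sub>R v \<notin> \<Omega>"
        using e'(3)[of "z - t *\<^sub>R v"] e'(3)[of "z + t *\<^sub>R v"] t v(1)
        by (auto simp: mult_less_0_iff)
      moreover have "(z - t *\<^sub>R v - z) \<bullet> nu = - (t * (v \<bullet> nu))" "(z + t *\<^sub>R v - z) \<bullet> nu = t * (v \<bullet> nu)"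
        "t * (v \<bullet> nu) \<noteq> 0"
        using t(1) v(2) by auto
      ultimately show False
        using mem[of "z - t *\<^sub>R v"] mem[of "z + t *\<^sub>R v"] t(2,3) 3 by (auto split: if_splits)
    qed
    then show ?thesis using 3 by (simp add: outward_normal_eq_0 jump_def)
  qed
qed

lemma speed_normal_on_line:
  assumes "l \<in> Lines" "x \<in> on_line l"
  shows "speed l * snd (outward_normal \<Omega> (line l x)) = jump (line l x)"
proof -
  have x: "line l x \<in> frontier \<Omega>" "x \<notin> exceptional" using assms by (auto simp: on_line_def)
  obtain k where k: "k \<in> Lines" "line l x = line k x"
    "\<forall>\<^sub>F q in nhds (line l x). q \<in> frontier \<Omega> \<longleftrightarrow> q = line k (fst q)"
    using frontier_locally_line[of "line l x"] x by auto
  have "k = l"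
    using k(1,2) assms(1) x(2) unfolding exceptional_def crossing_def by force
  with k show ?thesis by (intro normal_is_jump) auto
qed

lemma on_line_unique:
  "l \<in> Lines \<Longrightarrow> k \<in> Lines \<Longrightarrow> x \<notin> exceptional \<Longrightarrow> line l x = line k x \<Longrightarrow> l = k"
  unfolding exceptional_def crossing_def by force

lemma borel_on_line: "on_line l \<in> sets borel"
proof -
  have "closed (line l -` frontier \<Omega>)"
    using continuous_line by (intro continuous_closed_vimage) (auto simp: continuous_on_eq_continuous_at)
  then have "line l -` frontier \<Omega> - exceptional \<in> sets borel"
    using finite_exceptional by (auto intro: borel_closed finite_imp_closed)
  moreover have "on_line l = line l -` frontier \<Omega> - exceptional" by (auto simp: on_line_def)
  ultimately show ?thesis by simp
qed

lemma bounded_frontier_dom: "bounded (frontier \<Omega>)"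
  using bounded_dom bounded_closure bounded_subset frontier_def by (metis Diff_subset)

lemma box_bound:
  obtains M where "0 < M" "\<And>z. z \<in> \<Omega> \<union> frontier \<Omega> \<Longrightarrow> \<bar>fst z\<bar> < M \<and> \<bar>snd z\<bar> < M"
proof -
  have "bounded (\<Omega> \<union> frontier \<Omega>)" using bounded_dom bounded_frontier_dom by simp
  then obtain M where "0 < M" "\<And>z. z \<in> \<Omega> \<union> frontier \<Omega> \<Longrightarrow> norm z < M"
    unfolding bounded_pos_less by blast
  then show thesis
    using that norm_fst_le norm_snd_le by (metis order_le_less_trans prod.collapse real_norm_def)
qed

lemma on_line_bounded: obtains a b where "\<And>l. on_line l \<subseteq> {a..b}"
proof -
  obtain M where M: "0 < M" "\<And>z. z \<in> \<Omega> \<union> frontier \<Omega> \<Longrightarrow> \<bar>fst z\<bar> < M \<and> \<bar>snd z\<bar> < M"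
    using box_bound by blast
  have "on_line l \<subseteq> {- M..M}" for l
  proof
    fix x assume "x \<in> on_line l"
    then have "\<bar>x\<bar> < M" using M(2)[of "line l x"] by (simp add: on_line_def)
    then show "x \<in> {- M..M}" by auto
  qed
  then show thesis by (rule that)
qed

end

lemma set_integrable_bounded:
  fixes f :: "'a \<Rightarrow> 'b::{banach, second_countable_topology}"
  assumes "A \<in> sets M" "emeasure M A < \<infinity>" "f \<in> borel_measurable M" "\<And>x. x \<in> A \<Longrightarrow> norm (f x) \<le> B"
  shows "set_integrable M A f"
  unfolding set_integrable_def
  by (rule integrableI_bounded_set_indicator[where B = B]) (use assms in auto)

lemma set_integral_cong_on:
  fixes f g :: "'a \<Rightarrow> real"
  assumes "\<And>z. z \<in> S \<Longrightarrow> f z = g z"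
  shows "(LINT z:S|M. f z) = (LINT z:S|M. g z)"
  unfolding set_lebesgue_integral_def using assms
  by (intro Bochner_Integration.integral_cong) (auto simp: indicator_def)

lemma set_integral_lebesgue_lborel:
  fixes f :: "plane \<Rightarrow> real"
  assumes "S \<in> sets borel" "f \<in> borel_measurable borel"
  shows "(LINT z:S|lebesgue. f z) = (LINT z:S|lborel. f z)"
  unfolding set_lebesgue_integral_def using assms by (intro integral_completion) simp

lemma C1_has_derivative:
  assumes f: "f \<in> C1"
  shows "((\<lambda>s. f (s, y)) has_real_derivative dx f (x, y)) (at x)"
    and "((\<lambda>s. f (x, s)) has_real_derivative dy f (x, y)) (at y)"
proof -
  have d: "f differentiable at z" for z using f unfolding C1_def by blast
  have "(f \<circ> (\<lambda>s. (s, y))) differentiable at x"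
    by (rule differentiable_chain_at) (auto intro: d differentiableI derivative_intros)
  then show "((\<lambda>s. f (s, y)) has_real_derivative dx f (x, y)) (at x)"
    by (simp add: dx_def o_def DERIV_deriv_iff_real_differentiable)
  have "(f \<circ> (\<lambda>s. (x, s))) differentiable at y"
    by (rule differentiable_chain_at) (auto intro: d differentiableI derivative_intros)
  then show "((\<lambda>s. f (x, s)) has_real_derivative dy f (x, y)) (at y)"
    by (simp add: dy_def o_def DERIV_deriv_iff_real_differentiable)
qed

lemma C1_continuous:
  assumes f: "f \<in> C1"
  shows "continuous_on UNIV f" "continuous_on UNIV (dx f)" "continuous_on UNIV (dy f)"
proof -
  show "continuous_on UNIV f"
    using f by (auto simp: C1_def continuous_on_eq_continuous_at differentiable_imp_continuous_within)
  have g: "continuous_on UNIV (grad f)" using f by (simp add: C1_def)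
  show "continuous_on UNIV (dx f)" "continuous_on UNIV (dy f)"
    using continuous_on_fst[OF g] continuous_on_snd[OF g] by (simp_all add: grad_def)
qed

lemma C1_borel_measurable:
  assumes f: "f \<in> C1"
  shows "f \<in> borel_measurable borel" "dx f \<in> borel_measurable borel" "dy f \<in> borel_measurable borel"
  using C1_continuous[OF f] by (auto intro: borel_measurable_continuous_onI)

lemma bounded_continuous_bound:
  fixes f :: "'a::heine_borel \<Rightarrow> real"
  assumes "bounded S" "continuous_on UNIV f"
  obtains B where "\<And>z. z \<in> S \<Longrightarrow> \<bar>f z\<bar> \<le> B"
proof -
  have "compact (closure S)" using assms(1) by (simp add: compact_closure)
  then have "bounded (f ` closure S)"
    using assms(2) by (intro compact_imp_bounded compact_continuous_image) (auto intro: continuous_on_subset)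
  then obtain B where "\<And>y. y \<in> f ` closure S \<Longrightarrow> norm y \<le> B" unfolding bounded_iff by blast
  then show thesis using closure_subset[of S] by (intro that[of B]) auto
qed

lemma set_integrable_continuous_bounded:
  fixes f :: "plane \<Rightarrow> real"
  assumes "bounded S" "S \<in> sets borel" "continuous_on UNIV f"
  shows "set_integrable lborel S f" "set_integrable lebesgue S f"
proof -
  obtain B where B: "\<And>z. z \<in> S \<Longrightarrow> \<bar>f z\<bar> \<le> B" using bounded_continuous_bound assms by blast
  have "emeasure lborel S < \<infinity>" using emeasure_bounded_finite[OF assms(1)] by simp
  moreover have f: "f \<in> borel_measurable borel" using assms(3) by (rule borel_measurable_continuous_onI)
  ultimately show l: "set_integrable lborel S f"
    using assms B by (intro set_integrable_bounded[where B = B]) auto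
  then show "set_integrable lebesgue S f"
    unfolding set_integrable_def using f assms(2) by (subst integrable_completion) simp_all
qed

context polygonal_boundary
begin

lemma frontier_decomposition:
  "frontier \<Omega> - {z. fst z \<in> exceptional} = (\<Union>l\<in>Lines. line l ` on_line l)"
proof (intro equalityI subsetI)
  fix z assume "z \<in> frontier \<Omega> - {z. fst z \<in> exceptional}"
  then have z: "z \<in> frontier \<Omega>" "fst z \<notin> exceptional" by auto
  obtain l where "l \<in> Lines" "z = line l (fst z)" using frontier_locally_line[OF z] by blast
  moreover from this have "fst z \<in> on_line l" using z by (simp add: on_line_def)
  ultimately show "z \<in> (\<Union>l\<in>Lines. line l ` on_line l)" by blast
qed (auto simp: on_line_def)

text \<open>Over the exceptional abscissae there are, up to finitely many points, only interior points of
  vertical boundary segments, at which a normal must be horizontal.\<close>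

lemma AE_normal_exceptional:
  "AE z in hausdorff1. z \<in> frontier \<Omega> \<and> fst z \<in> exceptional \<longrightarrow> snd (outward_normal \<Omega> z) = 0"
proof -
  \<comment> \<open>contains the end points and all points of nonvertical segments over exceptional abscissae\<close>
  define P where "P = (\<Union>l\<in>Lines. line l ` exceptional) \<union> fst ` E \<union> snd ` E"
  have "finite P" using finite_Lines finite_exceptional finite_E by (simp add: P_def)
  then have "AE z in hausdorff1. z \<notin> P"
    by (intro AE_not_in) (auto simp: null_sets_def emeasure_hausdorff1_finite finite_imp_closed borel_closed)
  then show ?thesis
  proof eventually_elim
    case (elim z)
    show ?case
    proof (intro impI)
      assume z: "z \<in> frontier \<Omega> \<and> fst z \<in> exceptional"
      then obtain s where s: "s \<in> E" "z \<in> closed_segment (fst s) (snd s)"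
        unfolding frontier_eq by auto
      have ends: "z \<noteq> fst s" "z \<noteq> snd s" using elim s(1) by (auto simp: P_def)
      have vert: "fst (fst s) = fst (snd s)"
      proof (rule ccontr)
        assume "fst (fst s) \<noteq> fst (snd s)"
        from segment_on_line[OF s(1) this] s(2) obtain l where "l \<in> Lines" "z = line l (fst z)" by blast
        then show False using elim z unfolding P_def by blast
      qed
      define d where "d = snd s - fst s"
      obtain u where u: "0 \<le> u" "u \<le> 1" "z = fst s + u *\<^sub>R d"
        using s(2) by (auto simp: closed_segment_def d_def algebra_simps)
      have "u \<noteq> 0" "u \<noteq> 1" using ends u(3) by (auto simp: d_def)
      then have u': "0 < u" "u < 1" using u by auto
      have d: "fst d = 0" "snd d \<noteq> 0" using vert ends u(3) by (auto simp: d_def prod_eq_iff)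
      have on: "z + t *\<^sub>R d \<in> frontier \<Omega>" if "0 \<le> u + t" "u + t \<le> 1" for t
      proof -
        have "z + t *\<^sub>R d = (1 - (u + t)) *\<^sub>R fst s + (u + t) *\<^sub>R snd s"
          by (simp add: u(3) d_def algebra_simps)
        then have "z + t *\<^sub>R d \<in> closed_segment (fst s) (snd s)"
          using that unfolding closed_segment_def by blast
        then show ?thesis unfolding frontier_eq using s(1) by (auto simp: case_prod_unfold)
      qed
      show "snd (outward_normal \<Omega> z) = 0"
      proof (cases "\<exists>n. is_outward_normal \<Omega> z n")
        case True
        then obtain n where n: "is_outward_normal \<Omega> z n" by blast
        obtain e where e: "0 < e" "\<And>q. dist z q < e \<Longrightarrow> q \<in> \<Omega> \<longleftrightarrow> (q - z) \<bullet> n < 0"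
          using is_outward_normalE[OF n] by blast
        obtain t0 where t0: "0 < t0" "dist z (z + t0 *\<^sub>R d) < e" "dist z (z - t0 *\<^sub>R d) < e"
          using small_multiple_in_ball[OF e(1)] by blast
        define t where "t = min t0 (min u (1 - u))"
        have t: "0 < t" "t \<le> t0" "t \<le> u" "t \<le> 1 - u" using t0 u' by (auto simp: t_def)
        have "t * norm d \<le> t0 * norm d" using t by (intro mult_right_mono) auto
        then have near: "dist z (z + t *\<^sub>R d) < e" "dist z (z + (- t) *\<^sub>R d) < e"
          using t0 t by (auto simp: dist_norm)
        have "z + t *\<^sub>R d \<notin> \<Omega>" "z + (- t) *\<^sub>R d \<notin> \<Omega>"
          using on[of t] on[of "- t"] t u' open_dom by (auto simp: frontier_def interior_open)
        then have "0 \<le> t * (d \<bullet> n)" "0 \<le> - (t * (d \<bullet> n))"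
          using e(2)[OF near(1)] e(2)[OF near(2)] by auto
        then have "d \<bullet> n = 0" using t(1) by (simp add: mult_le_0_iff zero_le_mult_iff)
        then have "snd n = 0" using d by (simp add: inner_prod_def)
        then show ?thesis using n by (simp add: outward_normal_eq)
      next
        case False
        then have "outward_normal \<Omega> z = 0" by (intro outward_normal_eq_0) blast
        then show ?thesis by simp
      qed
    qed
  qed
qed

lemma finite_hausdorff1_frontier: "emeasure hausdorff1 (frontier \<Omega>) < \<infinity>"
proof -
  have "hausdorff1_outer (closed_segment a b) < \<infinity>" for a b :: plane
  proof (cases "a = b")
    case True
    then have "hausdorff1_outer (closed_segment a b) = 0"
      using emeasure_hausdorff1_finite[of "{a}"] by (simp add: emeasure_hausdorff1)
    then show ?thesis by simp
  next
    case False
    define g where "g t = a + t *\<^sub>R (b - a)" for t :: real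
    have "dist (g s) (g t) = norm (b - a) * \<bar>s - t\<bar>" for s t
    proof -
      have "g s - g t = (s - t) *\<^sub>R (b - a)" by (simp add: g_def algebra_simps)
      then show ?thesis by (simp add: dist_norm)
    qed
    moreover have "closed_segment a b = g ` {0..1}"
      by (simp add: closed_segment_image_interval g_def algebra_simps)
    ultimately have "hausdorff1_outer (closed_segment a b) \<le> ennreal (norm (b - a) * (1 - 0))"
      using hausdorff1_outer_similarity_le[of g "norm (b - a)" 0 1] False by simp
    then show ?thesis by (simp add: order_le_less_trans)
  qed
  then have seg: "emeasure hausdorff1 (closed_segment a b) < \<infinity>" for a b :: plane
    by (simp add: emeasure_hausdorff1)
  have "emeasure hausdorff1 (frontier \<Omega>) \<le> (\<Sum>s\<in>E. emeasure hausdorff1 (closed_segment (fst s) (snd s)))"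
    unfolding frontier_eq case_prod_unfold
    by (rule emeasure_subadditive_finite) (use finite_E in auto)
  also have "\<dots> < \<infinity>" using seg finite_E by (simp add: less_top)
  finally show ?thesis .
qed

lemma set_integrable_frontier:
  fixes f :: "plane \<Rightarrow> real"
  assumes "f \<in> borel_measurable borel" "\<And>z. z \<in> frontier \<Omega> \<Longrightarrow> \<bar>f z\<bar> \<le> B"
  shows "set_integrable hausdorff1 (frontier \<Omega>) f"
  using assms finite_hausdorff1_frontier
  by (intro set_integrable_bounded[where B = B]) (auto simp: measurable_cong_sets[OF sets_hausdorff1 refl])

lemma
  shows borel_measurable_xn2_frontier: "(\<lambda>z. indicator (frontier \<Omega>) z * xn2 \<Omega> z) \<in> borel_measurable hausdorff1"
    and bounded_xn2_frontier: "\<exists>B. \<forall>z. \<bar>indicator (frontier \<Omega>) z * xn2 \<Omega> z\<bar> \<le> B"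
proof -
  have sets: "frontier \<Omega> \<in> sets borel" by (simp add: borel_closed)
  note [measurable] = sets
  show "(\<lambda>z. indicator (frontier \<Omega>) z * xn2 \<Omega> z) \<in> borel_measurable hausdorff1"
    unfolding measurable_cong_sets[OF sets_hausdorff1 refl] by measurable
  have fst_cont: "continuous_on UNIV (fst :: plane \<Rightarrow> real)" by (intro continuous_intros)
  obtain B where B: "\<And>z. z \<in> frontier \<Omega> \<Longrightarrow> \<bar>fst z\<bar> \<le> B"
    using bounded_continuous_bound[OF bounded_frontier_dom fst_cont] by blast
  have "\<bar>indicator (frontier \<Omega>) z * xn2 \<Omega> z\<bar> \<le> max B 0" for z
  proof (cases "z \<in> frontier \<Omega>")
    case True
    have "\<bar>xn2 \<Omega> z\<bar> \<le> B * 1"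
      unfolding xn2_def abs_mult using B[OF True] abs_snd_outward_normal_le[of \<Omega> z] by (intro mult_mono) auto
    then show ?thesis using True by simp
  qed simp
  then show "\<exists>B. \<forall>z. \<bar>indicator (frontier \<Omega>) z * xn2 \<Omega> z\<bar> \<le> B" by blast
qed

lemma integral_vertical_slice:
  assumes f: "f \<in> C1" and x: "x \<notin> exceptional"
  shows "(LINT t|lborel. indicator \<Omega> (x, t) * dy f (x, t)) =
    (\<Sum>l\<in>Lines. indicator (on_line l) x * (jump (line l x) * f (line l x)))"
proof -
  obtain M where M: "0 < M" "\<And>z. z \<in> \<Omega> \<union> frontier \<Omega> \<Longrightarrow> \<bar>fst z\<bar> < M \<and> \<bar>snd z\<bar> < M"
    using box_bound by blast
  define U where "U = {t. (x, t) \<in> \<Omega>}"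
  define L where "L = {l \<in> Lines. x \<in> on_line l}"
  define Y where "Y = (\<lambda>l. snd (line l x)) ` L"
  have fin: "finite L" unfolding L_def using finite_Lines by simp
  have inj: "inj_on (\<lambda>l. snd (line l x)) L"
  proof (rule inj_onI)
    fix l k assume "l \<in> L" "k \<in> L" "snd (line l x) = snd (line k x)"
    then show "l = k" using on_line_unique[OF _ _ x] by (simp add: L_def line_def)
  qed
  have Y: "Y = {t. (x, t) \<in> frontier \<Omega>}"
  proof (intro equalityI subsetI)
    fix t assume "t \<in> {t. (x, t) \<in> frontier \<Omega>}"
    then have "(x, t) \<in> frontier \<Omega> - {z. fst z \<in> exceptional}" using x by simp
    then obtain l y where l: "l \<in> Lines" "(x, t) = line l y" "y \<in> on_line l"
      unfolding frontier_decomposition by auto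
    then have "y = x" by (metis fst_conv fst_line)
    then show "t \<in> Y" using l unfolding Y_def L_def by (metis (mono_tags, lifting) image_eqI mem_Collect_eq snd_conv)
  qed (auto simp: Y_def L_def on_line_def line_def)
  have cont: "continuous_on UNIV (\<lambda>t. (x, t))" by (intro continuous_intros)
  have U: "open U"
    using open_vimage[OF open_dom cont] by (simp add: U_def vimage_def)
  have front: "frontier U \<subseteq> Y"
  proof
    fix t assume t: "t \<in> frontier U"
    then have "t \<notin> U" "t \<in> closure U" using U by (auto simp: frontier_def interior_open)
    moreover have "(\<lambda>t. (x, t)) ` closure U \<subseteq> closure \<Omega>"
      by (rule image_closure_subset[OF continuous_on_subset[OF cont]])
        (use closure_subset[of \<Omega>] in \<open>auto simp: U_def\<close>)
    ultimately have "(x, t) \<in> closure \<Omega>" by blast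
    then show "t \<in> Y" using \<open>t \<notin> U\<close> open_dom by (simp add: Y U_def frontier_def interior_open)
  qed
  have big: "t \<notin> U" if "M \<le> \<bar>t\<bar>" for t
  proof
    assume "t \<in> U"
    then have "\<bar>t\<bar> < M" using M(2)[of "(x, t)"] by (simp add: U_def)
    then show False using that by simp
  qed
  have slice: "U \<inter> {- M - 1<..<M + 1} = U"
    using big by (force simp: not_le[symmetric] abs_le_iff)
  have Y_sub: "Y \<subseteq> {- M - 1<..<M + 1}"
  proof
    fix t assume "t \<in> Y"
    then have "\<bar>t\<bar> < M" using M(2)[of "(x, t)"] by (simp add: Y)
    then show "t \<in> {- M - 1<..<M + 1}" by auto
  qed
  have ends: "\<not> (\<forall>\<^sub>F t in at_left (M + 1). t \<in> U)" "\<not> (\<forall>\<^sub>F t in at_right (- M - 1). t \<in> U)"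
  proof -
    have "\<forall>\<^sub>F t in at_left (M + 1). t \<in> {M<..<M + 1}" by (rule eventually_at_left_real) simp
    then have "\<forall>\<^sub>F t in at_left (M + 1). t \<notin> U" by eventually_elim (rule big, use M(1) in auto)
    then show "\<not> (\<forall>\<^sub>F t in at_left (M + 1). t \<in> U)"
      using eventually_conj eventually_happens'[OF trivial_limit_at_left_real] by blast
    have "\<forall>\<^sub>F t in at_right (- M - 1). t \<in> {- M - 1<..<- M}" by (rule eventually_at_right_real) simp
    then have "\<forall>\<^sub>F t in at_right (- M - 1). t \<notin> U" by eventually_elim (rule big, use M(1) in auto)
    then show "\<not> (\<forall>\<^sub>F t in at_right (- M - 1). t \<in> U)"
      using eventually_conj eventually_happens'[OF trivial_limit_at_right_real] by blast
  qed
  have cont_dy: "continuous_on UNIV (\<lambda>t. dy f (x, t))"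
    using continuous_on_compose2[OF C1_continuous(3)[OF f] cont] by simp
  have "(LINT t|lborel. indicator \<Omega> (x, t) * dy f (x, t)) = (LINT t:U|lborel. dy f (x, t))"
    unfolding set_lebesgue_integral_def
    by (intro Bochner_Integration.integral_cong) (auto simp: U_def indicator_def)
  also have "\<dots> = (LINT t:U \<inter> {- M - 1<..<M + 1}|lborel. dy f (x, t))" by (simp only: slice)
  also have "\<dots> = (\<Sum>y\<in>Y. (of_bool (\<forall>\<^sub>F t in at_left y. t \<in> U) - of_bool (\<forall>\<^sub>F t in at_right y. t \<in> U)) * f (x, y))"
    using integral_deriv_open_subset[of "\<lambda>t. f (x, t)" "\<lambda>t. dy f (x, t)" U Y "- M - 1" "M + 1"]
      C1_has_derivative(2)[OF f] cont_dy U fin front Y_sub M(1) ends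
    by (auto simp: Y_def)
  also have "\<dots> = (\<Sum>y\<in>Y. jump (x, y) * f (x, y))"
    by (simp add: jump_def below_def above_def U_def)
  also have "\<dots> = (\<Sum>l\<in>L. jump (line l x) * f (line l x))"
    unfolding Y_def by (subst sum.reindex[OF inj]) (simp add: line_def)
  also have "\<dots> = (\<Sum>l\<in>Lines. indicator (on_line l) x * (jump (line l x) * f (line l x)))"
    unfolding L_def using finite_Lines by (intro sum.mono_neutral_cong_left) (auto simp: indicator_def)
  finally show ?thesis .
qed

text \<open>The image of Lebesgue measure under \<open>line l\<close> is Hausdorff measure on the line, divided by
  \<open>speed l\<close>, and \<open>speed l * n\<^sub>2\<close> is the sign \<open>jump\<close> (\<open>speed_normal_on_line\<close>). Hence the boundary
  integral is the integral over \<open>x\<close> of the one-dimensional boundary terms, which Fubini's theorem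
  identifies with the domain integral.\<close>

theorem divergence_theorem_y:
  assumes f: "f \<in> C1"
  shows "(LINT z:\<Omega>|lebesgue. dy f z) = (LINT z:frontier \<Omega>|hausdorff1. snd (outward_normal \<Omega> z) * f z)"
proof -
  define g where "g z = snd (outward_normal \<Omega> z) * f z" for z
  note C1_borel_measurable[OF f, measurable]
  have g [measurable]: "g \<in> borel_measurable borel"
    unfolding g_def[abs_def] by measurable
  obtain B where B: "\<And>z. z \<in> frontier \<Omega> \<Longrightarrow> \<bar>f z\<bar> \<le> B"
    using bounded_continuous_bound[OF bounded_frontier_dom C1_continuous(1)[OF f]] by blast
  have g_le: "\<bar>g z\<bar> \<le> B" if "z \<in> frontier \<Omega>" for z
    using mult_mono[OF abs_snd_outward_normal_le[of \<Omega> z] B[OF that]] by (simp add: g_def abs_mult)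
  obtain a b where ab: "\<And>l. on_line l \<subseteq> {a..b}" using on_line_bounded by blast
  have int_on: "set_integrable lborel (on_line l) (\<lambda>t. speed l * g (line l t))" for l
  proof (rule set_integrable_bounded)
    interpret line_parametrization "line l" fst "speed l" by (rule line_parametrization)
    show "(\<lambda>t. speed l * g (line l t)) \<in> borel_measurable lborel" by measurable
    have "emeasure lborel (on_line l) \<le> emeasure lborel {a..b}"
      by (rule emeasure_mono[OF ab]) simp
    then show "emeasure lborel (on_line l) < \<infinity>" by (rule order_le_less_trans) (simp add: emeasure_lborel_Icc_eq)
    show "norm (speed l * g (line l t)) \<le> speed l * B" if "t \<in> on_line l" for t
      using that g_le[of "line l t"] speed_pos[of l] by (simp add: on_line_def abs_mult)
  qed (simp add: borel_on_line)
  have image_meas: "line l ` on_line l \<in> sets borel" for l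
    using line_parametrization.image_measurable[OF line_parametrization borel_on_line] .
  have int2: "integrable (lborel \<Otimes>\<^sub>M lborel) (\<lambda>z. indicator \<Omega> z * dy f z)"
    using set_integrable_continuous_bounded(1)[OF bounded_dom _ C1_continuous(3)[OF f]] open_dom
    by (simp add: lborel_prod set_integrable_def)
  define R where "R = (\<Union>l\<in>Lines. line l ` on_line l)"
  have "(LINT z:frontier \<Omega>|hausdorff1. g z) = (LINT z:R|hausdorff1. g z)"
    unfolding set_lebesgue_integral_def
  proof (rule integral_cong_AE)
    show "AE z in hausdorff1. indicat_real (frontier \<Omega>) z *\<^sub>R g z = indicat_real R z *\<^sub>R g z"
      using AE_normal_exceptional
      by eventually_elim (auto simp flip: frontier_decomposition simp: R_def g_def indicator_def)
    have [measurable]: "R \<in> sets borel" "frontier \<Omega> \<in> sets borel"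
      unfolding R_def using finite_Lines image_meas by (auto intro: borel_closed)
    show "(\<lambda>z. indicat_real (frontier \<Omega>) z *\<^sub>R g z) \<in> borel_measurable hausdorff1"
      "(\<lambda>z. indicat_real R z *\<^sub>R g z) \<in> borel_measurable hausdorff1"
      unfolding measurable_cong_sets[OF sets_hausdorff1 refl] by measurable
  qed
  also have "\<dots> = (\<Sum>l\<in>Lines. LINT z:line l ` on_line l|hausdorff1. g z)"
    unfolding R_def
  proof (rule set_integral_finite_Union[OF finite_Lines])
    show "disjoint_family_on (\<lambda>l. line l ` on_line l) Lines"
      unfolding disjoint_family_on_def
    proof (intro ballI impI, rule ccontr)
      fix l k assume lk: "l \<in> Lines" "k \<in> Lines" "l \<noteq> k"
      assume "line l ` on_line l \<inter> line k ` on_line k \<noteq> {}"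
      then obtain x y where xy: "x \<in> on_line l" "line l x = line k y" by blast
      then have "x = y" by (metis fst_line)
      with xy lk show False using on_line_unique by (metis (mono_tags) on_line_def mem_Collect_eq)
    qed
    show "set_integrable hausdorff1 (line l ` on_line l) g" for l
      using line_parametrization.integrable_image_iff[OF line_parametrization borel_on_line ab g] int_on by blast
  qed (simp add: image_meas)
  also have "\<dots> = (\<Sum>l\<in>Lines. LINT x:on_line l|lborel. speed l * g (line l x))"
    by (intro sum.cong refl line_parametrization.integral_image[OF line_parametrization borel_on_line ab g])
  also have "\<dots> = (LINT x|lborel. (\<Sum>l\<in>Lines. indicator (on_line l) x *\<^sub>R (speed l * g (line l x))))"
    unfolding set_lebesgue_integral_def using int_on
    by (intro Bochner_Integration.integral_sum[symmetric]) (simp add: set_integrable_def)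
  also have "\<dots> = (LINT x|lborel. (LINT t|lborel. indicator \<Omega> (x, t) * dy f (x, t)))"
  proof (rule integral_cong_AE)
    have "AE x in lborel. x \<notin> exceptional"
      by (rule AE_not_in) (use finite_exceptional in \<open>auto intro: finite_imp_null_set_lborel\<close>)
    then show "AE x in lborel. (\<Sum>l\<in>Lines. indicator (on_line l) x *\<^sub>R (speed l * g (line l x)))
        = (LINT t|lborel. indicator \<Omega> (x, t) * dy f (x, t))"
    proof eventually_elim
      case (elim x)
      have "indicator (on_line l) x *\<^sub>R (speed l * g (line l x))
          = indicat_real (on_line l) x * (jump (line l x) * f (line l x))" if "l \<in> Lines" for l
        using speed_normal_on_line[OF that, of x] by (auto simp: indicator_def g_def mult.assoc[symmetric])
      then show ?case unfolding integral_vertical_slice[OF f elim] by (rule sum.cong[OF refl])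
    qed
    show "(\<lambda>x. \<Sum>l\<in>Lines. indicator (on_line l) x *\<^sub>R (speed l * g (line l x))) \<in> borel_measurable lborel"
      using int_on by (intro borel_measurable_sum borel_measurable_integrable) (simp add: set_integrable_def)
    show "(\<lambda>x. LINT t|lborel. indicator \<Omega> (x, t) * dy f (x, t)) \<in> borel_measurable lborel"
      by (rule borel_measurable_integrable[OF lborel_pair.integrable_fst'[OF int2]])
  qed
  also have "\<dots> = (LINT z|lborel. indicator \<Omega> z * dy f z)"
    using lborel_pair.integral_fst'[OF int2] by (simp add: lborel_prod)
  also have "\<dots> = (LINT z:\<Omega>|lebesgue. dy f z)"
    using set_integral_lebesgue_lborel[of \<Omega> "dy f"] open_dom by (simp add: set_lebesgue_integral_def)
  finally show ?thesis by (simp add: g_def)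
qed

end

text \<open>The version for the other coordinate follows by exchanging the coordinates.\<close>

lemma dist_swap: "dist (prod.swap z) (prod.swap w) = dist (z :: plane) w"
  by (simp add: dist_prod_def add.commute)

lemma linear_swap: "linear (prod.swap :: plane \<Rightarrow> plane)"
  by (rule linearI) (auto simp: prod_eq_iff)

lemma image_swap_eq: "prod.swap ` S = {z :: plane. prod.swap z \<in> S}"
proof (rule set_eqI)
  show "z \<in> prod.swap ` S \<longleftrightarrow> z \<in> {z. prod.swap z \<in> S}" for z
    by (metis image_iff mem_Collect_eq swap_swap)
qed

lemma frontier_swap: "frontier (prod.swap ` S) = prod.swap ` frontier (S :: plane set)"
  unfolding frontier_def
  by (simp add: closure_injective_linear_image[OF linear_swap inj_swap, symmetric]
      interior_injective_linear_image[OF linear_swap inj_swap] image_set_diff[OF inj_swap])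

lemma is_outward_normal_swap:
  assumes "is_outward_normal S z n"
  shows "is_outward_normal (prod.swap ` S) (prod.swap z) (prod.swap n)"
proof -
  obtain e where e: "norm n = 1" "0 < e" "\<And>q. dist z q < e \<Longrightarrow> q \<in> S \<longleftrightarrow> (q - z) \<bullet> n < 0"
    using is_outward_normalE[OF assms] by blast
  have "norm (prod.swap n) = 1" using e(1) by (simp add: norm_prod_def add.commute)
  moreover have "q \<in> prod.swap ` S \<longleftrightarrow> (q - prod.swap z) \<bullet> prod.swap n < 0" if "dist (prod.swap z) q < e" for q
  proof -
    have "dist z (prod.swap q) < e" using that dist_swap[of z "prod.swap q"] by simp
    moreover have "(q - prod.swap z) \<bullet> prod.swap n = (prod.swap q - z) \<bullet> n"
      by (simp add: inner_prod_def add.commute)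
    ultimately show ?thesis using e(3) by (simp add: image_swap_eq)
  qed
  ultimately show ?thesis
    using e(2) unfolding is_outward_normal_def by (intro conjI exI[of _ e]) (auto simp: mem_ball)
qed

lemma outward_normal_swap:
  "outward_normal (prod.swap ` S) (prod.swap z) = prod.swap (outward_normal S z)"
proof (cases "\<exists>n. is_outward_normal S z n")
  case True
  then obtain n where "is_outward_normal S z n" by blast
  then show ?thesis using is_outward_normal_swap outward_normal_eq by metis
next
  case False
  have "\<not> is_outward_normal (prod.swap ` S) (prod.swap z) n" for n
  proof
    assume "is_outward_normal (prod.swap ` S) (prod.swap z) n"
    from is_outward_normal_swap[OF this] have "is_outward_normal S z (prod.swap n)"
      by (simp add: image_image)
    with False show False by blast
  qed
  then have "outward_normal (prod.swap ` S) (prod.swap z) = 0" by (rule outward_normal_eq_0)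
  moreover have "outward_normal S z = 0" by (rule outward_normal_eq_0) (use False in blast)
  ultimately show ?thesis by (simp add: zero_prod_def)
qed

lemma integral_lborel_swap:
  fixes f :: "plane \<Rightarrow> real"
  assumes [measurable]: "f \<in> borel_measurable borel"
  shows "(LINT z|lborel. f (prod.swap z)) = (LINT z|lborel. f z)"
  using lborel_pair.integral_product_swap[of f] by (simp add: lborel_prod case_prod_unfold prod.swap_def)

lemma C1_swap:
  assumes f: "f \<in> C1"
  shows "f \<circ> prod.swap \<in> C1" "dy (f \<circ> prod.swap) z = dx f (prod.swap z)" "dx (f \<circ> prod.swap) z = dy f (prod.swap z)"
proof -
  show dy: "dy (f \<circ> prod.swap) z = dx f (prod.swap z)" and dx: "dx (f \<circ> prod.swap) z = dy f (prod.swap z)" for z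
    by (simp_all add: dx_def dy_def)
  have cont: "continuous_on UNIV (prod.swap :: plane \<Rightarrow> plane)"
    by (intro continuous_on_swap)
  have "f differentiable (at z)" for z using f unfolding C1_def by blast
  then have "(f \<circ> prod.swap) differentiable (at z)" for z
    using linear_imp_differentiable[OF linear_swap] by (intro differentiable_chain_at) auto
  moreover have "continuous_on UNIV (\<lambda>z. dx f (prod.swap z))" "continuous_on UNIV (\<lambda>z. dy f (prod.swap z))"
    using continuous_on_compose2[OF _ cont] C1_continuous(2,3)[OF f] by auto
  ultimately show "f \<circ> prod.swap \<in> C1"
    by (simp add: C1_def grad_def[abs_def] dx dy continuous_on_Pair)
qed

theorem (in polygonal_boundary) divergence_theorem_x:
  assumes f: "f \<in> C1"
  shows "(LINT z:\<Omega>|lebesgue. dx f z) = (LINT z:frontier \<Omega>|hausdorff1. n1 \<Omega> z * f z)"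
proof -
  let ?s = "prod.swap :: plane \<Rightarrow> plane"
  interpret swapped: polygonal_boundary "?s ` \<Omega>" "(\<lambda>(a, b). (?s a, ?s b)) ` E"
  proof
    have cont: "continuous_on UNIV ?s" by (intro continuous_on_swap)
    show "open (?s ` \<Omega>)"
      using open_vimage[OF open_dom cont] by (simp add: image_swap_eq vimage_def)
    show "bounded (?s ` \<Omega>)"
      using bounded_linear_image[OF bounded_dom] linear_swap linear_linear by blast
    have "frontier (?s ` \<Omega>) = (\<Union>(a, b)\<in>E. ?s ` closed_segment a b)"
      unfolding frontier_swap frontier_eq by auto
    then show "frontier (?s ` \<Omega>) = (\<Union>(a, b)\<in>(\<lambda>(a, b). (?s a, ?s b)) ` E. closed_segment a b)"
      by (simp add: closed_segment_linear_image[OF linear_swap] case_prod_unfold)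
  qed (simp add: finite_E)
  note fs = C1_swap[OF f]
  note [measurable] = C1_borel_measurable[OF f] C1_borel_measurable[OF fs(1)]
  have sets: "?s ` \<Omega> \<in> sets borel" "\<Omega> \<in> sets borel" "frontier \<Omega> \<in> sets borel"
    using swapped.open_dom open_dom by (auto intro: borel_closed)
  note [measurable] = sets
  have meas: "(\<lambda>z. snd (outward_normal (?s ` \<Omega>) z) * (f \<circ> ?s) z) \<in> borel_measurable borel"
    by (intro borel_measurable_times measurable_compose[OF borel_measurable_outward_normal]
        borel_measurable_fst_snd C1_borel_measurable[OF fs(1)])
  have "(LINT z:\<Omega>|lebesgue. dx f z) = (LINT z|lborel. indicator \<Omega> z * dx f z)"
    using sets by (simp add: set_integral_lebesgue_lborel) (simp add: set_lebesgue_integral_def)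
  also have "\<dots> = (LINT z|lborel. indicator \<Omega> (?s z) * dx f (?s z))"
    by (rule integral_lborel_swap[symmetric]) measurable
  also have "\<dots> = (LINT z|lborel. indicator (?s ` \<Omega>) z * dy (f \<circ> ?s) z)"
    by (simp add: fs(2) image_swap_eq indicator_def)
  also have "\<dots> = (LINT z:?s ` \<Omega>|lebesgue. dy (f \<circ> ?s) z)"
    using sets by (simp add: set_integral_lebesgue_lborel) (simp add: set_lebesgue_integral_def)
  also have "\<dots> = (LINT z:?s ` frontier \<Omega>|hausdorff1. snd (outward_normal (?s ` \<Omega>) z) * (f \<circ> ?s) z)"
    unfolding swapped.divergence_theorem_y[OF fs(1)] frontier_swap ..
  also have "\<dots> = (LINT z:frontier \<Omega>|hausdorff1. snd (outward_normal (?s ` \<Omega>) (?s z)) * (f \<circ> ?s) (?s z))"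
    by (rule integral_hausdorff1_isometry[OF dist_swap _ meas sets(3)]) simp
  also have "\<dots> = (LINT z:frontier \<Omega>|hausdorff1. n1 \<Omega> z * f z)"
    by (simp add: outward_normal_swap n1_def)
  finally show ?thesis .
qed

lemma polygonal_domain_boundary:
  assumes "polygonal_domain \<Omega>"
  obtains E where "polygonal_boundary \<Omega> E"
  using assms unfolding polygonal_domain_def polygonal_boundary_def by blast

section \<open>Continuously differentiable functions and polynomials\<close>

lemma C1I:
  assumes "\<And>z. f differentiable (at z)" "continuous_on UNIV (dx f)" "continuous_on UNIV (dy f)"
  shows "f \<in> C1"
  using assms unfolding C1_def grad_def[abs_def] by (auto intro: continuous_on_Pair)

lemma dx_eqI: "((\<lambda>s. f (s, snd z)) has_real_derivative D) (at (fst z)) \<Longrightarrow> dx f z = D"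
  unfolding dx_def by (rule DERIV_imp_deriv)

lemma dy_eqI: "((\<lambda>s. f (fst z, s)) has_real_derivative D) (at (snd z)) \<Longrightarrow> dy f z = D"
  unfolding dy_def by (rule DERIV_imp_deriv)

lemma C1_dx: "f \<in> C1 \<Longrightarrow> ((\<lambda>s. f (s, snd z)) has_real_derivative dx f z) (at (fst z))"
  using C1_has_derivative(1)[of f "snd z" "fst z"] by simp

lemma C1_dy: "f \<in> C1 \<Longrightarrow> ((\<lambda>s. f (fst z, s)) has_real_derivative dy f z) (at (snd z))"
  using C1_has_derivative(2)[of f "fst z" "snd z"] by simp

lemma C1_differentiable: "f \<in> C1 \<Longrightarrow> f differentiable (at z)"
  unfolding C1_def by blast

lemma
  assumes f: "f \<in> C1" and g: "g \<in> C1"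
  shows C1_mult: "(\<lambda>z. f z * g z) \<in> C1"
    and dx_mult: "dx (\<lambda>z. f z * g z) = (\<lambda>z. dx f z * g z + f z * dx g z)"
    and dy_mult: "dy (\<lambda>z. f z * g z) = (\<lambda>z. dy f z * g z + f z * dy g z)"
proof -
  show dx: "dx (\<lambda>z. f z * g z) = (\<lambda>z. dx f z * g z + f z * dx g z)"
    by (rule ext, rule dx_eqI) (use DERIV_mult'[OF C1_dx[OF f] C1_dx[OF g]] in \<open>simp add: add.commute\<close>)
  show dy: "dy (\<lambda>z. f z * g z) = (\<lambda>z. dy f z * g z + f z * dy g z)"
    by (rule ext, rule dy_eqI) (use DERIV_mult'[OF C1_dy[OF f] C1_dy[OF g]] in \<open>simp add: add.commute\<close>)
  show "(\<lambda>z. f z * g z) \<in> C1"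
  proof (rule C1I)
    show "(\<lambda>z. f z * g z) differentiable (at z)" for z
      by (intro differentiable_mult C1_differentiable f g)
  qed (unfold dx dy, (intro continuous_intros C1_continuous f g)+)
qed

lemma
  assumes f: "f \<in> C1" and g: "g \<in> C1"
  shows C1_add: "(\<lambda>z. f z + g z) \<in> C1"
    and dx_add: "dx (\<lambda>z. f z + g z) = (\<lambda>z. dx f z + dx g z)"
    and dy_add: "dy (\<lambda>z. f z + g z) = (\<lambda>z. dy f z + dy g z)"
proof -
  show dx: "dx (\<lambda>z. f z + g z) = (\<lambda>z. dx f z + dx g z)"
    by (rule ext, rule dx_eqI) (rule DERIV_add[OF C1_dx[OF f] C1_dx[OF g]])
  show dy: "dy (\<lambda>z. f z + g z) = (\<lambda>z. dy f z + dy g z)"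
    by (rule ext, rule dy_eqI) (rule DERIV_add[OF C1_dy[OF f] C1_dy[OF g]])
  show "(\<lambda>z. f z + g z) \<in> C1"
  proof (rule C1I)
    show "(\<lambda>z. f z + g z) differentiable (at z)" for z
      by (intro differentiable_add C1_differentiable f g)
  qed (unfold dx dy, (intro continuous_intros C1_continuous f g)+)
qed

lemma
  shows C1_const: "(\<lambda>z. c) \<in> C1" and dx_const: "dx (\<lambda>z. c) = (\<lambda>z. 0)" and dy_const: "dy (\<lambda>z. c) = (\<lambda>z. 0)"
proof -
  show dx: "dx (\<lambda>z. c) = (\<lambda>z. 0)" by (rule ext, rule dx_eqI) simp
  show dy: "dy (\<lambda>z. c) = (\<lambda>z. 0)" by (rule ext, rule dy_eqI) simp
  show "(\<lambda>z. c) \<in> C1" by (rule C1I) (auto simp: dx dy)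
qed

lemma
  shows C1_fst: "fst \<in> C1" and dx_fst: "dx fst = (\<lambda>z. 1)" and dy_fst: "dy fst = (\<lambda>z. 0)"
proof -
  show dx: "dx fst = (\<lambda>z. 1)" by (rule ext, rule dx_eqI) simp
  show dy: "dy fst = (\<lambda>z. 0)" by (rule ext, rule dy_eqI) simp
  show "fst \<in> C1"
    by (rule C1I) (auto simp: dx dy intro: linear_imp_differentiable linear_fst)
qed

lemma C1_cmult: "f \<in> C1 \<Longrightarrow> (\<lambda>z. c * f z) \<in> C1"
  by (rule C1_mult[OF C1_const])

lemma dx_cmult: "f \<in> C1 \<Longrightarrow> dx (\<lambda>z. c * f z) = (\<lambda>z. c * dx f z)"
  by (simp add: dx_mult[OF C1_const] dx_const)

text \<open>Index sets are arbitrary and monomials may be repeated, so that differentiation changes only the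
  coefficients and exponents but not the set of indices.\<close>

definition monomial_sum :: "'i set \<Rightarrow> ('i \<Rightarrow> real) \<Rightarrow> ('i \<Rightarrow> nat) \<Rightarrow> ('i \<Rightarrow> nat) \<Rightarrow> plane \<Rightarrow> real" where
  "monomial_sum I c m n z = (\<Sum>i\<in>I. c i * (fst z ^ m i * snd z ^ n i))"

lemma dx_monomial_sum:
  "dx (monomial_sum I c m n) = monomial_sum I (\<lambda>i. c i * real (m i)) (\<lambda>i. m i - 1) n"
  unfolding monomial_sum_def[abs_def]
  by (rule ext, rule dx_eqI, rule DERIV_sum) (auto intro!: derivative_eq_intros)

lemma dy_monomial_sum:
  "dy (monomial_sum I c m n) = monomial_sum I (\<lambda>i. c i * real (n i)) m (\<lambda>i. n i - 1)"
  unfolding monomial_sum_def[abs_def]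
  by (rule ext, rule dy_eqI, rule DERIV_sum) (auto intro!: derivative_eq_intros)

lemma dx_dy_monomial_sum: "dx (dy (monomial_sum I c m n)) = dy (dx (monomial_sum I c m n))"
  by (simp add: dx_monomial_sum dy_monomial_sum mult_ac)

lemma finite_degrees: "finite {(i, j). i + j \<le> (p::nat)}"
  by (rule finite_subset[of _ "{..p} \<times> {..p}"]) auto

lemma monomial_sum_polys:
  assumes "finite I" "\<And>i. i \<in> I \<Longrightarrow> c i \<noteq> 0 \<Longrightarrow> m i + n i \<le> p"
  shows "monomial_sum I c m n \<in> polys p"
proof -
  define C where "C a b = (\<Sum>i\<in>I. if m i = a \<and> n i = b then c i else 0)" for a b
  have "monomial_sum I c m n (x, y) = (\<Sum>(a, b)\<in>{(i, j). i + j \<le> p}. C a b * x ^ a * y ^ b)" for x y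
  proof -
    have "(\<Sum>(a, b)\<in>{(i, j). i + j \<le> p}. C a b * x ^ a * y ^ b)
        = (\<Sum>k\<in>{(i, j). i + j \<le> p}. \<Sum>i\<in>I. if k = (m i, n i) then c i * (x ^ m i * y ^ n i) else 0)"
      by (intro sum.cong refl) (auto simp: C_def sum_distrib_right intro!: sum.cong)
    also have "\<dots> = (\<Sum>i\<in>I. \<Sum>k\<in>{(i, j). i + j \<le> p}. if k = (m i, n i) then c i * (x ^ m i * y ^ n i) else 0)"
      by (rule sum.swap)
    also have "\<dots> = (\<Sum>i\<in>I. c i * (x ^ m i * y ^ n i))"
      using assms(2) by (intro sum.cong refl) (auto simp: sum.delta finite_degrees)
    finally show ?thesis by (simp add: monomial_sum_def)
  qed
  then show ?thesis unfolding polys_def by blast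
qed

lemma polysE:
  assumes "q \<in> polys p"
  obtains c where "q = monomial_sum {(i, j). i + j \<le> p} c fst snd"
proof -
  obtain c where c: "\<And>x y. q (x, y) = (\<Sum>(i, j)\<in>{(i, j). i + j \<le> p}. c i j * x ^ i * y ^ j)"
    using assms unfolding polys_def by blast
  have "q = monomial_sum {(i, j). i + j \<le> p} (\<lambda>k. c (fst k) (snd k)) fst snd"
    by (rule ext) (auto simp: monomial_sum_def c case_prod_unfold mult.assoc)
  then show thesis by (rule that)
qed

lemma polys_dx: "q \<in> polys p \<Longrightarrow> dx q \<in> polys p"
  by (erule polysE) (auto simp: dx_monomial_sum intro!: monomial_sum_polys finite_degrees)

lemma polys_dy: "q \<in> polys p \<Longrightarrow> dy q \<in> polys p"
  by (erule polysE) (auto simp: dy_monomial_sum intro!: monomial_sum_polys finite_degrees)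

lemma polys_dx_dy: "q \<in> polys p \<Longrightarrow> dx (dy q) = dy (dx q)"
  by (erule polysE) (simp add: dx_dy_monomial_sum)

lemma polys_lincomb:
  assumes "q \<in> polys p" "r \<in> polys p"
  shows "(\<lambda>z. a * q z + b * r z) \<in> polys p"
proof -
  obtain c d where "q = monomial_sum {(i, j). i + j \<le> p} c fst snd" "r = monomial_sum {(i, j). i + j \<le> p} d fst snd"
    using assms by (metis polysE)
  then have "(\<lambda>z. a * q z + b * r z) = monomial_sum {(i, j). i + j \<le> p} (\<lambda>i. a * c i + b * d i) fst snd"
    by (auto simp: monomial_sum_def fun_eq_iff sum_distrib_left sum.distrib algebra_simps)
  then show ?thesis by (auto intro!: monomial_sum_polys finite_degrees)
qed

lemma polys_continuous: "q \<in> polys p \<Longrightarrow> continuous_on UNIV q"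
  by (erule polysE) (simp add: monomial_sum_def[abs_def] continuous_intros)

lemma polys_C1:
  assumes "q \<in> polys p"
  shows "q \<in> C1"
proof (rule C1I)
  show "continuous_on UNIV (dx q)" "continuous_on UNIV (dy q)"
    using assms by (auto intro: polys_continuous polys_dx polys_dy)
  obtain c where "q = monomial_sum {(i, j). i + j \<le> p} c fst snd" using assms by (rule polysE)
  then have q: "q = (\<lambda>z. \<Sum>k\<in>{(i, j). i + j \<le> p}. c k * (fst z ^ fst k * snd z ^ snd k))"
    by (simp add: monomial_sum_def[abs_def])
  show "q differentiable (at z)" for z
    unfolding q
    by (intro differentiable_sum finite_degrees ballI differentiable_mult differentiable_const differentiable_power
        linear_imp_differentiable linear_fst linear_snd)
qed

text \<open>Derivatives and one-sided limits only see the values on the open element.\<close>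

lemma dx_cong_open:
  assumes "open T" "z \<in> T" "\<And>w. w \<in> T \<Longrightarrow> f w = g w"
  shows "dx f z = dx g z"
proof -
  have "open ((\<lambda>s. (s, snd z)) -` T)" by (intro open_vimage assms continuous_intros)
  then have "\<forall>\<^sub>F s in nhds (fst z). s \<in> (\<lambda>s. (s, snd z)) -` T"
    by (rule eventually_nhds_in_open) (use assms in simp)
  then have "\<forall>\<^sub>F s in nhds (fst z). f (s, snd z) = g (s, snd z)"
    by eventually_elim (use assms in auto)
  then show ?thesis unfolding dx_def by (rule deriv_cong_ev) simp
qed

lemma dy_cong_open:
  assumes "open T" "z \<in> T" "\<And>w. w \<in> T \<Longrightarrow> f w = g w"
  shows "dy f z = dy g z"
proof -
  have "open ((\<lambda>s. (fst z, s)) -` T)" by (intro open_vimage assms continuous_intros)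
  then have "\<forall>\<^sub>F s in nhds (snd z). s \<in> (\<lambda>s. (fst z, s)) -` T"
    by (rule eventually_nhds_in_open) (use assms in simp)
  then have "\<forall>\<^sub>F s in nhds (snd z). f (fst z, s) = g (fst z, s)"
    by eventually_elim (use assms in auto)
  then show ?thesis unfolding dy_def by (rule deriv_cong_ev) simp
qed

lemma grad_cong_open:
  assumes "open T" "\<And>w. w \<in> T \<Longrightarrow> f w = g w" "z \<in> T"
  shows "grad f z = grad g z"
  using dx_cong_open[of T z f g] dy_cong_open[of T z f g] assms by (simp add: grad_def)

lemma Lop_cong_open:
  assumes T: "open T" "\<And>w. w \<in> T \<Longrightarrow> f w = g w" and z: "z \<in> T"
  shows "Lop f z = Lop g z"
  unfolding Lop_def using dx_cong_open[OF T(1) z dx_cong_open[OF T(1) _ T(2)]] dy_cong_open[OF T(1) z T(2)] by simp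

lemma inner_trace_eq:
  fixes f g :: "plane \<Rightarrow> 'b::t2_space"
  assumes "open T" "z \<in> closure T" "z \<notin> T" "continuous_on UNIV g" "\<And>w. w \<in> T \<Longrightarrow> f w = g w"
  shows "inner_trace T f z = g z"
proof -
  have "at z within T \<noteq> bot"
    using assms(2,3) by (simp add: at_within_eq_bot_iff closure_def islimpt_def trivial_limit_within)
  moreover have "(g \<longlongrightarrow> g z) (at z within T)"
    using assms(4) by (meson UNIV_I continuous_on continuous_on_subset tendsto_within_subset top_greatest)
  then have "(f \<longlongrightarrow> g z) (at z within T)"
    by (rule Lim_transform_eventually) (auto simp: eventually_at_filter assms(5))
  ultimately show ?thesis unfolding inner_trace_def by (rule tendsto_Lim)
qed


section \<open>Triangles\<close>

lemma
  assumes "open_triangle T"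
  shows open_triangle_open: "open T" and open_triangle_bounded: "bounded T"
    and open_triangle_nonempty: "T \<noteq> {}" and open_triangle_closure: "2 simplex closure T"
    and open_triangle_interior_closure: "interior (closure T) = T"
    and open_triangle_boundary: "\<exists>E. polygonal_boundary T E"
proof -
  obtain K where K: "2 simplex K" "T = interior K" using assms by (auto simp: open_triangle_def)
  then obtain C where C: "\<not> affine_dependent C" "card C = 3" "K = convex hull C"
    by (auto simp: simplex_def)
  then obtain a b c where abc: "C = {a, b, c}" by (auto simp: card_3_iff)
  have K': "convex K" "compact K" using K(1) by (auto simp: convex_simplex compact_simplex)
  have "aff_dim K = 2" using K(1) by (rule aff_dim_simplex)
  then have "affine hull K = UNIV" using aff_dim_eq_full[of K] by (simp add: DIM_prod)
  moreover have "rel_interior K \<noteq> {}" using K'(1) by (simp add: rel_interior_eq_empty C abc)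
  ultimately have int: "interior K \<noteq> {}" by (simp add: rel_interior_interior)
  have cl: "closure T = K"
    using convex_closure_interior[OF K'(1) int] K K'(2) by (simp add: compact_imp_closed)
  show "open T" "bounded T" "T \<noteq> {}" "2 simplex closure T" "interior (closure T) = T"
    using K K' int cl by (auto intro: bounded_subset[OF compact_imp_bounded interior_subset])
  have "frontier T = frontier K"
    using K cl K'(2) by (simp add: frontier_def compact_imp_closed)
  also have "\<dots> = closed_segment a b \<union> closed_segment b c \<union> closed_segment c a"
    unfolding C(3) abc by (rule frontier_of_triangle) (simp add: DIM_prod)
  finally have "polygonal_boundary T {(a, b), (b, c), (c, a)}"
    using \<open>open T\<close> \<open>bounded T\<close> by unfold_locales auto
  then show "\<exists>E. polygonal_boundary T E" by blast
qed

text \<open>Measurability and boundedness make the essential supremum finite; if it were infinite,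
  \<^const>\<open>Linf_norm\<close> would be 0.\<close>

lemma AE_le_Linf_norm:
  fixes f :: "'a \<Rightarrow> real"
  assumes f: "f \<in> borel_measurable M" and S: "S \<in> sets M" and B: "\<And>z. z \<in> S \<Longrightarrow> \<bar>f z\<bar> \<le> B"
  shows "AE z in M. z \<in> S \<longrightarrow> \<bar>f z\<bar> \<le> Linf_norm M S f"
proof -
  let ?R = "restrict_space M S" and ?g = "\<lambda>z. ennreal \<bar>f z\<bar>"
  have g: "?g \<in> borel_measurable ?R" using f by (intro measurable_restrict_space1) measurable
  have "AE z in ?R. ?g z \<le> ennreal B"
    using S by (intro AE_I2 ennreal_leI B) (auto simp: space_restrict_space)
  then have "esssup ?R ?g \<le> ennreal B" using g by (simp add: esssup_I)
  then have fin: "esssup ?R ?g < top" by (simp add: order_le_less_trans)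
  have "AE z in ?R. ?g z \<le> esssup ?R ?g" by (rule esssup_AE)
  then have "AE z in ?R. \<bar>f z\<bar> \<le> Linf_norm M S f"
  proof eventually_elim
    case (elim z)
    then have "enn2real (?g z) \<le> enn2real (esssup ?R ?g)" using fin by (rule enn2real_mono)
    then show ?case by (simp add: Linf_norm_def)
  qed
  then show ?thesis using S by (subst (asm) AE_restrict_space_iff) auto
qed

section \<open>The bilinear form on one element\<close>

lemma L2_norm_sq: "(L2_norm M S f)\<^sup>2 = (LINT z:S|M. (norm (f z))\<^sup>2)"
  unfolding L2_norm_def set_lebesgue_integral_def by (rule real_sqrt_pow2) (simp add: integral_nonneg)

lemma L2_inner_cong_on:
  assumes "\<And>z. z \<in> S \<Longrightarrow> f z = f' z" "\<And>z. z \<in> S \<Longrightarrow> g z = g' z"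
  shows "L2_inner M S f g = L2_inner M S f' g'"
  unfolding L2_inner_def by (rule set_integral_cong_on) (use assms in simp)

lemma L2_norm_cong_on:
  assumes "\<And>z. z \<in> S \<Longrightarrow> f z = f' z"
  shows "L2_norm M S f = L2_norm M S f'"
  unfolding L2_norm_def by (intro arg_cong[where f = sqrt] set_integral_cong_on) (use assms in simp)

lemma inner_sym_mat: "v \<bullet> sym_mat a b c w =
    a * fst v * fst w + b * (fst v * snd w + snd v * fst w) + c * snd v * snd w"
  by (simp add: sym_mat_def inner_prod_def algebra_simps)

lemma sym_mat_square:
  assumes "a \<noteq> 0"
  shows "v \<bullet> sym_mat a b c v = a * (fst v + b / a * snd v)\<^sup>2 + (c - b\<^sup>2 / a) * (snd v)\<^sup>2"
  using assms by (simp add: inner_sym_mat power2_eq_square field_simps)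

text \<open>Symmetric matrices with \<open>a > 0\<close> and nonnegative determinant are positive semidefinite; \<open>c - b\<^sup>2 / a\<close>
  is the Schur complement.\<close>

locale positive_sym_mat =
  fixes a b c :: real
  assumes a: "0 < a" and det: "b\<^sup>2 \<le> a * c"
begin

lemma schur_nonneg: "0 \<le> c - b\<^sup>2 / a"
  using a det by (simp add: pos_divide_le_eq mult.commute)

lemma nonneg: "0 \<le> v \<bullet> sym_mat a b c v"
  using a schur_nonneg by (simp add: sym_mat_square)

lemma young:
  assumes e: "0 < e"
  shows "\<bar>v \<bullet> sym_mat a b c w\<bar> \<le> e / 2 * (v \<bullet> sym_mat a b c v) + 1 / (2 * e) * (w \<bullet> sym_mat a b c w)"
proof -
  have "0 \<le> (e *\<^sub>R v + k *\<^sub>R w) \<bullet> sym_mat a b c (e *\<^sub>R v + k *\<^sub>R w) / (2 * e)" for k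
    using nonneg e by simp
  also have "(e *\<^sub>R v + k *\<^sub>R w) \<bullet> sym_mat a b c (e *\<^sub>R v + k *\<^sub>R w) / (2 * e)
      = e / 2 * (v \<bullet> sym_mat a b c v) + k * (v \<bullet> sym_mat a b c w) + k\<^sup>2 / (2 * e) * (w \<bullet> sym_mat a b c w)" for k
    using e by (simp add: inner_sym_mat field_simps power2_eq_square)
  finally have "0 \<le> e / 2 * (v \<bullet> sym_mat a b c v) + k * (v \<bullet> sym_mat a b c w) + k\<^sup>2 / (2 * e) * (w \<bullet> sym_mat a b c w)" for k .
  from this[of 1] this[of "-1"] show ?thesis by simp
qed

end

locale triangle =
  fixes T :: "plane set"
  assumes triangle: "open_triangle T"
begin

abbreviation I :: "(plane \<Rightarrow> real) \<Rightarrow> real" where "I f \<equiv> LINT z:T|lebesgue. f z"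
abbreviation J :: "(plane \<Rightarrow> real) \<Rightarrow> real" where "J f \<equiv> LINT z:frontier T|hausdorff1. f z"

lemma sets_T: "T \<in> sets borel"
  using open_triangle_open[OF triangle] by simp

lemma integrable_I:
  fixes f :: "plane \<Rightarrow> real"
  shows "continuous_on UNIV f \<Longrightarrow> set_integrable lebesgue T f"
  by (rule set_integrable_continuous_bounded(2)[OF open_triangle_bounded[OF triangle] sets_T])

lemma I_lincomb:
  assumes "continuous_on UNIV f" "continuous_on UNIV g"
  shows "I (\<lambda>z. a * f z + b * g z) = a * I f + b * I g"
  using integrable_I[OF assms(1)] integrable_I[OF assms(2)] by simp

lemma I_mono:
  assumes "continuous_on UNIV f" "continuous_on UNIV g" "\<And>z. z \<in> T \<Longrightarrow> f z \<le> g z"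
  shows "I f \<le> I g"
  by (rule set_integral_mono) (use integrable_I assms in auto)

lemma I_nonneg: "(\<And>z. 0 \<le> f z) \<Longrightarrow> 0 \<le> I f"
  unfolding set_lebesgue_integral_def by (simp add: integral_nonneg)

lemma sets_frontier: "frontier T \<in> sets borel"
  by (simp add: borel_closed)

lemma bounded_frontier: "bounded (frontier T)"
  using open_triangle_bounded[OF triangle] bounded_subset[OF bounded_closure]
  unfolding frontier_def by blast

lemma integrable_J:
  fixes f :: "plane \<Rightarrow> real"
  assumes "k \<in> borel_measurable borel" "\<And>z. z \<in> frontier T \<Longrightarrow> \<bar>k z\<bar> \<le> B" "continuous_on UNIV f"
  shows "set_integrable hausdorff1 (frontier T) (\<lambda>z. k z * f z)"
proof -
  obtain E where "polygonal_boundary T E" using open_triangle_boundary[OF triangle] by blast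
  then interpret polygonal_boundary T E .
  obtain B' where B': "\<And>z. z \<in> frontier T \<Longrightarrow> \<bar>f z\<bar> \<le> B'"
    using bounded_continuous_bound[OF bounded_frontier assms(3)] by blast
  note [measurable] = assms(1) borel_measurable_continuous_onI[OF assms(3)]
  show ?thesis
  proof (rule set_integrable_frontier)
    show "\<bar>k z * f z\<bar> \<le> B * B'" if "z \<in> frontier T" for z
      unfolding abs_mult using assms(2)[OF that] B'[OF that] by (intro mult_mono) auto
  qed measurable
qed

lemma integrable_J_continuous:
  fixes f :: "plane \<Rightarrow> real"
  shows "continuous_on UNIV f \<Longrightarrow> set_integrable hausdorff1 (frontier T) f"
  using integrable_J[of "\<lambda>z. 1" 1 f] by simp

lemma integrable_J_n1:
  fixes f :: "plane \<Rightarrow> real"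
  shows "continuous_on UNIV f \<Longrightarrow> set_integrable hausdorff1 (frontier T) (\<lambda>z. n1 T z * f z)"
  by (rule integrable_J[of _ 1]) (auto simp: abs_n1_le)

lemma xn2_bounded: obtains B where "\<And>z. z \<in> frontier T \<Longrightarrow> \<bar>xn2 T z\<bar> \<le> B"
proof -
  obtain E where "polygonal_boundary T E" using open_triangle_boundary[OF triangle] by blast
  then obtain B where B: "\<And>z. \<bar>indicator (frontier T) z * xn2 T z\<bar> \<le> B"
    using polygonal_boundary.bounded_xn2_frontier by blast
  have "\<bar>xn2 T z\<bar> \<le> B" if "z \<in> frontier T" for z using B[of z] that by simp
  then show thesis by (rule that)
qed

lemma integrable_J_xn2:
  fixes f :: "plane \<Rightarrow> real"
  shows "continuous_on UNIV f \<Longrightarrow> set_integrable hausdorff1 (frontier T) (\<lambda>z. xn2 T z * f z)"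
  proof -
  assume f: "continuous_on UNIV f"
  obtain B where "\<And>z. z \<in> frontier T \<Longrightarrow> \<bar>xn2 T z\<bar> \<le> B" using xn2_bounded by blast
  then show ?thesis by (intro integrable_J[OF _ _ f]) auto
qed

lemma divergence_x: "f \<in> C1 \<Longrightarrow> I (dx f) = J (\<lambda>z. n1 T z * f z)"
  and divergence_y: "f \<in> C1 \<Longrightarrow> I (dy f) = J (\<lambda>z. snd (outward_normal T z) * f z)"
  using open_triangle_boundary[OF triangle]
  by (auto dest: polygonal_boundary.divergence_theorem_x polygonal_boundary.divergence_theorem_y)

lemma diameter_pos: "0 < diameter T"
proof (rule ccontr)
  assume "\<not> ?thesis"
  moreover have bdd: "bounded T" using open_triangle_bounded[OF triangle] .
  ultimately have "diameter T = 0" using diameter_ge_0[OF bdd] by simp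
  obtain z where z: "z \<in> T" using open_triangle_nonempty[OF triangle] by blast
  obtain e where e: "0 < e" "ball z e \<subseteq> T"
    using open_triangle_open[OF triangle] z by (meson openE)
  obtain t :: real where t: "0 < t" "dist z (z + t *\<^sub>R (1, 0)) < e"
    using small_multiple_in_ball[OF e(1)] by blast
  then have "z + t *\<^sub>R (1, 0) \<in> T" using e(2) by (auto simp: mem_ball)
  with z have "dist z (z + t *\<^sub>R (1, 0)) \<le> diameter T" using diameter_bounded_bound[OF bdd] by blast
  then show False using \<open>diameter T = 0\<close> t(1) by (simp add: prod_eq_iff)
qed

text \<open>The parameter \<open>tau\<close> is small enough for the inverse estimate to absorb the second derivative
  in \<open>L u\<close>.\<close>

lemma stabilization_term_ge:
  assumes u: "u \<in> polys p" and s: "s \<in> polys p" and p: "1 \<le> p" and C: "0 < C"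
    and inv: "\<And>v. v \<in> polys p \<Longrightarrow>
      L2_norm lebesgue T (grad v) \<le> C * (real p)\<^sup>2 / diameter T * L2_norm lebesgue T v"
    and tau: "\<tau> = (diameter T)\<^sup>2 / (4 * C\<^sup>2 * real p ^ 4)"
  shows "L2_inner lebesgue T (\<lambda>z. s z + Lop u z) (\<lambda>z. \<tau> * (s z + fst z * dy u z))
      \<ge> \<tau> / 2 * I (\<lambda>z. (s z + fst z * dy u z)\<^sup>2) - 1/8 * I (\<lambda>z. (dx u z)\<^sup>2)"
proof -
  define r where "r z = s z + fst z * dy u z" for z
  define uxx where "uxx = dx (dx u)"
  have tau0: "0 < \<tau>" using diameter_pos C p by (simp add: tau)
  note polys = u s polys_dx[OF u] polys_dy[OF u] polys_dx[OF polys_dx[OF u]] polys_dy[OF polys_dx[OF u]]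
  have cont: "continuous_on UNIV r" "continuous_on UNIV uxx" "continuous_on UNIV (dx u)" "continuous_on UNIV (dy (dx u))"
    unfolding r_def[abs_def] uxx_def by (intro continuous_intros polys_continuous[OF polys(1)]
        polys_continuous[OF polys(2)] polys_continuous[OF polys(3)] polys_continuous[OF polys(4)]
        polys_continuous[OF polys(5)] polys_continuous[OF polys(6)])+
  have "I (\<lambda>z. (uxx z)\<^sup>2) \<le> I (\<lambda>z. (norm (grad (dx u) z))\<^sup>2)"
  proof (rule I_mono)
    show "continuous_on UNIV (\<lambda>z. (norm (grad (dx u) z))\<^sup>2)"
      unfolding grad_def uxx_def[symmetric] by (intro continuous_intros cont)
    show "(uxx z)\<^sup>2 \<le> (norm (grad (dx u) z))\<^sup>2" for z
      by (simp add: uxx_def grad_def norm_prod_def)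
  qed (intro continuous_intros cont)
  also have "\<dots> = (L2_norm lebesgue T (grad (dx u)))\<^sup>2" by (rule L2_norm_sq[symmetric])
  also have "\<dots> \<le> (C * (real p)\<^sup>2 / diameter T * L2_norm lebesgue T (dx u))\<^sup>2"
    by (rule power_mono[OF inv[OF polys(3)]]) (simp add: L2_norm_def set_lebesgue_integral_def integral_nonneg)
  also have "\<dots> = (C * (real p)\<^sup>2 / diameter T)\<^sup>2 * I (\<lambda>z. (dx u z)\<^sup>2)"
    by (simp only: power_mult_distrib L2_norm_sq) simp
  finally have "\<tau> * I (\<lambda>z. (uxx z)\<^sup>2) \<le> \<tau> * ((C * (real p)\<^sup>2 / diameter T)\<^sup>2 * I (\<lambda>z. (dx u z)\<^sup>2))"
    using tau0 by (intro mult_left_mono) auto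
  also have "\<dots> = 1/4 * I (\<lambda>z. (dx u z)\<^sup>2)"
  proof -
    have "\<tau> * (C * (real p)\<^sup>2 / diameter T)\<^sup>2 = 1/4"
      unfolding tau using diameter_pos C p by (simp add: power_divide power_mult_distrib)
    then show ?thesis by (simp add: mult.assoc[symmetric])
  qed
  finally have uxx: "\<tau> * I (\<lambda>z. (uxx z)\<^sup>2) \<le> 1/4 * I (\<lambda>z. (dx u z)\<^sup>2)" .
  have "\<tau> / 2 * I (\<lambda>z. (r z)\<^sup>2) + - \<tau> / 2 * I (\<lambda>z. (uxx z)\<^sup>2)
      = I (\<lambda>z. \<tau> / 2 * (r z)\<^sup>2 + - \<tau> / 2 * (uxx z)\<^sup>2)"
    by (rule I_lincomb[symmetric]) (intro continuous_intros cont)+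
  also have "\<dots> \<le> I (\<lambda>z. (r z - uxx z) * (\<tau> * r z))"
  proof (rule I_mono)
    fix z
    have "0 \<le> \<tau> / 2 * (r z - uxx z)\<^sup>2" using tau0 by simp
    then show "\<tau> / 2 * (r z)\<^sup>2 + - \<tau> / 2 * (uxx z)\<^sup>2 \<le> (r z - uxx z) * (\<tau> * r z)"
      by (simp add: power2_eq_square algebra_simps)
  qed (intro continuous_intros cont)+
  also have "\<dots> = L2_inner lebesgue T (\<lambda>z. s z + Lop u z) (\<lambda>z. \<tau> * (s z + fst z * dy u z))"
    unfolding L2_inner_def by (rule set_integral_cong_on) (simp add: r_def uxx_def Lop_def)
  finally show ?thesis using uxx by (simp add: r_def)
qed

text \<open>Integration by parts moves one \<open>x\<close>-derivative off \<open>\<nabla>u\<^sub>x\<^sub>x\<close>; the transport part is, up to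
  the commutator of \<open>\<nabla>\<close> with the coefficient \<open>x\<close>, a \<open>y\<close>-derivative of a quadratic form.\<close>

lemma gradient_term_eq:
  assumes u: "u \<in> polys p"
  shows "L2_inner lebesgue T (grad (Lop u)) (\<lambda>z. sym_mat a b c (grad u z)) =
      I (\<lambda>z. grad (dx u) z \<bullet> sym_mat a b c (grad (dx u) z))
    + I (\<lambda>z. dy u z * (a * dx u z + b * dy u z))
    - J (\<lambda>z. n1 T z * (grad (dx u) z \<bullet> sym_mat a b c (grad u z)))
    + 1/2 * J (\<lambda>z. xn2 T z * (grad u z \<bullet> sym_mat a b c (grad u z)))"
proof -
  define ux where "ux = dx u"
  define uy where "uy = dy u"
  define uxx where "uxx = dx ux"
  define uxy where "uxy = dy ux"
  define uyy where "uyy = dy uy"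
  have pu: "ux \<in> polys p" "uy \<in> polys p" "uxx \<in> polys p" "uxy \<in> polys p" "uyy \<in> polys p"
    unfolding ux_def uy_def uxx_def uxy_def uyy_def by (intro polys_dx polys_dy u)+
  have dxuy: "dx uy = uxy" by (simp add: uxy_def uy_def ux_def polys_dx_dy[OF u])
  have dxuxy: "dx uxy = dy uxx" by (simp add: uxy_def uxx_def polys_dx_dy[OF pu(1)])
  note C1 = polys_C1[OF pu(1)] polys_C1[OF pu(2)] polys_C1[OF pu(3)] polys_C1[OF pu(4)] polys_C1[OF pu(5)]
  note rules = C1 C1_fst C1_add C1_mult C1_cmult
  define F where "F z = uxx z * (a * ux z + b * uy z) + uxy z * (b * ux z + c * uy z)" for z
  define G where "G z = 1/2 * (fst z * (a * (ux z * ux z) + (2 * b * (ux z * uy z) + c * (uy z * uy z))))" for z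
  have FG: "F \<in> C1" "G \<in> C1" unfolding F_def[abs_def] G_def[abs_def] by (intro rules)+
  have dxF: "dx F = (\<lambda>z. (dx uxx z * (a * ux z + b * uy z) + uxx z * (a * uxx z + b * uxy z))
      + (dy uxx z * (b * ux z + c * uy z) + uxy z * (b * uxx z + c * uxy z)))"
    unfolding F_def[abs_def]
    by (simp add: dx_add dx_mult dx_cmult rules dxuy dxuxy uxx_def[symmetric])
  have dyG: "dy G = (\<lambda>z. fst z * (uxy z * (a * ux z + b * uy z) + uyy z * (b * ux z + c * uy z)))"
    unfolding G_def[abs_def]
    by (simp only: dy_add dy_mult rules dy_fst dy_const C1_const uxy_def[symmetric] uyy_def[symmetric])
      (simp add: fun_eq_iff algebra_simps)
  have L: "Lop u = (\<lambda>z. (-1) * uxx z + fst z * uy z)"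
    by (simp add: Lop_def fun_eq_iff uxx_def ux_def uy_def)
  have dxL: "dx (Lop u) = (\<lambda>z. - dx uxx z + (uy z + fst z * uxy z))"
    unfolding L by (simp only: dx_add dx_mult dx_const C1_const rules dx_fst dxuy) simp
  have dyL: "dy (Lop u) = (\<lambda>z. - dy uxx z + fst z * uyy z)"
    unfolding L by (simp only: dy_add dy_mult dy_const C1_const rules dy_fst uyy_def[symmetric]) simp
  have cont: "continuous_on UNIV f" if "f \<in> {ux, uy, uxx, uxy, dx F, dy G}" for f
    using that C1_continuous C1 FG by blast
  let ?Q = "\<lambda>z. grad ux z \<bullet> sym_mat a b c (grad ux z)"
  let ?R = "\<lambda>z. uy z * (a * ux z + b * uy z)"
  have contQ: "continuous_on UNIV ?Q"
    unfolding inner_sym_mat grad_def fst_conv snd_conv uxx_def[symmetric] uxy_def[symmetric]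
    by (intro continuous_intros cont) auto
  have contR: "continuous_on UNIV ?R" by (intro continuous_intros cont) auto
  have "L2_inner lebesgue T (grad (Lop u)) (\<lambda>z. sym_mat a b c (grad u z))
      = I (\<lambda>z. 1 * (1 * ?Q z + 1 * ?R z) + 1 * ((-1) * dx F z + 1 * dy G z))"
    unfolding L2_inner_def
    by (rule set_integral_cong_on)
      (simp add: inner_sym_mat grad_def dxL dyL dxF dyG ux_def[symmetric] uy_def[symmetric]
        uxx_def[symmetric] uxy_def[symmetric] algebra_simps)
  also have "\<dots> = 1 * (1 * I ?Q + 1 * I ?R) + 1 * ((-1) * I (dx F) + 1 * I (dy G))"
    by (subst I_lincomb, (intro continuous_intros contQ contR cont; simp)+)
      (subst I_lincomb[OF contQ contR], subst I_lincomb, (intro cont; simp)+, rule refl)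
  also have "I (dx F) = J (\<lambda>z. n1 T z * (grad ux z \<bullet> sym_mat a b c (grad u z)))"
    unfolding divergence_x[OF FG(1)]
    by (simp add: F_def inner_sym_mat grad_def ux_def[symmetric] uy_def[symmetric]
        uxx_def[symmetric] uxy_def[symmetric] algebra_simps)
  also have "I (dy G) = J (\<lambda>z. 1/2 * (xn2 T z * (grad u z \<bullet> sym_mat a b c (grad u z))))"
    unfolding divergence_y[OF FG(2)]
    by (simp add: G_def xn2_def inner_sym_mat grad_def ux_def[symmetric] uy_def[symmetric] algebra_simps)
  also have "\<dots> = 1/2 * J (\<lambda>z. xn2 T z * (grad u z \<bullet> sym_mat a b c (grad u z)))"
    by (rule set_integral_mult_right)
  finally show ?thesis by (simp add: ux_def uy_def)
qed

end

text \<open>The contributions of one element to the bilinear form and to the squared norm. The transport term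
  \<open>(x w\<^sub>y, w)\<close> and the outflow term on the boundary of the domain do not split over the elements and
  are not included.\<close>

definition elem_form ::
    "plane set \<Rightarrow> real \<Rightarrow> (plane \<Rightarrow> plane) \<Rightarrow> (plane \<Rightarrow> real) \<Rightarrow> (plane \<Rightarrow> real) \<Rightarrow> real" where
  "elem_form T t A w wt = (LINT z:T|lebesgue. (dx w z)\<^sup>2)
    + L2_inner lebesgue T (\<lambda>z. wt z + Lop w z) (\<lambda>z. t * (wt z + fst z * dy w z))
    + L2_inner lebesgue T (grad (Lop w)) (\<lambda>z. A (grad w z))"

definition elem_norm_sq ::
    "plane set \<Rightarrow> real \<Rightarrow> real \<Rightarrow> (plane \<Rightarrow> plane) \<Rightarrow> (plane \<Rightarrow> real) \<Rightarrow> (plane \<Rightarrow> real) \<Rightarrow> real" where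
  "elem_norm_sq T k t A w wt = 1/2 * (LINT z:T|lebesgue. (dx w z)\<^sup>2)
    + (L2_norm lebesgue T (\<lambda>z. sqrt k * dy w z))\<^sup>2
    + 1/2 * (L2_norm lebesgue T (\<lambda>z. sqrt t * (wt z + fst z * dy w z)))\<^sup>2
    + (LINT z:T|lebesgue. grad (dx w) z \<bullet> A (grad (dx w) z))
    + (LINT z:elem_bdry_plus T|hausdorff1. xn2 T z * (inner_trace T (grad w) z \<bullet> A (inner_trace T (grad w) z)))"

context triangle
begin

lemma continuous_quadratic:
  assumes "v \<in> polys p" "w \<in> polys p"
  shows "continuous_on UNIV (\<lambda>z. grad v z \<bullet> sym_mat a b c (grad w z))"
  unfolding inner_sym_mat grad_def fst_conv snd_conv
  by (intro continuous_intros polys_continuous[OF polys_dx[OF assms(1)]] polys_continuous[OF polys_dy[OF assms(1)]]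
      polys_continuous[OF polys_dx[OF assms(2)]] polys_continuous[OF polys_dy[OF assms(2)]])

lemma J_lincomb:
  fixes f g :: "plane \<Rightarrow> real"
  assumes "continuous_on UNIV f" "continuous_on UNIV g"
  shows "J (\<lambda>z. k * f z + l * g z) = k * J f + l * J g"
  using integrable_J_continuous[OF assms(1)] integrable_J_continuous[OF assms(2)] by simp

text \<open>After completing the square, the quadratic form is a sum of squares of polynomials.\<close>

lemma trace_quadratic_le:
  assumes A: "positive_sym_mat a b c" and v: "v \<in> polys p"
    and trace: "\<And>q. q \<in> polys p \<Longrightarrow> J (\<lambda>z. (q z)\<^sup>2) \<le> K * I (\<lambda>z. (q z)\<^sup>2)"
  shows "J (\<lambda>z. grad v z \<bullet> sym_mat a b c (grad v z)) \<le> K * I (\<lambda>z. grad v z \<bullet> sym_mat a b c (grad v z))"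
proof -
  interpret positive_sym_mat a b c by (rule A)
  define f where "f z = 1 * dx v z + b / a * dy v z" for z
  define k where "k = c - b\<^sup>2 / a"
  have pf: "f \<in> polys p" "dy v \<in> polys p"
    unfolding f_def[abs_def] by (intro polys_lincomb polys_dx polys_dy v)+
  have cont: "continuous_on UNIV (\<lambda>z. (f z)\<^sup>2)" "continuous_on UNIV (\<lambda>z. (dy v z)\<^sup>2)"
    by (intro continuous_on_power polys_continuous[OF pf(1)] polys_continuous[OF pf(2)])+
  have sq: "(\<lambda>z. grad v z \<bullet> sym_mat a b c (grad v z)) = (\<lambda>z. a * (f z)\<^sup>2 + k * (dy v z)\<^sup>2)"
    using a by (simp add: sym_mat_square grad_def f_def k_def)
  have "a * J (\<lambda>z. (f z)\<^sup>2) + k * J (\<lambda>z. (dy v z)\<^sup>2)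
      \<le> a * (K * I (\<lambda>z. (f z)\<^sup>2)) + k * (K * I (\<lambda>z. (dy v z)\<^sup>2))"
    using a schur_nonneg by (intro add_mono mult_left_mono trace pf) (auto simp: k_def)
  then show ?thesis
    unfolding sq J_lincomb[OF cont] I_lincomb[OF cont] by (simp add: algebra_simps)
qed

text \<open>Young's inequality on the boundary and the trace estimate; the assumption \<open>small\<close> makes the
  product of the two resulting coefficients small enough for them to be \<open>3/4\<close> and \<open>d/2\<close>.\<close>

lemma normal_x_term_le:
  assumes A: "positive_sym_mat a b c" and v: "v \<in> polys p" and w: "w \<in> polys p"
    and trace: "\<And>q. q \<in> polys p \<Longrightarrow> J (\<lambda>z. (q z)\<^sup>2) \<le> K * I (\<lambda>z. (q z)\<^sup>2)"
    and d: "0 < d"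
    and small: "2 * (Linf_norm hausdorff1 (frontier T) (n1 T))\<^sup>2 * K\<^sup>2 / 3 \<le> d"
  shows "J (\<lambda>z. n1 T z * (grad v z \<bullet> sym_mat a b c (grad w z)))
      \<le> 3/4 * I (\<lambda>z. grad v z \<bullet> sym_mat a b c (grad v z))
        + 1/2 * d * I (\<lambda>z. grad w z \<bullet> sym_mat a b c (grad w z))"
proof -
  interpret positive_sym_mat a b c by (rule A)
  let ?N = "Linf_norm hausdorff1 (frontier T) (n1 T)"
  let ?Q = "\<lambda>v z. grad v z \<bullet> sym_mat a b c (grad v z)"
  \<comment> \<open>the weight for which Young's inequality gives the two coefficients\<close>
  define e where "e = sqrt (3 / (2 * d))"
  define m where "m = sqrt (3 * d / 2)"
  have e: "0 < e" using d by (simp add: e_def)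
  have "m * e = sqrt ((3/2)\<^sup>2)"
    using d unfolding m_def e_def by (subst real_sqrt_mult[symmetric]) (simp add: power2_eq_square)
  then have me: "m * e = 3/2" by simp
  have "(m / e) * (m * e) = m\<^sup>2" using e by (simp add: power2_eq_square)
  moreover have "m\<^sup>2 = 3 * d / 2" using d by (simp add: m_def)
  ultimately have "(m / e) * (3/2) = 3 * d / 2" by (simp only: me)
  then have m_e: "m / e = d" by simp
  have N0: "0 \<le> ?N" by (simp add: Linf_norm_def)
  have "(?N * K)\<^sup>2 \<le> m\<^sup>2" using small d by (simp add: m_def power_mult_distrib)
  then have NK: "?N * K \<le> m" by (rule power2_le_imp_le) (use d in \<open>simp add: m_def\<close>)
  have cont: "continuous_on UNIV (?Q v)" "continuous_on UNIV (?Q w)"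
    by (rule continuous_quadratic[OF v v], rule continuous_quadratic[OF w w])
  have "AE z in hausdorff1. z \<in> frontier T \<longrightarrow> \<bar>n1 T z\<bar> \<le> ?N"
    by (rule AE_le_Linf_norm[where B = 1])
      (auto simp: abs_n1_le measurable_cong_sets[OF sets_hausdorff1 refl])
  then have "AE z in hausdorff1. z \<in> frontier T \<longrightarrow>
      n1 T z * (grad v z \<bullet> sym_mat a b c (grad w z)) \<le> ?N * (e / 2 * ?Q v z + 1 / (2 * e) * ?Q w z)"
  proof eventually_elim
    case (elim z)
    show ?case
    proof
      assume "z \<in> frontier T"
      then have "\<bar>n1 T z * (grad v z \<bullet> sym_mat a b c (grad w z))\<bar> \<le> ?N * (e / 2 * ?Q v z + 1 / (2 * e) * ?Q w z)"
        unfolding abs_mult using elim young[OF e] N0 by (intro mult_mono) auto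
      then show "n1 T z * (grad v z \<bullet> sym_mat a b c (grad w z)) \<le> ?N * (e / 2 * ?Q v z + 1 / (2 * e) * ?Q w z)"
        by linarith
    qed
  qed
  then have "J (\<lambda>z. n1 T z * (grad v z \<bullet> sym_mat a b c (grad w z)))
      \<le> J (\<lambda>z. ?N * (e / 2 * ?Q v z + 1 / (2 * e) * ?Q w z))"
    by (intro set_integral_mono_AE integrable_J_n1 integrable_J_continuous continuous_quadratic[OF v w])
      (use e in \<open>auto intro!: continuous_intros cont\<close>)
  also have "\<dots> = J (\<lambda>z. (?N * (e / 2)) * ?Q v z + (?N * (1 / (2 * e))) * ?Q w z)"
    by (simp add: algebra_simps)
  also have "\<dots> = ?N * (e / 2) * J (?Q v) + ?N * (1 / (2 * e)) * J (?Q w)"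
    by (rule J_lincomb[OF cont])
  also have "\<dots> \<le> ?N * (e / 2) * (K * I (?Q v)) + ?N * (1 / (2 * e)) * (K * I (?Q w))"
    using N0 e by (intro add_mono mult_left_mono trace_quadratic_le[OF A v trace]
        trace_quadratic_le[OF A w trace]) auto
  also have "\<dots> = (?N * K) * (e / 2 * I (?Q v) + 1 / (2 * e) * I (?Q w))" by (simp add: algebra_simps)
  also have "\<dots> \<le> m * (e / 2 * I (?Q v) + 1 / (2 * e) * I (?Q w))"
    using NK e by (intro mult_right_mono add_nonneg_nonneg mult_nonneg_nonneg I_nonneg nonneg) auto
  also have "\<dots> = (m * e) / 2 * I (?Q v) + (m / e) / 2 * I (?Q w)" by (simp add: algebra_simps)
  also have "\<dots> = 3/4 * I (?Q v) + 1/2 * d * I (?Q w)" by (simp add: me m_e)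
  finally show ?thesis .
qed

text \<open>Only the inflow part of the boundary contributes negatively, and there the trace estimate applies.\<close>

lemma transport_boundary_term_ge:
  assumes A: "positive_sym_mat a b c" and w: "w \<in> polys p"
    and trace: "\<And>q. q \<in> polys p \<Longrightarrow> J (\<lambda>z. (q z)\<^sup>2) \<le> K * I (\<lambda>z. (q z)\<^sup>2)"
    and small: "K * Linf_norm hausdorff1 (elem_bdry_minus T) (xn2 T) \<le> d"
  shows "(LINT z:elem_bdry_plus T|hausdorff1. xn2 T z * (grad w z \<bullet> sym_mat a b c (grad w z)))
        - d * I (\<lambda>z. grad w z \<bullet> sym_mat a b c (grad w z))
      \<le> J (\<lambda>z. xn2 T z * (grad w z \<bullet> sym_mat a b c (grad w z)))" (is "?P - _ \<le> _")
proof -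
  interpret positive_sym_mat a b c by (rule A)
  let ?M = "Linf_norm hausdorff1 (elem_bdry_minus T) (xn2 T)"
  let ?Q = "\<lambda>z. grad w z \<bullet> sym_mat a b c (grad w z)"
  have M0: "0 \<le> ?M" by (simp add: Linf_norm_def)
  have cont: "continuous_on UNIV ?Q" by (rule continuous_quadratic[OF w w])
  note [measurable] = sets_frontier
  have "{z \<in> space borel. z \<in> frontier T \<and> xn2 T z < 0} \<in> sets borel"
    "{z \<in> space borel. z \<in> frontier T \<and> 0 \<le> xn2 T z} \<in> sets borel" by measurable
  then have sets: "elem_bdry_minus T \<in> sets borel" "elem_bdry_plus T \<in> sets borel"
    by (simp_all add: elem_bdry_minus_def elem_bdry_plus_def)
  have sub: "elem_bdry_minus T \<subseteq> frontier T" "elem_bdry_plus T \<subseteq> frontier T"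
    by (auto simp: elem_bdry_minus_def elem_bdry_plus_def)
  have int_x: "set_integrable hausdorff1 S (\<lambda>z. xn2 T z * ?Q z)"
    and int_c: "set_integrable hausdorff1 S (\<lambda>z. k * ?Q z)"
    if "S \<in> {elem_bdry_minus T, elem_bdry_plus T}" for S k
    using that sets sub
    by (auto intro!: set_integrable_subset[OF integrable_J_xn2[OF cont]]
        set_integrable_subset[OF integrable_J_continuous] continuous_intros cont)
  have split: "J (\<lambda>z. xn2 T z * ?Q z) = ?P + (LINT z:elem_bdry_minus T|hausdorff1. xn2 T z * ?Q z)"
  proof -
    have "frontier T = elem_bdry_plus T \<union> elem_bdry_minus T"
      by (auto simp: elem_bdry_minus_def elem_bdry_plus_def)
    then have "J (\<lambda>z. xn2 T z * ?Q z) = (LINT z:elem_bdry_plus T \<union> elem_bdry_minus T|hausdorff1. xn2 T z * ?Q z)"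
      by (simp only:)
    also have "\<dots> = ?P + (LINT z:elem_bdry_minus T|hausdorff1. xn2 T z * ?Q z)"
      by (rule set_integral_Un) (auto simp: elem_bdry_minus_def elem_bdry_plus_def intro!: int_x)
    finally show ?thesis .
  qed
  obtain B where "\<And>z. z \<in> frontier T \<Longrightarrow> \<bar>xn2 T z\<bar> \<le> B" using xn2_bounded by blast
  then have "AE z in hausdorff1. z \<in> elem_bdry_minus T \<longrightarrow> \<bar>xn2 T z\<bar> \<le> ?M"
    using sets sub by (intro AE_le_Linf_norm[where B = B]) (auto simp: measurable_cong_sets[OF sets_hausdorff1 refl])
  then have "AE z in hausdorff1. z \<in> elem_bdry_minus T \<longrightarrow> - ?M * ?Q z \<le> xn2 T z * ?Q z"
  proof eventually_elim
    case (elim z)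
    show ?case
    proof
      assume "z \<in> elem_bdry_minus T"
      then have "- ?M \<le> xn2 T z" using elim by linarith
      then show "- ?M * ?Q z \<le> xn2 T z * ?Q z" using nonneg by (intro mult_right_mono)
    qed
  qed
  then have "(LINT z:elem_bdry_minus T|hausdorff1. - ?M * ?Q z) \<le> (LINT z:elem_bdry_minus T|hausdorff1. xn2 T z * ?Q z)"
    by (intro set_integral_mono_AE int_x int_c) auto
  moreover have "(LINT z:elem_bdry_minus T|hausdorff1. - ?M * ?Q z) = - ?M * (LINT z:elem_bdry_minus T|hausdorff1. ?Q z)"
    by (rule set_integral_mult_right)
  moreover have "?M * (LINT z:elem_bdry_minus T|hausdorff1. ?Q z) \<le> ?M * J ?Q"
  proof (rule mult_left_mono[OF _ M0])
    show "(LINT z:elem_bdry_minus T|hausdorff1. ?Q z) \<le> J ?Q"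
      using integrable_J_continuous[OF cont] int_c[of "elem_bdry_minus T" 1] sub nonneg
      unfolding set_lebesgue_integral_def set_integrable_def
      by (intro integral_mono) (auto simp: indicator_def)
  qed
  moreover have "?M * J ?Q \<le> ?M * (K * I ?Q)"
    by (intro mult_left_mono trace_quadratic_le[OF A w trace] M0)
  moreover have "?M * (K * I ?Q) \<le> d * I ?Q"
    using small I_nonneg[of ?Q] nonneg by (simp only: mult.assoc[symmetric] mult.commute[of ?M]) (intro mult_right_mono, auto)
  ultimately show ?thesis using split by linarith
qed

text \<open>With \<open>Y = v\<^sub>2 / d\<close> the difference of the two sides is
  \<open>5/8 v\<^sub>1\<^sup>2 + 1/24 v\<^sub>1 Y + 17/768 Y\<^sup>2\<close>.\<close>

lemma pointwise_coercivity:
  assumes d: "0 < (d::real)"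
  shows "1/8 * (fst v)\<^sup>2 + 1/4 * (1 / (64 * d ^ 3) * d * (snd v)\<^sup>2)
    \<le> 7/8 * (fst v)\<^sup>2 + snd v * (1 / (8 * d) * fst v + 1 / (24 * d\<^sup>2) * snd v)
      - d * (v \<bullet> sym_mat (1 / (8 * d)) (1 / (24 * d\<^sup>2)) (1 / (64 * d ^ 3)) v)"
proof -
  define X where "X = fst v"
  define Y where "Y = snd v / d"
  have Y: "snd v = d * Y" using d by (simp add: Y_def)
  have "0 \<le> 5/8 * (X + Y / 30)\<^sup>2 + (17/768 - 1/1440) * Y\<^sup>2" by simp
  also have "\<dots> = 5/8 * X\<^sup>2 + 1/24 * (X * Y) + 17/768 * Y\<^sup>2"
    by (simp add: power2_eq_square algebra_simps)
  finally have main: "1/8 * X\<^sup>2 + 1/4 * (1/64 * Y\<^sup>2) \<le> 7/8 * X\<^sup>2 + (1/8 * X * Y + 1/24 * Y\<^sup>2)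
      - (1/8 * X\<^sup>2 + 1/12 * (X * Y) + 1/64 * Y\<^sup>2)" by simp
  have 1: "1 / (64 * d ^ 3) * d * (snd v)\<^sup>2 = 1/64 * Y\<^sup>2"
    using d by (simp add: Y field_simps power2_eq_square power3_eq_cube)
  have 2: "snd v * (1 / (8 * d) * fst v + 1 / (24 * d\<^sup>2) * snd v) = 1/8 * X * Y + 1/24 * Y\<^sup>2"
    using d by (simp add: Y X_def field_simps power2_eq_square)
  have 3: "d * (v \<bullet> sym_mat (1 / (8 * d)) (1 / (24 * d\<^sup>2)) (1 / (64 * d ^ 3)) v)
      = 1/8 * X\<^sup>2 + 1/12 * (X * Y) + 1/64 * Y\<^sup>2"
    using d by (simp add: inner_sym_mat Y X_def field_simps power2_eq_square power3_eq_cube)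
  show ?thesis unfolding 1 2 3 using main by (simp only: X_def)
qed

text \<open>The three parts of the form are bounded from below separately and added. The two boundary bounds
  consume \<open>\<delta> \<parallel>\<surd>A \<nabla>w\<parallel>\<^sup>2\<close> and \<open>3/4\<close> of \<open>\<parallel>\<surd>A \<nabla>w\<^sub>x\<parallel>\<^sup>2\<close>, which leaves the
  coefficient \<open>1/4\<close> of the claim. If \<open>\<delta> = 0\<close> then \<open>A = 0\<close>, because division by 0 gives 0, and only
  the stabilization term matters.\<close>

lemma element_coercivity:
  assumes w: "\<exists>q\<in>polys p. \<forall>z\<in>T. w z = q z" and wt: "\<exists>q\<in>polys p. \<forall>z\<in>T. wt z = q z" and p: "1 \<le> p"
    and C_INV: "0 < C_INV" "\<And>v. v \<in> polys p \<Longrightarrow>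
      L2_norm lebesgue T (grad v) \<le> C_INV * (real p)\<^sup>2 / diameter T * L2_norm lebesgue T v"
    and C_inv: "\<And>v. v \<in> polys p \<Longrightarrow>
      L2_norm hausdorff1 (frontier T) v \<le> C_inv * real p / sqrt (diameter T) * L2_norm lebesgue T v"
    and delta: "\<delta> =
        max (C_inv\<^sup>2 * (real p)\<^sup>2 * Linf_norm hausdorff1 (elem_bdry_minus T) (xn2 T) / diameter T)
            (2 * (Linf_norm hausdorff1 (frontier T) (n1 T))\<^sup>2 * C_inv ^ 4 * real p ^ 4
               / (3 * (diameter T)\<^sup>2))"
    and tau: "\<tau> = (diameter T)\<^sup>2 / (4 * C_INV\<^sup>2 * real p ^ 4)"
    and alpha: "\<alpha> = 1 / (8 * \<delta>)" and beta: "\<beta> = 1 / (24 * \<delta>\<^sup>2)" and gamma: "\<gamma> = 1 / (64 * \<delta> ^ 3)"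
  shows "1/4 * elem_norm_sq T (\<gamma> * \<delta>) \<tau> (sym_mat \<alpha> \<beta> \<gamma>) w wt \<le> elem_form T \<tau> (sym_mat \<alpha> \<beta> \<gamma>) w wt"
proof -
  let ?A = "sym_mat \<alpha> \<beta> \<gamma>"
  have oT: "open T" by (rule open_triangle_open[OF triangle])
  obtain u where u: "u \<in> polys p" and wu: "\<And>z. z \<in> T \<Longrightarrow> w z = u z" using w by blast
  obtain s where s: "s \<in> polys p" and wts: "\<And>z. z \<in> T \<Longrightarrow> wt z = s z" using wt by blast
  have dxw: "dx w z = dx u z" if "z \<in> T" for z by (rule dx_cong_open[OF oT that wu])
  have dyw: "dy w z = dy u z" if "z \<in> T" for z by (rule dy_cong_open[OF oT that wu])
  have gradw: "grad w z = grad u z" if "z \<in> T" for z by (rule grad_cong_open[OF oT wu that])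
  have graddxw: "grad (dx w) z = grad (dx u) z" if "z \<in> T" for z by (rule grad_cong_open[OF oT dxw that])
  have Lw: "Lop w z = Lop u z" if "z \<in> T" for z by (rule Lop_cong_open[OF oT wu that])
  have gradLw: "grad (Lop w) z = grad (Lop u) z" if "z \<in> T" for z by (rule grad_cong_open[OF oT Lw that])
  have "continuous_on UNIV (grad u)" using polys_C1[OF u] by (simp add: C1_def)
  then have tr: "inner_trace T (grad w) z = grad u z" if "z \<in> elem_bdry_plus T" for z
    using that gradw oT by (intro inner_trace_eq) (auto simp: elem_bdry_plus_def frontier_def interior_open)
  define K where "K = C_inv\<^sup>2 * (real p)\<^sup>2 / diameter T"
  define N where "N = Linf_norm hausdorff1 (frontier T) (n1 T)"
  define M where "M = Linf_norm hausdorff1 (elem_bdry_minus T) (xn2 T)"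
  have K0: "0 \<le> K" using diameter_pos by (simp add: K_def)
  have M0: "0 \<le> M" by (simp add: M_def Linf_norm_def)
  have d: "\<delta> = max (K * M) (2 * N\<^sup>2 * K\<^sup>2 / 3)"
    unfolding delta K_def M_def[symmetric] N_def[symmetric]
    by (simp add: power_divide power_mult_distrib mult_ac)
  have d0: "0 \<le> \<delta>" using K0 M0 unfolding d by (simp add: le_max_iff_disj)
  have tau0: "0 \<le> \<tau>" unfolding tau by simp
  have trace: "J (\<lambda>z. (q z)\<^sup>2) \<le> K * I (\<lambda>z. (q z)\<^sup>2)" if "q \<in> polys p" for q
  proof -
    have "(L2_norm hausdorff1 (frontier T) q)\<^sup>2 \<le> (C_inv * real p / sqrt (diameter T) * L2_norm lebesgue T q)\<^sup>2"
      by (rule power_mono[OF C_inv[OF that]]) (simp add: L2_norm_def set_lebesgue_integral_def integral_nonneg)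
    also have "\<dots> = K * (L2_norm lebesgue T q)\<^sup>2"
      using diameter_pos by (simp add: K_def power_mult_distrib power_divide)
    finally show ?thesis by (simp add: L2_norm_sq)
  qed
  define X where "X = I (\<lambda>z. (dx u z)\<^sup>2)"
  define Y where "Y = I (\<lambda>z. (dy u z)\<^sup>2)"
  define R where "R = I (\<lambda>z. (s z + fst z * dy u z)\<^sup>2)"
  have X0: "0 \<le> X" and R0: "0 \<le> R" unfolding X_def R_def by (intro I_nonneg; simp)+
  have stab: "L2_inner lebesgue T (\<lambda>z. s z + Lop u z) (\<lambda>z. \<tau> * (s z + fst z * dy u z)) \<ge> 1/2 * (\<tau> * R) - 1/8 * X"
    using stabilization_term_ge[OF u s p C_INV tau] by (simp add: X_def R_def)
  have normR: "(L2_norm lebesgue T (\<lambda>z. sqrt \<tau> * (s z + fst z * dy u z)))\<^sup>2 = \<tau> * R"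
    unfolding L2_norm_sq R_def using tau0 by (simp add: power_mult_distrib)
  have normY: "(L2_norm lebesgue T (\<lambda>z. sqrt (\<gamma> * \<delta>) * dy u z))\<^sup>2 = \<gamma> * \<delta> * Y"
    unfolding L2_norm_sq Y_def using d0 by (simp add: gamma power_mult_distrib)
  have form: "elem_form T \<tau> ?A w wt = X
      + L2_inner lebesgue T (\<lambda>z. s z + Lop u z) (\<lambda>z. \<tau> * (s z + fst z * dy u z))
      + L2_inner lebesgue T (grad (Lop u)) (\<lambda>z. ?A (grad u z))"
    unfolding elem_form_def X_def
    by (intro arg_cong2[where f = "(+)"] set_integral_cong_on L2_inner_cong_on)
      (simp_all add: dxw dyw gradw Lw gradLw wts)
  have norm: "elem_norm_sq T (\<gamma> * \<delta>) \<tau> ?A w wt = 1/2 * X + \<gamma> * \<delta> * Y + 1/2 * (\<tau> * R)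
      + I (\<lambda>z. grad (dx u) z \<bullet> ?A (grad (dx u) z))
      + (LINT z:elem_bdry_plus T|hausdorff1. xn2 T z * (grad u z \<bullet> ?A (grad u z)))"
    unfolding elem_norm_sq_def normY[symmetric] normR[symmetric] X_def
    by (intro arg_cong2[where f = "(+)"] arg_cong2[where f = "(*)"] arg_cong2[where f = "(^)"] refl
        set_integral_cong_on L2_norm_cong_on)
      (simp_all add: dxw dyw graddxw tr wts)
  show ?thesis
  proof (cases "\<delta> = 0")
    case True
    then have "\<alpha> = 0" "\<beta> = 0" "\<gamma> = 0" by (simp_all add: alpha beta gamma)
    then have "sym_mat \<alpha> \<beta> \<gamma> = (\<lambda>v. 0)" by (simp add: sym_mat_def fun_eq_iff zero_prod_def)
    then have zero: "I (\<lambda>z. grad (dx u) z \<bullet> sym_mat \<alpha> \<beta> \<gamma> (grad (dx u) z)) = 0"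
      "(LINT z:elem_bdry_plus T|hausdorff1. xn2 T z * (grad u z \<bullet> sym_mat \<alpha> \<beta> \<gamma> (grad u z))) = 0"
      "L2_inner lebesgue T (grad (Lop u)) (\<lambda>z. sym_mat \<alpha> \<beta> \<gamma> (grad u z)) = 0" "\<gamma> * \<delta> * Y = 0"
      using True by (simp_all add: set_lebesgue_integral_def L2_inner_def)
    have "1/4 * (1/2 * X + 0 + 1/2 * t + 0 + 0) \<le> X + S + 0" if "1/2 * t - 1/8 * X \<le> S" "0 \<le> t" for t S
      using that X0 by (simp add: field_simps)
    from this[OF stab mult_nonneg_nonneg[OF tau0 R0]] show ?thesis
      unfolding form norm zero .
  next
    case False
    with d0 have dpos: "0 < \<delta>" by simp
    have A: "positive_sym_mat \<alpha> \<beta> \<gamma>"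
    proof
      show "0 < \<alpha>" using dpos by (simp add: alpha)
      show "\<beta>\<^sup>2 \<le> \<alpha> * \<gamma>"
        using dpos by (simp add: alpha beta gamma power2_eq_square field_simps power3_eq_cube)
    qed
    let ?q = "\<lambda>z. grad u z \<bullet> sym_mat \<alpha> \<beta> \<gamma> (grad u z)"
    let ?r = "\<lambda>z. dy u z * (\<alpha> * dx u z + \<beta> * dy u z)"
    define Qx where "Qx = I (\<lambda>z. grad (dx u) z \<bullet> sym_mat \<alpha> \<beta> \<gamma> (grad (dx u) z))"
    define Q where "Q = I ?q"
    define P where "P = (LINT z:elem_bdry_plus T|hausdorff1. xn2 T z * ?q z)"
    have P0: "0 \<le> P"
      unfolding P_def set_lebesgue_integral_def
      by (rule Bochner_Integration.integral_nonneg) (auto simp: indicator_def elem_bdry_plus_def positive_sym_mat.nonneg[OF A])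
    have n1_le: "J (\<lambda>z. n1 T z * (grad (dx u) z \<bullet> sym_mat \<alpha> \<beta> \<gamma> (grad u z))) \<le> 3/4 * Qx + 1/2 * \<delta> * Q"
      unfolding Qx_def Q_def
      by (rule normal_x_term_le[OF A polys_dx[OF u] u trace dpos]) (simp_all add: d N_def)
    have xn2_ge: "P - \<delta> * Q \<le> J (\<lambda>z. xn2 T z * ?q z)"
      unfolding P_def Q_def
      by (rule transport_boundary_term_ge[OF A u trace]) (simp_all add: d M_def)
    have cont: "continuous_on UNIV (\<lambda>z. (dx u z)\<^sup>2)" "continuous_on UNIV (\<lambda>z. (dy u z)\<^sup>2)"
        "continuous_on UNIV ?q" "continuous_on UNIV ?r"
      by (intro continuous_intros continuous_quadratic[OF u u] polys_continuous[OF polys_dx[OF u]]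
          polys_continuous[OF polys_dy[OF u]])+
    have "1/8 * X + 1/4 * (\<gamma> * \<delta>) * Y = I (\<lambda>z. 1/8 * (dx u z)\<^sup>2 + 1/4 * (\<gamma> * \<delta>) * (dy u z)\<^sup>2)"
      unfolding X_def Y_def by (rule I_lincomb[OF cont(1,2), symmetric])
    also have "\<dots> \<le> I (\<lambda>z. 7/8 * (dx u z)\<^sup>2 + 1 * (1 * ?r z + (- \<delta>) * ?q z))"
    proof (rule I_mono)
      show "1/8 * (dx u z)\<^sup>2 + 1/4 * (\<gamma> * \<delta>) * (dy u z)\<^sup>2 \<le> 7/8 * (dx u z)\<^sup>2 + 1 * (1 * ?r z + (- \<delta>) * ?q z)" for z
        using pointwise_coercivity[OF dpos, of "grad u z"]
        by (simp add: alpha beta gamma) (simp add: grad_def)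
    qed (intro continuous_intros cont)+
    also have "\<dots> = 7/8 * X + 1 * I (\<lambda>z. 1 * ?r z + (- \<delta>) * ?q z)"
      unfolding X_def by (rule I_lincomb[OF cont(1)]) (intro continuous_intros cont)
    also have "I (\<lambda>z. 1 * ?r z + (- \<delta>) * ?q z) = 1 * I ?r + (- \<delta>) * Q"
      unfolding Q_def by (rule I_lincomb[OF cont(4,3)])
    finally have point: "1/8 * X + 1/4 * (\<gamma> * \<delta>) * Y \<le> 7/8 * X + I ?r - \<delta> * Q" by simp
    have "1/4 * (1/2 * X + \<gamma> * \<delta> * Y + 1/2 * (\<tau> * R) + Qx + P)
        \<le> X + (1/2 * (\<tau> * R) - 1/8 * X) + (Qx + I ?r - (3/4 * Qx + 1/2 * \<delta> * Q) + 1/2 * (P - \<delta> * Q))"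
      using point P0 mult_nonneg_nonneg[OF tau0 R0] by (simp add: field_simps)
    also have "\<dots> \<le> X + L2_inner lebesgue T (\<lambda>z. s z + Lop u z) (\<lambda>z. \<tau> * (s z + fst z * dy u z))
      + L2_inner lebesgue T (grad (Lop u)) (\<lambda>z. sym_mat \<alpha> \<beta> \<gamma> (grad u z))"
      unfolding gradient_term_eq[OF u] Qx_def[symmetric]
      by (intro add_mono order_refl stab diff_mono n1_le mult_left_mono xn2_ge) simp
    finally show ?thesis unfolding form norm Qx_def[symmetric] P_def[symmetric] .
  qed
qed

end

section \<open>Limits of products in the mean square\<close>

lemma integrable_mult_square_integrable:
  fixes f g :: "'a \<Rightarrow> real"
  assumes [measurable]: "f \<in> borel_measurable M" "g \<in> borel_measurable M" "m \<in> borel_measurable M"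
    and m: "\<And>z. \<bar>m z\<bar> \<le> B"
    and f: "integrable M (\<lambda>z. (f z)\<^sup>2)" and g: "integrable M (\<lambda>z. (g z)\<^sup>2)"
  shows "integrable M (\<lambda>z. m z * f z * g z)"
proof (rule Bochner_Integration.integrable_bound)
  show "integrable M (\<lambda>z. B * ((f z)\<^sup>2 + (g z)\<^sup>2))" using f g by simp
  show "AE z in M. norm (m z * f z * g z) \<le> norm (B * ((f z)\<^sup>2 + (g z)\<^sup>2))"
  proof (rule AE_I2)
    fix z
    have B: "0 \<le> B" using m[of z] by linarith
    have "0 \<le> (\<bar>f z\<bar> - \<bar>g z\<bar>)\<^sup>2" by simp
    then have "2 * (\<bar>f z\<bar> * \<bar>g z\<bar>) \<le> (f z)\<^sup>2 + (g z)\<^sup>2"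
      by (simp add: power2_eq_square algebra_simps abs_mult_self_eq)
    then have "\<bar>f z\<bar> * \<bar>g z\<bar> \<le> (f z)\<^sup>2 + (g z)\<^sup>2"
      using mult_nonneg_nonneg[of "\<bar>f z\<bar>" "\<bar>g z\<bar>"] by linarith
    then have "\<bar>m z\<bar> * (\<bar>f z\<bar> * \<bar>g z\<bar>) \<le> B * ((f z)\<^sup>2 + (g z)\<^sup>2)"
      using m B by (intro mult_mono) auto
    then show "norm (m z * f z * g z) \<le> norm (B * ((f z)\<^sup>2 + (g z)\<^sup>2))"
      using B by (simp add: abs_mult mult.assoc)
  qed
qed measurable

lemma abs_integral_mult_le:
  fixes f g :: "'a \<Rightarrow> real"
  assumes meas [measurable]: "f \<in> borel_measurable M" "g \<in> borel_measurable M" "m \<in> borel_measurable M"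
    and m: "\<And>z. \<bar>m z\<bar> \<le> B" and t: "0 < t"
    and f: "integrable M (\<lambda>z. (f z)\<^sup>2)" and g: "integrable M (\<lambda>z. (g z)\<^sup>2)"
  shows "\<bar>\<integral>z. m z * f z * g z \<partial>M\<bar> \<le> B * (t * (\<integral>z. (f z)\<^sup>2 \<partial>M) + (\<integral>z. (g z)\<^sup>2 \<partial>M) / t)"
proof -
  have int: "integrable M (\<lambda>z. m z * f z * g z)"
    by (rule integrable_mult_square_integrable[OF meas m f g])
  have "\<bar>\<integral>z. m z * f z * g z \<partial>M\<bar> \<le> (\<integral>z. \<bar>m z * f z * g z\<bar> \<partial>M)"
    by (rule integral_abs_bound)
  also have "\<dots> \<le> (\<integral>z. B * (t * (f z)\<^sup>2 + (g z)\<^sup>2 / t) \<partial>M)"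
  proof (rule integral_mono)
    fix z
    have B: "0 \<le> B" using m[of z] by linarith
    have "0 \<le> (t * \<bar>f z\<bar> - \<bar>g z\<bar>)\<^sup>2 / t" using t by simp
    also have "(t * \<bar>f z\<bar> - \<bar>g z\<bar>)\<^sup>2 / t = t * (f z)\<^sup>2 + (g z)\<^sup>2 / t - 2 * (\<bar>f z\<bar> * \<bar>g z\<bar>)"
      using t by (simp add: power2_eq_square field_simps)
    finally have "\<bar>f z\<bar> * \<bar>g z\<bar> \<le> t * (f z)\<^sup>2 + (g z)\<^sup>2 / t"
      using mult_nonneg_nonneg[of "\<bar>f z\<bar>" "\<bar>g z\<bar>"] by linarith
    then have "\<bar>m z\<bar> * (\<bar>f z\<bar> * \<bar>g z\<bar>) \<le> B * (t * (f z)\<^sup>2 + (g z)\<^sup>2 / t)"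
      using m B by (intro mult_mono) auto
    then show "\<bar>m z * f z * g z\<bar> \<le> B * (t * (f z)\<^sup>2 + (g z)\<^sup>2 / t)"
      by (simp add: abs_mult mult.assoc)
  qed (use int f g in auto)
  also have "\<dots> = B * (t * (\<integral>z. (f z)\<^sup>2 \<partial>M) + (\<integral>z. (g z)\<^sup>2 \<partial>M) / t)"
    using f g by simp
  finally show ?thesis .
qed

text \<open>Young's inequality with a large weight on the factor that tends to zero.\<close>

lemma integral_mult_null_seq:
  fixes f g :: "nat \<Rightarrow> 'a \<Rightarrow> real"
  assumes meas: "\<And>k. f k \<in> borel_measurable M" "\<And>k. g k \<in> borel_measurable M" "m \<in> borel_measurable M"
    and m: "\<And>z. \<bar>m z\<bar> \<le> B"
    and f: "\<And>k. integrable M (\<lambda>z. (f k z)\<^sup>2)" and g: "\<And>k. integrable M (\<lambda>z. (g k z)\<^sup>2)"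
    and f0: "(\<lambda>k. \<integral>z. (f k z)\<^sup>2 \<partial>M) \<longlonglongrightarrow> 0" and gC: "\<And>k. (\<integral>z. (g k z)\<^sup>2 \<partial>M) \<le> C"
  shows "(\<lambda>k. \<integral>z. m z * f k z * g k z \<partial>M) \<longlonglongrightarrow> 0"
proof (rule LIMSEQ_I)
  fix e :: real assume e: "0 < e"
  have B0: "0 \<le> B" using m[of undefined] by linarith
  have "0 \<le> (\<integral>z. (g 0 z)\<^sup>2 \<partial>M)" by (rule Bochner_Integration.integral_nonneg) simp
  then have C0: "0 \<le> C" using gC[of 0] by linarith
  \<comment> \<open>large enough for the contribution of \<open>g k\<close> to stay below \<open>e / 2\<close>\<close>
  define t where "t = (2 * B * C + 1) / e"
  have t: "0 < t" using e B0 C0 by (simp add: t_def add_nonneg_pos)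
  have BCt: "B * C / t < e / 2"
    using e B0 C0 t by (simp add: t_def field_simps add_nonneg_pos)
  have "0 < e / (2 * (B * t + 1))" using e B0 t by (simp add: add_nonneg_pos)
  then have "\<forall>\<^sub>F k in sequentially. (\<integral>z. (f k z)\<^sup>2 \<partial>M) < e / (2 * (B * t + 1))"
    by (rule order_tendstoD(2)[OF f0])
  then obtain N where N: "\<And>k. N \<le> k \<Longrightarrow> (\<integral>z. (f k z)\<^sup>2 \<partial>M) < e / (2 * (B * t + 1))"
    by (auto simp: eventually_sequentially)
  have "norm ((\<integral>z. m z * f k z * g k z \<partial>M) - 0) < e" if "N \<le> k" for k
  proof -
    have "\<bar>\<integral>z. m z * f k z * g k z \<partial>M\<bar> \<le> B * (t * (\<integral>z. (f k z)\<^sup>2 \<partial>M) + (\<integral>z. (g k z)\<^sup>2 \<partial>M) / t)"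
      by (rule abs_integral_mult_le[OF meas m t f g])
    also have "\<dots> \<le> B * (t * (e / (2 * (B * t + 1))) + C / t)"
      using N[OF that] gC[of k] t B0 by (intro mult_left_mono add_mono divide_right_mono) auto
    also have "\<dots> = (B * t / (B * t + 1)) * (e / 2) + B * C / t"
      by (simp add: field_simps)
    also have "\<dots> < 1 * (e / 2) + e / 2"
    proof (rule add_le_less_mono[OF _ BCt])
      have "B * t / (B * t + 1) \<le> 1" using B0 t by (simp add: divide_le_eq_1 add_nonneg_pos)
      then show "B * t / (B * t + 1) * (e / 2) \<le> 1 * (e / 2)" using e by (intro mult_right_mono) auto
    qed
    finally show ?thesis by simp
  qed
  then show "\<exists>N. \<forall>k\<ge>N. norm ((\<integral>z. m z * f k z * g k z \<partial>M) - 0) < e" by blast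
qed

text \<open>The product rule \<open>f\<^sub>k g\<^sub>k - f\<^sub>0 g\<^sub>0 = F G + F g\<^sub>0 + G f\<^sub>0\<close> for the
  differences \<open>F\<close> and \<open>G\<close>.\<close>

lemma integral_mult_tendsto:
  fixes f g :: "nat \<Rightarrow> 'a \<Rightarrow> real"
  assumes meas: "\<And>k. f k \<in> borel_measurable M" "\<And>k. g k \<in> borel_measurable M"
      "f0 \<in> borel_measurable M" "g0 \<in> borel_measurable M" "m \<in> borel_measurable M"
    and m: "\<And>z. \<bar>m z\<bar> \<le> B"
    and int: "\<And>k. integrable M (\<lambda>z. (f k z - f0 z)\<^sup>2)" "\<And>k. integrable M (\<lambda>z. (g k z - g0 z)\<^sup>2)"
      "integrable M (\<lambda>z. (f0 z)\<^sup>2)" "integrable M (\<lambda>z. (g0 z)\<^sup>2)"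
    and lim: "(\<lambda>k. \<integral>z. (f k z - f0 z)\<^sup>2 \<partial>M) \<longlonglongrightarrow> 0" "(\<lambda>k. \<integral>z. (g k z - g0 z)\<^sup>2 \<partial>M) \<longlonglongrightarrow> 0"
  shows "(\<lambda>k. \<integral>z. m z * f k z * g k z \<partial>M) \<longlonglongrightarrow> (\<integral>z. m z * f0 z * g0 z \<partial>M)"
proof -
  define F where "F k z = f k z - f0 z" for k z
  define G where "G k z = g k z - g0 z" for k z
  have mF: "F k \<in> borel_measurable M" and mG: "G k \<in> borel_measurable M" for k
    unfolding F_def[abs_def] G_def[abs_def] using meas by auto
  have iF: "integrable M (\<lambda>z. (F k z)\<^sup>2)" and iG: "integrable M (\<lambda>z. (G k z)\<^sup>2)" for k
    using int by (auto simp: F_def G_def)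
  have lF: "(\<lambda>k. \<integral>z. (F k z)\<^sup>2 \<partial>M) \<longlonglongrightarrow> 0" and lG: "(\<lambda>k. \<integral>z. (G k z)\<^sup>2 \<partial>M) \<longlonglongrightarrow> 0"
    using lim by (auto simp: F_def G_def)
  obtain C where C: "\<And>k. (\<integral>z. (G k z)\<^sup>2 \<partial>M) \<le> C"
    using convergent_imp_Bseq[OF convergentI[OF lG]] unfolding Bseq_def by (auto simp: abs_le_iff)
  note prod = integrable_mult_square_integrable[OF _ _ meas(5) m]
  have "(\<lambda>k. \<integral>z. m z * F k z * G k z \<partial>M) \<longlonglongrightarrow> 0"
    by (rule integral_mult_null_seq[OF mF mG meas(5) m iF iG lF C])
  moreover have "(\<lambda>k. \<integral>z. m z * F k z * g0 z \<partial>M) \<longlonglongrightarrow> 0"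
    by (rule integral_mult_null_seq[OF mF meas(4,5) m iF int(4) lF order_refl])
  moreover have "(\<lambda>k. \<integral>z. m z * G k z * f0 z \<partial>M) \<longlonglongrightarrow> 0"
    by (rule integral_mult_null_seq[OF mG meas(3,5) m iG int(3) lG order_refl])
  ultimately have "(\<lambda>k. (\<integral>z. m z * F k z * G k z \<partial>M) + (\<integral>z. m z * F k z * g0 z \<partial>M)
      + (\<integral>z. m z * G k z * f0 z \<partial>M) + (\<integral>z. m z * f0 z * g0 z \<partial>M)) \<longlonglongrightarrow> 0 + 0 + 0 + (\<integral>z. m z * f0 z * g0 z \<partial>M)"
    by (intro tendsto_add tendsto_const)
  moreover have "(\<integral>z. m z * F k z * G k z \<partial>M) + (\<integral>z. m z * F k z * g0 z \<partial>M)
      + (\<integral>z. m z * G k z * f0 z \<partial>M) + (\<integral>z. m z * f0 z * g0 z \<partial>M) = (\<integral>z. m z * f k z * g k z \<partial>M)" for k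
  proof -
    have "(\<integral>z. m z * f k z * g k z \<partial>M)
        = (\<integral>z. m z * F k z * G k z + m z * F k z * g0 z + m z * G k z * f0 z + m z * f0 z * g0 z \<partial>M)"
      by (intro Bochner_Integration.integral_cong) (auto simp: F_def G_def algebra_simps)
    also have "\<dots> = (\<integral>z. m z * F k z * G k z \<partial>M) + (\<integral>z. m z * F k z * g0 z \<partial>M)
      + (\<integral>z. m z * G k z * f0 z \<partial>M) + (\<integral>z. m z * f0 z * g0 z \<partial>M)"
      using prod[OF mF mG iF iG] prod[OF mF meas(4) iF int(4)] prod[OF mG meas(3) iG int(3)]
        prod[OF meas(3,4) int(3,4)]
      by (simp add: Bochner_Integration.integral_add)
    finally show ?thesis ..
  qed
  ultimately show ?thesis by simp
qed


section \<open>The transport term and the trace\<close>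

lemma C1_power: "f \<in> C1 \<Longrightarrow> (\<lambda>z. f z ^ n) \<in> C1"
  by (induction n) (auto intro: C1_const C1_mult)

lemma C1_prod: "(\<And>i. i \<in> S \<Longrightarrow> f i \<in> C1) \<Longrightarrow> (\<lambda>z. \<Prod>i\<in>S. f i z) \<in> C1"
  by (induction S rule: infinite_finite_induct) (auto intro: C1_const C1_mult)

lemma C1_inner: "(\<lambda>z. (z - a) \<bullet> v) \<in> C1"
proof (rule C1I)
  have "(\<lambda>z. (z - a) \<bullet> v) = (\<lambda>z. fst v * fst z + snd v * snd z - a \<bullet> v)"
    by (simp add: fun_eq_iff inner_prod_def algebra_simps)
  then have "dx (\<lambda>z. (z - a) \<bullet> v) = (\<lambda>z. fst v)" "dy (\<lambda>z. (z - a) \<bullet> v) = (\<lambda>z. snd v)"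
    by (auto simp: fun_eq_iff intro!: dx_eqI dy_eqI derivative_eq_intros)
  then show "continuous_on UNIV (dx (\<lambda>z. (z - a) \<bullet> v))" "continuous_on UNIV (dy (\<lambda>z. (z - a) \<bullet> v))"
    by simp_all
  show "(\<lambda>z. (z - a) \<bullet> v) differentiable (at z)" for z
  proof (rule differentiableI)
    show "((\<lambda>z. (z - a) \<bullet> v) has_derivative (\<lambda>h. h \<bullet> v)) (at z)"
      by (auto intro!: derivative_eq_intros)
  qed
qed

context polygonal_boundary
begin

text \<open>Up to normalization, the product of the squared distances to the lines through the boundary
  segments; for a degenerate segment, to the vertical line through its point.\<close>

lemma boundary_defining_function:
  obtains lam where "lam \<in> C1" "\<And>z. z \<in> frontier \<Omega> \<Longrightarrow> lam z = 0"
    "\<And>z. z \<in> \<Omega> \<Longrightarrow> 0 \<le> lam z \<and> lam z \<le> 1" "AE z in lborel. lam z \<noteq> 0"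
proof -
  define nu :: "plane \<times> plane \<Rightarrow> plane" where
    "nu s = (if fst s = snd s then (1, 0) else (snd (snd s) - snd (fst s), fst (fst s) - fst (snd s)))" for s
  define q where "q z = (\<Prod>s\<in>E. ((z - fst s) \<bullet> nu s)\<^sup>2)" for z
  have nu0: "nu s \<noteq> 0" for s by (auto simp: nu_def prod_eq_iff)
  have q: "q \<in> C1" unfolding q_def[abs_def] by (intro C1_prod C1_power C1_inner)
  obtain B where B: "\<And>z. z \<in> \<Omega> \<Longrightarrow> \<bar>q z\<bar> \<le> B"
    using bounded_continuous_bound[OF bounded_dom C1_continuous(1)[OF q]] by blast
  have q0: "0 \<le> q z" for z unfolding q_def by (intro prod_nonneg) simp
  define B' where "B' = max B 1"
  have "1 / B' * q z \<le> 1" if "z \<in> \<Omega>" for z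
    using B[OF that] by (auto simp: B'_def divide_le_eq_1)
  moreover have "q z = 0" if z: "z \<in> frontier \<Omega>" for z
  proof -
    obtain s where s: "s \<in> E" "z \<in> closed_segment (fst s) (snd s)" using z unfolding frontier_eq by auto
    then obtain u where "z = (1 - u) *\<^sub>R fst s + u *\<^sub>R snd s"
      by (auto simp: closed_segment_def)
    then have "z - fst s = u *\<^sub>R (snd s - fst s)" by (simp add: algebra_simps)
    moreover have "(snd s - fst s) \<bullet> nu s = 0" by (simp add: nu_def inner_prod_def algebra_simps)
    ultimately have "(z - fst s) \<bullet> nu s = 0" by simp
    then show ?thesis using s(1) finite_E unfolding q_def by (intro prod_zero) auto
  qed
  moreover have "AE z in lborel. q z \<noteq> 0"
  proof -
    have "AE z in lborel. (z - fst s) \<bullet> nu s \<noteq> 0" for s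
    proof -
      have "negligible {z. nu s \<bullet> z = nu s \<bullet> fst s}" by (rule negligible_hyperplane) (simp add: nu0)
      moreover have "{z. nu s \<bullet> z = nu s \<bullet> fst s} \<in> sets borel"
        by (intro borel_closed closed_hyperplane)
      ultimately have "{z. nu s \<bullet> z = nu s \<bullet> fst s} \<in> null_sets lborel"
        by (simp add: negligible_iff_null_sets null_sets_def)
      then have "AE z in lborel. z \<notin> {z. nu s \<bullet> z = nu s \<bullet> fst s}" by (rule AE_not_in)
      then show ?thesis by eventually_elim (simp add: inner_diff_right inner_commute[of _ "nu s"])
    qed
    then have "AE z in lborel. \<forall>s\<in>E. (z - fst s) \<bullet> nu s \<noteq> 0"
      using finite_E by (intro AE_finite_allI) auto
    then show ?thesis by eventually_elim (simp add: q_def finite_E)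
  qed
  ultimately show thesis
    using q q0 by (intro that[of "\<lambda>z. 1 / B' * q z"]) (auto simp: B'_def intro: C1_cmult[of q "1 / B'", simplified])
qed

end

lemma set_integral_partition:
  fixes f :: "plane \<Rightarrow> real"
  assumes fin: "finite \<T>" and disj: "disjoint \<T>" and sub: "\<And>T. T \<in> \<T> \<Longrightarrow> T \<subseteq> \<Omega>"
    and null: "negligible (\<Omega> - \<Union>\<T>)" and meas: "\<And>T. T \<in> \<T> \<Longrightarrow> T \<in> sets lebesgue"
    and int: "\<And>T. T \<in> \<T> \<Longrightarrow> set_integrable lebesgue T f"
  shows "(LINT z:\<Omega>|lebesgue. f z) = (\<Sum>T\<in>\<T>. LINT z:T|lebesgue. f z)"
proof -
  have U: "set_integrable lebesgue (\<Union>T\<in>\<T>. T) f"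
    by (rule set_integrable_UN) (use fin int meas in auto)
  have "{z \<in> (\<Union>T\<in>\<T>. T) - \<Omega>. f z \<noteq> 0} = {}" using sub by auto
  then have n1: "negligible {z \<in> (\<Union>T\<in>\<T>. T) - \<Omega>. f z \<noteq> 0}" by (metis negligible_empty)
  have n2: "negligible {z \<in> \<Omega> - (\<Union>T\<in>\<T>. T). f z \<noteq> 0}"
    by (rule negligible_subset[OF null]) auto
  have \<Omega>: "set_integrable lebesgue \<Omega> f"
    by (rule absolutely_integrable_spike_set[OF U n1 n2])
  have "(LINT z:\<Omega>|lebesgue. f z) = integral \<Omega> f"
    by (rule set_lebesgue_integral_eq_integral(2)[OF \<Omega>])
  also have "\<dots> = integral (\<Union>T\<in>\<T>. T) f"
    by (rule integral_spike_set[OF n2 n1])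
  also have "\<dots> = (LINT z:(\<Union>T\<in>\<T>. T)|lebesgue. f z)"
    by (rule set_lebesgue_integral_eq_integral(2)[OF U, symmetric])
  also have "\<dots> = (\<Sum>T\<in>\<T>. LINT z:T|lebesgue. f z)"
    by (rule set_integral_finite_Union[OF fin])
      (use disj int meas in \<open>auto simp: disjoint_family_on_def disjoint_def\<close>)
  finally show "(LINT z:\<Omega>|lebesgue. f z) = (\<Sum>T\<in>\<T>. LINT z:T|lebesgue. f z)" .
qed

lemma integrable_diff_square:
  fixes f g :: "'a \<Rightarrow> real"
  assumes meas: "f \<in> borel_measurable M" "g \<in> borel_measurable M"
    and int: "integrable M (\<lambda>z. (f z)\<^sup>2)" "integrable M (\<lambda>z. (g z)\<^sup>2)"
  shows "integrable M (\<lambda>z. (f z - g z)\<^sup>2)"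
proof -
  have "integrable M (\<lambda>z. (1::real) * f z * g z)"
    by (rule integrable_mult_square_integrable[where B = 1]) (use assms in auto)
  then have "integrable M (\<lambda>z. (f z)\<^sup>2 + (g z)\<^sup>2 - 2 * (1 * f z * g z))" using int by simp
  then show ?thesis by (simp add: power2_diff mult.assoc)
qed

lemma square_integrable_indicator:
  assumes "square_integrable M S (f :: 'a \<Rightarrow> real)"
  shows "(\<lambda>z. indicator S z * f z) \<in> borel_measurable M" "integrable M (\<lambda>z. (indicator S z * f z)\<^sup>2)"
proof -
  show "(\<lambda>z. indicator S z * f z) \<in> borel_measurable M"
    using assms by (simp add: square_integrable_def set_borel_measurable_def)
  have "(\<lambda>z. (indicator S z * f z)\<^sup>2) = (\<lambda>z. indicator S z *\<^sub>R (norm (f z))\<^sup>2)"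
    by (auto simp: indicator_def fun_eq_iff)
  then show "integrable M (\<lambda>z. (indicator S z * f z)\<^sup>2)"
    using assms by (simp add: square_integrable_def set_integrable_def)
qed

lemma square_integrable_components:
  assumes G: "square_integrable M S (G :: 'a \<Rightarrow> plane)"
  shows "square_integrable M S (\<lambda>z. fst (G z))" "square_integrable M S (\<lambda>z. snd (G z))"
proof -
  have m: "(\<lambda>z. indicat_real S z *\<^sub>R G z) \<in> borel_measurable M"
    and i: "integrable M (\<lambda>z. indicat_real S z *\<^sub>R (norm (G z))\<^sup>2)"
    using G by (auto simp: square_integrable_def set_borel_measurable_def set_integrable_def)
  have m1: "(\<lambda>z. indicat_real S z *\<^sub>R fst (G z)) \<in> borel_measurable M"
    and m2: "(\<lambda>z. indicat_real S z *\<^sub>R snd (G z)) \<in> borel_measurable M"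
    using measurable_compose[OF m borel_measurable_fst_snd(1)] measurable_compose[OF m borel_measurable_fst_snd(2)]
    by simp_all
  have sq: "(\<lambda>z. indicat_real S z *\<^sub>R (norm (h z))\<^sup>2) = (\<lambda>z. (indicat_real S z *\<^sub>R h z)\<^sup>2)" for h :: "'a \<Rightarrow> real"
    by (auto simp: indicator_def fun_eq_iff)
  have "integrable M (\<lambda>z. indicat_real S z *\<^sub>R (norm (fst (G z)))\<^sup>2)"
  proof (rule Bochner_Integration.integrable_bound[OF i])
    show "(\<lambda>z. indicat_real S z *\<^sub>R (norm (fst (G z)))\<^sup>2) \<in> borel_measurable M"
      unfolding sq using m1 by (rule borel_measurable_power)
  qed (auto simp: indicator_def norm_prod_def)
  moreover have "integrable M (\<lambda>z. indicat_real S z *\<^sub>R (norm (snd (G z)))\<^sup>2)"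
  proof (rule Bochner_Integration.integrable_bound[OF i])
    show "(\<lambda>z. indicat_real S z *\<^sub>R (norm (snd (G z)))\<^sup>2) \<in> borel_measurable M"
      unfolding sq using m2 by (rule borel_measurable_power)
  qed (auto simp: indicator_def norm_prod_def)
  ultimately show "square_integrable M S (\<lambda>z. fst (G z))" "square_integrable M S (\<lambda>z. snd (G z))"
    using m1 m2 by (simp_all add: square_integrable_def set_borel_measurable_def set_integrable_def)
qed

lemma L2_norm_tendsto_0D:
  assumes "(\<lambda>k. L2_norm M S (f k)) \<longlonglongrightarrow> 0"
  shows "(\<lambda>k. \<integral>z. indicator S z * (norm (f k z))\<^sup>2 \<partial>M) \<longlonglongrightarrow> 0"
  using tendsto_power[OF assms, of 2] by (simp add: L2_norm_sq set_lebesgue_integral_def)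

context polygonal_boundary
begin

lemma C1_indicator:
  assumes "f \<in> C1"
  shows "(\<lambda>z. indicator \<Omega> z * f z) \<in> borel_measurable lebesgue"
    "integrable lebesgue (\<lambda>z. (indicator \<Omega> z * f z)\<^sup>2)"
    "(\<lambda>z. indicator \<Omega> z * dy f z) \<in> borel_measurable lebesgue"
    "integrable lebesgue (\<lambda>z. (indicator \<Omega> z * dy f z)\<^sup>2)"
    "(\<lambda>z. indicator \<Omega> z * dx f z) \<in> borel_measurable lebesgue"
    "integrable lebesgue (\<lambda>z. (indicator \<Omega> z * dx f z)\<^sup>2)"
proof -
  have *: "(\<lambda>z. indicator \<Omega> z * h z) \<in> borel_measurable lebesgue \<and>
      integrable lebesgue (\<lambda>z. (indicator \<Omega> z * h z)\<^sup>2)" if h: "continuous_on UNIV h" for h :: "plane \<Rightarrow> real"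
  proof
    have \<Omega>: "\<Omega> \<in> sets borel" using open_dom by simp
    show "(\<lambda>z. indicator \<Omega> z * h z) \<in> borel_measurable lebesgue"
      using set_integrable_continuous_bounded(2)[OF bounded_dom \<Omega> h] by (auto simp: set_integrable_def)
    have "continuous_on UNIV (\<lambda>z. (h z)\<^sup>2)" using h by (intro continuous_intros)
    from set_integrable_continuous_bounded(2)[OF bounded_dom \<Omega> this]
    have "integrable lebesgue (\<lambda>z. indicator \<Omega> z * (h z)\<^sup>2)" by (simp add: set_integrable_def)
    moreover have "(\<lambda>z. indicator \<Omega> z * (h z)\<^sup>2) = (\<lambda>z. (indicator \<Omega> z * h z)\<^sup>2)"
      by (auto simp: indicator_def fun_eq_iff)
    ultimately show "integrable lebesgue (\<lambda>z. (indicator \<Omega> z * h z)\<^sup>2)" by simp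
  qed
  show "(\<lambda>z. indicator \<Omega> z * f z) \<in> borel_measurable lebesgue"
    "integrable lebesgue (\<lambda>z. (indicator \<Omega> z * f z)\<^sup>2)"
    "(\<lambda>z. indicator \<Omega> z * dy f z) \<in> borel_measurable lebesgue"
    "integrable lebesgue (\<lambda>z. (indicator \<Omega> z * dy f z)\<^sup>2)"
    "(\<lambda>z. indicator \<Omega> z * dx f z) \<in> borel_measurable lebesgue"
    "integrable lebesgue (\<lambda>z. (indicator \<Omega> z * dx f z)\<^sup>2)"
    using * C1_continuous[OF assms] by blast+
qed

end

text \<open>The situation in the definition of \<^const>\<open>has_trace\<close>: \<open>g\<close> is the trace of \<open>v\<close>, and \<open>G\<close> is a
  candidate for its gradient.\<close>

locale approximated_trace = polygonal_boundary +
  fixes v g :: "plane \<Rightarrow> real" and G :: "plane \<Rightarrow> plane" and \<phi> :: "nat \<Rightarrow> plane \<Rightarrow> real"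
  assumes v: "square_integrable lebesgue \<Omega> v" and g: "square_integrable hausdorff1 (frontier \<Omega>) g"
    and G: "square_integrable lebesgue \<Omega> G" and \<phi>: "\<And>k. \<phi> k \<in> C1"
    and lim_v: "(\<lambda>k. L2_norm lebesgue \<Omega> (\<lambda>z. \<phi> k z - v z)) \<longlonglongrightarrow> 0"
    and lim_G: "(\<lambda>k. L2_norm lebesgue \<Omega> (\<lambda>z. grad (\<phi> k) z - G z)) \<longlonglongrightarrow> 0"
    and lim_g: "(\<lambda>k. L2_norm hausdorff1 (frontier \<Omega>) (\<lambda>z. \<phi> k z - g z)) \<longlonglongrightarrow> 0"
begin

definition v\<Omega> :: "plane \<Rightarrow> real" where "v\<Omega> z = indicator \<Omega> z * v z"
definition G1\<Omega> :: "plane \<Rightarrow> real" where "G1\<Omega> z = indicator \<Omega> z * fst (G z)"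
definition G2\<Omega> :: "plane \<Rightarrow> real" where "G2\<Omega> z = indicator \<Omega> z * snd (G z)"
definition g\<Omega> :: "plane \<Rightarrow> real" where "g\<Omega> z = indicator (frontier \<Omega>) z * g z"

lemma v\<Omega>: "v\<Omega> \<in> borel_measurable lebesgue" "integrable lebesgue (\<lambda>z. (v\<Omega> z)\<^sup>2)"
  unfolding v\<Omega>_def[abs_def] using square_integrable_indicator[OF v] by auto

lemma G1\<Omega>: "G1\<Omega> \<in> borel_measurable lebesgue" "integrable lebesgue (\<lambda>z. (G1\<Omega> z)\<^sup>2)"
  unfolding G1\<Omega>_def[abs_def] using square_integrable_indicator[OF square_integrable_components(1)[OF G]] by auto

lemma G2\<Omega>: "G2\<Omega> \<in> borel_measurable lebesgue" "integrable lebesgue (\<lambda>z. (G2\<Omega> z)\<^sup>2)"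
  unfolding G2\<Omega>_def[abs_def] using square_integrable_indicator[OF square_integrable_components(2)[OF G]] by auto

lemma g\<Omega>: "g\<Omega> \<in> borel_measurable hausdorff1" "integrable hausdorff1 (\<lambda>z. (g\<Omega> z)\<^sup>2)"
  unfolding g\<Omega>_def[abs_def] using square_integrable_indicator[OF g] by auto

lemma lim_v\<Omega>: "(\<lambda>k. LINT z|lebesgue. (indicator \<Omega> z * \<phi> k z - v\<Omega> z)\<^sup>2) \<longlonglongrightarrow> 0"
proof -
  have "indicator \<Omega> z * (norm (\<phi> k z - v z))\<^sup>2 = (indicator \<Omega> z * \<phi> k z - v\<Omega> z)\<^sup>2" for k z
    by (simp add: indicator_def v\<Omega>_def)
  then show ?thesis using L2_norm_tendsto_0D[OF lim_v] by simp
qed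

lemma lim_g\<Omega>: "(\<lambda>k. LINT z|hausdorff1. (indicator (frontier \<Omega>) z * \<phi> k z - g\<Omega> z)\<^sup>2) \<longlonglongrightarrow> 0"
proof -
  have "indicator (frontier \<Omega>) z * (norm (\<phi> k z - g z))\<^sup>2 = (indicator (frontier \<Omega>) z * \<phi> k z - g\<Omega> z)\<^sup>2" for k z
    by (simp add: indicator_def g\<Omega>_def)
  then show ?thesis using L2_norm_tendsto_0D[OF lim_g] by simp
qed

lemma lim_G2\<Omega>: "(\<lambda>k. LINT z|lebesgue. (indicator \<Omega> z * dy (\<phi> k) z - G2\<Omega> z)\<^sup>2) \<longlonglongrightarrow> 0"
proof (rule tendsto_sandwich[OF _ _ tendsto_const L2_norm_tendsto_0D[OF lim_G]])
  show "\<forall>\<^sub>F k in sequentially. 0 \<le> (LINT z|lebesgue. (indicator \<Omega> z * dy (\<phi> k) z - G2\<Omega> z)\<^sup>2)"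
    by (intro always_eventually allI Bochner_Integration.integral_nonneg) simp
  have "(LINT z|lebesgue. (indicator \<Omega> z * dy (\<phi> k) z - G2\<Omega> z)\<^sup>2)
      \<le> (LINT z|lebesgue. indicator \<Omega> z * (norm (grad (\<phi> k) z - G z))\<^sup>2)" for k
  proof -
    have eq: "indicator \<Omega> z * (norm (grad (\<phi> k) z - G z))\<^sup>2
        = (indicator \<Omega> z * dx (\<phi> k) z - G1\<Omega> z)\<^sup>2 + (indicator \<Omega> z * dy (\<phi> k) z - G2\<Omega> z)\<^sup>2" for z
      by (simp add: indicator_def G1\<Omega>_def G2\<Omega>_def grad_def norm_prod_def)
    have 1: "integrable lebesgue (\<lambda>z. (indicator \<Omega> z * dx (\<phi> k) z - G1\<Omega> z)\<^sup>2)"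
      by (rule integrable_diff_square) (use C1_indicator[OF \<phi>] G1\<Omega> in auto)
    have 2: "integrable lebesgue (\<lambda>z. (indicator \<Omega> z * dy (\<phi> k) z - G2\<Omega> z)\<^sup>2)"
      by (rule integrable_diff_square) (use C1_indicator[OF \<phi>] G2\<Omega> in auto)
    show ?thesis unfolding eq by (rule integral_mono[OF 2 Bochner_Integration.integrable_add[OF 1 2]]) simp
  qed
  then show "\<forall>\<^sub>F k in sequentially. (LINT z|lebesgue. (indicator \<Omega> z * dy (\<phi> k) z - G2\<Omega> z)\<^sup>2)
      \<le> (LINT z|lebesgue. indicator \<Omega> z * (norm (grad (\<phi> k) z - G z))\<^sup>2)" by simp
qed

text \<open>The divergence theorem for \<open>x \<phi>\<^sub>k\<^sup>2 / 2\<close>, in the limit.\<close>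

lemma transport_limit:
  "(LINT z:\<Omega>|lebesgue. fst z * v z * snd (G z)) = 1/2 * (LINT z:frontier \<Omega>|hausdorff1. xn2 \<Omega> z * (g z)\<^sup>2)"
proof -
  obtain B where B: "\<And>z. z \<in> \<Omega> \<Longrightarrow> \<bar>fst z\<bar> \<le> B"
    using bounded_continuous_bound[OF bounded_dom C1_continuous(1)[OF C1_fst]] by blast
  define m where "m z = indicator \<Omega> z * fst z" for z :: plane
  define n where "n z = indicator (frontier \<Omega>) z * xn2 \<Omega> z" for z :: plane
  have m: "\<bar>m z\<bar> \<le> max B 0" for z using B[of z] by (auto simp: m_def indicator_def)
  obtain B' where n: "\<And>z. \<bar>n z\<bar> \<le> B'" using bounded_xn2_frontier by (auto simp: n_def)
  have m_meas: "m \<in> borel_measurable lebesgue"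
    unfolding m_def[abs_def] using C1_indicator(1)[OF C1_fst] .
  have sets: "frontier \<Omega> \<in> sets borel" by (simp add: borel_closed)
  note [measurable] = sets
  have n_meas: "n \<in> borel_measurable hausdorff1"
    unfolding n_def[abs_def] by (rule borel_measurable_xn2_frontier)
  have f_meas: "(\<lambda>z. indicator (frontier \<Omega>) z * \<phi> k z) \<in> borel_measurable hausdorff1" for k
    using C1_borel_measurable(1)[OF \<phi>[of k]] unfolding measurable_cong_sets[OF sets_hausdorff1 refl] by measurable
  have f_int: "integrable hausdorff1 (\<lambda>z. (indicator (frontier \<Omega>) z * \<phi> k z)\<^sup>2)" for k
  proof -
    have sq: "(\<lambda>z. \<phi> k z * \<phi> k z) \<in> C1" by (intro C1_mult \<phi>)
    obtain B' where "\<And>z. z \<in> frontier \<Omega> \<Longrightarrow> \<bar>\<phi> k z * \<phi> k z\<bar> \<le> B'"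
      using bounded_continuous_bound[OF bounded_frontier_dom C1_continuous(1)[OF sq]] by blast
    then have "set_integrable hausdorff1 (frontier \<Omega>) (\<lambda>z. \<phi> k z * \<phi> k z)"
      by (intro set_integrable_frontier C1_borel_measurable(1)[OF sq])
    then have "integrable hausdorff1 (\<lambda>z. indicator (frontier \<Omega>) z * (\<phi> k z * \<phi> k z))" by (simp add: set_integrable_def)
    moreover have "(\<lambda>z. indicator (frontier \<Omega>) z * (\<phi> k z * \<phi> k z)) = (\<lambda>z. (indicator (frontier \<Omega>) z * \<phi> k z)\<^sup>2)"
      by (auto simp: indicator_def fun_eq_iff power2_eq_square)
    ultimately show ?thesis by simp
  qed
  have lim1: "(\<lambda>k. LINT z|lebesgue. m z * (indicator \<Omega> z * \<phi> k z) * (indicator \<Omega> z * dy (\<phi> k) z))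
      \<longlonglongrightarrow> (LINT z|lebesgue. m z * v\<Omega> z * G2\<Omega> z)"
    using C1_indicator[OF \<phi>] v\<Omega> G2\<Omega>
    by (intro integral_mult_tendsto[OF _ _ _ _ m_meas m _ _ _ _ lim_v\<Omega> lim_G2\<Omega>] integrable_diff_square) auto
  have lim2: "(\<lambda>k. LINT z|hausdorff1. n z * (indicator (frontier \<Omega>) z * \<phi> k z) * (indicator (frontier \<Omega>) z * \<phi> k z))
      \<longlonglongrightarrow> (LINT z|hausdorff1. n z * g\<Omega> z * g\<Omega> z)"
    using f_meas f_int g\<Omega>
    by (intro integral_mult_tendsto[OF _ _ _ _ n_meas n _ _ _ _ lim_g\<Omega> lim_g\<Omega>] integrable_diff_square) auto
  have eq: "(LINT z|lebesgue. m z * (indicator \<Omega> z * \<phi> k z) * (indicator \<Omega> z * dy (\<phi> k) z))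
      = 1/2 * (LINT z|hausdorff1. n z * (indicator (frontier \<Omega>) z * \<phi> k z) * (indicator (frontier \<Omega>) z * \<phi> k z))" for k
  proof -
    define f where "f z = 1/2 * (fst z * (\<phi> k z * \<phi> k z))" for z
    have f: "f \<in> C1" unfolding f_def[abs_def] by (intro C1_cmult C1_mult C1_fst \<phi>)
    have dyf: "dy f = (\<lambda>z. fst z * \<phi> k z * dy (\<phi> k) z)"
      unfolding f_def[abs_def]
      by (simp only: dy_mult C1_mult C1_fst \<phi> C1_const dy_const dy_fst) (simp add: fun_eq_iff)
    have "(LINT z|lebesgue. m z * (indicator \<Omega> z * \<phi> k z) * (indicator \<Omega> z * dy (\<phi> k) z))
        = (LINT z:\<Omega>|lebesgue. dy f z)"
      unfolding set_lebesgue_integral_def dyf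
      by (intro Bochner_Integration.integral_cong) (auto simp: m_def indicator_def)
    also have "\<dots> = (LINT z:frontier \<Omega>|hausdorff1. snd (outward_normal \<Omega> z) * f z)"
      by (rule divergence_theorem_y[OF f])
    also have "\<dots> = (LINT z|hausdorff1. 1/2 * (n z * (indicator (frontier \<Omega>) z * \<phi> k z) * (indicator (frontier \<Omega>) z * \<phi> k z)))"
      unfolding set_lebesgue_integral_def
      by (intro Bochner_Integration.integral_cong) (auto simp: n_def f_def xn2_def indicator_def)
    finally show ?thesis by simp
  qed
  have "(LINT z|lebesgue. m z * v\<Omega> z * G2\<Omega> z) = 1/2 * (LINT z|hausdorff1. n z * g\<Omega> z * g\<Omega> z)"
    by (rule LIMSEQ_unique[OF lim1]) (unfold eq, rule tendsto_mult[OF tendsto_const lim2])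
  moreover have "(LINT z|lebesgue. m z * v\<Omega> z * G2\<Omega> z) = (LINT z:\<Omega>|lebesgue. fst z * v z * snd (G z))"
    unfolding set_lebesgue_integral_def
    by (intro Bochner_Integration.integral_cong) (auto simp: m_def v\<Omega>_def G2\<Omega>_def indicator_def)
  moreover have "(LINT z|hausdorff1. n z * g\<Omega> z * g\<Omega> z) = (LINT z:frontier \<Omega>|hausdorff1. xn2 \<Omega> z * (g z)\<^sup>2)"
    unfolding set_lebesgue_integral_def
    by (intro Bochner_Integration.integral_cong) (auto simp: n_def g\<Omega>_def indicator_def power2_eq_square)
  ultimately show ?thesis by simp
qed

end

context approximated_trace
begin

text \<open>On a piece \<open>T\<close> on which \<open>v\<close> coincides with a continuously differentiable \<open>q\<close>, integration by
  parts identifies \<open>\<partial>\<^sub>y q\<close> with the limit of \<open>\<partial>\<^sub>y \<phi>\<^sub>k\<close> when tested with functions that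
  vanish on the boundary of \<open>T\<close>; these exhaust \<open>x q\<close>.\<close>

lemma gradient_on_piece:
  assumes T: "polygonal_boundary T F" and sub: "T \<subseteq> \<Omega>" and q: "q \<in> C1" and vq: "\<And>z. z \<in> T \<Longrightarrow> v z = q z"
  shows "set_integrable lebesgue T (\<lambda>z. fst z * q z * snd (G z))"
    and "(LINT z:T|lebesgue. fst z * q z * snd (G z)) = (LINT z:T|lebesgue. fst z * q z * dy q z)"
proof -
  interpret T: polygonal_boundary T F by (rule T)
  have T_sets: "T \<in> sets borel" using T.open_dom by simp
  note int_T = set_integrable_continuous_bounded(2)[OF T.bounded_dom T_sets]
  have chi: "indicat_real \<Omega> \<in> borel_measurable lebesgue" "integrable lebesgue (\<lambda>z. (indicat_real \<Omega> z)\<^sup>2)"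
    using C1_indicator(1,2)[OF C1_const[of 1]] by simp_all
  have bound: "\<exists>B. \<forall>z. \<bar>indicator T z * h z\<bar> \<le> B" if "continuous_on UNIV h" for h :: "plane \<Rightarrow> real"
  proof -
    obtain B where B: "\<And>z. z \<in> T \<Longrightarrow> \<bar>h z\<bar> \<le> B" using bounded_continuous_bound[OF T.bounded_dom \<open>continuous_on UNIV h\<close>] by blast
    have "\<bar>indicator T z * h z\<bar> \<le> max B 0" for z using B[of z] by (auto simp: indicator_def)
    then show ?thesis by blast
  qed
  have meas: "(\<lambda>z. indicator T z * h z) \<in> borel_measurable lebesgue" if "continuous_on UNIV h" for h :: "plane \<Rightarrow> real"
    using int_T[OF that] by (auto simp: set_integrable_def)
  have xq: "(\<lambda>z. fst z * q z) \<in> C1" by (intro C1_mult C1_fst q)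
  show int_xqG: "set_integrable lebesgue T (\<lambda>z. fst z * q z * snd (G z))"
  proof -
    obtain B where B: "\<And>z. \<bar>indicator T z * (fst z * q z)\<bar> \<le> B" using bound[OF C1_continuous(1)[OF xq]] by blast
    have "integrable lebesgue (\<lambda>z. indicator T z * (fst z * q z) * G2\<Omega> z * indicator \<Omega> z)"
      by (rule integrable_mult_square_integrable[OF G2\<Omega>(1) chi(1) meas[OF C1_continuous(1)[OF xq]] B G2\<Omega>(2) chi(2)])
    moreover have "indicator T z * (fst z * q z) * G2\<Omega> z * indicator \<Omega> z = indicator T z *\<^sub>R (fst z * q z * snd (G z))" for z
      using sub by (auto simp: indicator_def G2\<Omega>_def)
    ultimately show ?thesis unfolding set_integrable_def by simp
  qed
  have int_xqq: "set_integrable lebesgue T (\<lambda>z. fst z * q z * dy q z)"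
    by (intro int_T continuous_intros C1_continuous[OF q])
  obtain lam where lam: "lam \<in> C1" "\<And>z. z \<in> frontier T \<Longrightarrow> lam z = 0"
    "\<And>z. z \<in> T \<Longrightarrow> 0 \<le> lam z \<and> lam z \<le> 1" "AE z in lborel. lam z \<noteq> 0"
    using T.boundary_defining_function by blast
  \<comment> \<open>increases to 1 almost everywhere on \<open>T\<close>, and 0 on its boundary\<close>
  define chi_j where "chi_j j z = 1 + (-1) * (1 + (-1) * lam z) ^ j" for j :: nat and z
  have chi_j: "chi_j j \<in> C1" for j
    unfolding chi_j_def[abs_def] by (intro C1_add C1_const C1_cmult C1_power lam)
  have exhaust: "(\<lambda>j. LINT z:T|lebesgue. chi_j j z * h z) \<longlonglongrightarrow> (LINT z:T|lebesgue. h z)"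
    if h: "set_integrable lebesgue T h" for h :: "plane \<Rightarrow> real"
    unfolding set_lebesgue_integral_def
  proof (rule integral_dominated_convergence)
    show hm: "(\<lambda>z. indicat_real T z *\<^sub>R h z) \<in> borel_measurable lebesgue"
      using h by (auto simp: set_integrable_def)
    show "integrable lebesgue (\<lambda>z. \<bar>indicat_real T z *\<^sub>R h z\<bar>)"
      using h by (auto simp: set_integrable_def)
    have "(\<lambda>z. (indicator T z * chi_j j z) * (indicat_real T z *\<^sub>R h z)) \<in> borel_measurable lebesgue" for j
      by (rule borel_measurable_times[OF meas[OF C1_continuous(1)[OF chi_j]] hm])
    moreover have "(indicator T z * chi_j j z) * (indicat_real T z *\<^sub>R h z) = indicat_real T z *\<^sub>R (chi_j j z * h z)" for j z
      by (simp add: indicator_def)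
    ultimately show "(\<lambda>z. indicat_real T z *\<^sub>R (chi_j j z * h z)) \<in> borel_measurable lebesgue" for j
      by (simp only:)
    show "AE z in lebesgue. (\<lambda>j. indicat_real T z *\<^sub>R (chi_j j z * h z)) \<longlonglongrightarrow> indicat_real T z *\<^sub>R h z"
      using AE_completion[OF lam(4)]
    proof eventually_elim
      case (elim z)
      show ?case
      proof (cases "z \<in> T")
        case True
        then have "0 \<le> 1 - lam z" "1 - lam z < 1" using lam(3)[OF True] elim by auto
        then have "(\<lambda>j. (1 - lam z) ^ j) \<longlonglongrightarrow> 0" by (intro LIMSEQ_power_zero) simp
        then have "(\<lambda>j. (1 - (1 - lam z) ^ j) * h z) \<longlonglongrightarrow> (1 - 0) * h z"
          by (intro tendsto_mult tendsto_diff tendsto_const)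
        then show ?thesis using True by (simp add: chi_j_def)
      qed simp
    qed
    show "AE z in lebesgue. norm (indicat_real T z *\<^sub>R (chi_j j z * h z)) \<le> \<bar>indicat_real T z *\<^sub>R h z\<bar>" for j
    proof (rule AE_I2)
      fix z
      show "norm (indicat_real T z *\<^sub>R (chi_j j z * h z)) \<le> \<bar>indicat_real T z *\<^sub>R h z\<bar>"
      proof (cases "z \<in> T")
        case True
        then have l: "0 \<le> 1 - lam z" "1 - lam z \<le> 1" using lam(3)[OF True] by auto
        then have "0 \<le> (1 - lam z) ^ j" "(1 - lam z) ^ j \<le> 1" by (simp_all add: power_le_one)
        then have "\<bar>chi_j j z\<bar> \<le> 1" by (simp add: chi_j_def)
        then have "\<bar>chi_j j z\<bar> * \<bar>h z\<bar> \<le> 1 * \<bar>h z\<bar>" by (rule mult_right_mono) simp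
        then show ?thesis using True by (simp add: abs_mult)
      qed simp
    qed
  qed
  have eq_j: "(LINT z:T|lebesgue. chi_j j z * (fst z * q z * snd (G z)))
      = (LINT z:T|lebesgue. chi_j j z * (fst z * q z * dy q z))" if j: "0 < j" for j
  proof -
    define eta where "eta z = chi_j j z * (fst z * q z)" for z
    have eta: "eta \<in> C1" unfolding eta_def[abs_def] by (intro C1_mult chi_j xq C1_fst q)
    have eta0: "eta z = 0" if "z \<in> frontier T" for z
      using lam(2)[OF that] by (simp add: eta_def chi_j_def)
    note ce = C1_continuous[OF eta]
    have parts: "(LINT z:T|lebesgue. dy f z * eta z) = - (LINT z:T|lebesgue. f z * dy eta z)" if f: "f \<in> C1" for f
    proof -
      note cf = C1_continuous[OF f]
      have "(LINT z:T|lebesgue. dy f z * eta z) + (LINT z:T|lebesgue. f z * dy eta z)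
          = (LINT z:T|lebesgue. dy f z * eta z + f z * dy eta z)"
        by (rule set_integral_add(2)[symmetric]) (intro int_T continuous_intros cf ce)+
      also have "\<dots> = (LINT z:T|lebesgue. dy (\<lambda>z. f z * eta z) z)" by (simp only: dy_mult[OF f eta])
      also have "\<dots> = (LINT z:frontier T|hausdorff1. snd (outward_normal T z) * (f z * eta z))"
        by (rule T.divergence_theorem_y) (intro C1_mult f eta)
      also have "\<dots> = 0"
        unfolding set_lebesgue_integral_def by (rule integral_eq_zero_AE) (auto simp: indicator_def eta0)
      finally show ?thesis by simp
    qed
    obtain B1 where B1: "\<And>z. \<bar>indicator T z * eta z\<bar> \<le> B1" using bound[OF ce(1)] by blast
    obtain B2 where B2: "\<And>z. \<bar>indicator T z * dy eta z\<bar> \<le> B2" using bound[OF ce(3)] by blast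
    have zero: "(\<lambda>k::nat. LINT z|lebesgue. (indicat_real \<Omega> z - indicator \<Omega> z)\<^sup>2) \<longlonglongrightarrow> 0" by simp
    have lim1: "(\<lambda>k. LINT z|lebesgue. (indicator T z * eta z) * (indicator \<Omega> z * dy (\<phi> k) z) * indicator \<Omega> z)
        \<longlonglongrightarrow> (LINT z|lebesgue. (indicator T z * eta z) * G2\<Omega> z * indicator \<Omega> z)"
      using C1_indicator[OF \<phi>] G2\<Omega> chi
      by (intro integral_mult_tendsto[OF _ _ _ _ meas[OF ce(1)] B1 _ _ _ _ lim_G2\<Omega> zero] integrable_diff_square) auto
    have lim2: "(\<lambda>k. LINT z|lebesgue. (indicator T z * dy eta z) * (indicator \<Omega> z * \<phi> k z) * indicator \<Omega> z)
        \<longlonglongrightarrow> (LINT z|lebesgue. (indicator T z * dy eta z) * v\<Omega> z * indicator \<Omega> z)"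
      using C1_indicator[OF \<phi>] v\<Omega> chi
      by (intro integral_mult_tendsto[OF _ _ _ _ meas[OF ce(3)] B2 _ _ _ _ lim_v\<Omega> zero] integrable_diff_square) auto
    have on_T: "(LINT z|lebesgue. (indicator T z * a z) * (indicator \<Omega> z * b z) * indicator \<Omega> z) = (LINT z:T|lebesgue. b z * a z)"
      for a b :: "plane \<Rightarrow> real"
      unfolding set_lebesgue_integral_def using sub
      by (intro Bochner_Integration.integral_cong) (auto simp: indicator_def)
    have "(LINT z|lebesgue. (indicator T z * eta z) * G2\<Omega> z * indicator \<Omega> z)
        = - (LINT z|lebesgue. (indicator T z * dy eta z) * v\<Omega> z * indicator \<Omega> z)"
      by (rule LIMSEQ_unique[OF lim1]) (unfold on_T parts[OF \<phi>], rule tendsto_minus[OF lim2[unfolded on_T]])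
    then have "(LINT z:T|lebesgue. snd (G z) * eta z) = - (LINT z:T|lebesgue. v z * dy eta z)"
      unfolding G2\<Omega>_def v\<Omega>_def on_T .
    also have "(LINT z:T|lebesgue. v z * dy eta z) = (LINT z:T|lebesgue. q z * dy eta z)"
      by (rule set_lebesgue_integral_cong) (use T_sets vq in auto)
    also have "- \<dots> = (LINT z:T|lebesgue. dy q z * eta z)" using parts[OF q] by simp
    finally show ?thesis by (simp add: eta_def mult_ac)
  qed
  have "(\<lambda>j. LINT z:T|lebesgue. chi_j j z * (fst z * q z * snd (G z))) \<longlonglongrightarrow> (LINT z:T|lebesgue. fst z * q z * dy q z)"
    by (rule Lim_transform_eventually[OF exhaust[OF int_xqq]])
      (use eq_j in \<open>auto intro!: eventually_mono[OF eventually_gt_at_top[of 0]]\<close>)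
  with exhaust[OF int_xqG] show "(LINT z:T|lebesgue. fst z * q z * snd (G z)) = (LINT z:T|lebesgue. fst z * q z * dy q z)"
    by (rule LIMSEQ_unique)
qed

end

text \<open>The classical derivative of a piecewise smooth function agrees on each piece with the \<open>L\<^sub>2\<close> limit
  in \<open>transport_limit\<close>, as far as the integral against \<open>x w\<close> is concerned.\<close>

lemma (in polygonal_boundary) transport_term_eq_trace:
  assumes trace: "has_trace \<Omega> w g"
    and part: "finite \<T>" "disjoint \<T>" "\<And>T. T \<in> \<T> \<Longrightarrow> T \<subseteq> \<Omega>" "negligible (\<Omega> - \<Union>\<T>)"
    and pieces: "\<And>T. T \<in> \<T> \<Longrightarrow> \<exists>F. polygonal_boundary T F"
    and w: "\<And>T. T \<in> \<T> \<Longrightarrow> \<exists>q\<in>C1. \<forall>z\<in>T. w z = q z"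
  shows "(LINT z:\<Omega>|lebesgue. fst z * dy w z * w z)
    = 1/2 * (LINT z:frontier \<Omega>|hausdorff1. xn2 \<Omega> z * (g z)\<^sup>2)"
proof -
  obtain G \<phi> where G\<phi>: "approximated_trace \<Omega> E w g G \<phi>"
    using trace polygonal_boundary_axioms
    unfolding has_trace_def approximated_trace_def approximated_trace_axioms_def by blast
  interpret approximated_trace \<Omega> E w g G \<phi> by (rule G\<phi>)
  have open_T: "open T" and bounded_T: "bounded T" if "T \<in> \<T>" for T
    using pieces[OF that] polygonal_boundary.open_dom polygonal_boundary.bounded_dom by blast+
  have meas: "T \<in> sets lebesgue" if "T \<in> \<T>" for T using open_T[OF that] by (simp add: lmeasurable_open)
  have piece: "set_integrable lebesgue T (\<lambda>z. fst z * w z * snd (G z))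
      \<and> set_integrable lebesgue T (\<lambda>z. fst z * dy w z * w z)
      \<and> (LINT z:T|lebesgue. fst z * w z * snd (G z)) = (LINT z:T|lebesgue. fst z * dy w z * w z)"
    if T: "T \<in> \<T>" for T
  proof -
    obtain q where q: "q \<in> C1" "\<And>z. z \<in> T \<Longrightarrow> w z = q z" using w[OF T] by blast
    obtain F where F: "polygonal_boundary T F" using pieces[OF T] by blast
    have dyw: "dy w z = dy q z" if "z \<in> T" for z
      by (rule dy_cong_open[OF open_T[OF T] that q(2)])
    have cong: "indicat_real T z *\<^sub>R (fst z * w z * snd (G z)) = indicat_real T z *\<^sub>R (fst z * q z * snd (G z))"
      "indicat_real T z *\<^sub>R (fst z * dy w z * w z) = indicat_real T z *\<^sub>R (fst z * q z * dy q z)" for z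
      using q(2)[of z] dyw[of z] by (auto simp: indicator_def)
    have "set_integrable lebesgue T (\<lambda>z. fst z * q z * dy q z)"
      using open_T[OF T] by (intro set_integrable_continuous_bounded(2)[OF bounded_T[OF T]] continuous_intros C1_continuous q) simp
    with gradient_on_piece[OF F part(3)[OF T] q] show ?thesis
      unfolding set_integrable_def set_lebesgue_integral_def cong by blast
  qed
  have "(LINT z:\<Omega>|lebesgue. fst z * dy w z * w z) = (\<Sum>T\<in>\<T>. LINT z:T|lebesgue. fst z * dy w z * w z)"
    by (rule set_integral_partition[OF part meas]) (use piece in auto)
  also have "\<dots> = (\<Sum>T\<in>\<T>. LINT z:T|lebesgue. fst z * w z * snd (G z))"
    by (rule sum.cong) (use piece in auto)
  also have "\<dots> = (LINT z:\<Omega>|lebesgue. fst z * w z * snd (G z))"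
    by (rule set_integral_partition[OF part meas, symmetric]) (use piece in auto)
  finally show ?thesis unfolding transport_limit .
qed

section \<open>Meshes\<close>

text \<open>Two elements that meet have the same closure: the intersection of their closures is a face of
  both and contains interior points of both. What the elements leave out of the domain lies on
  their frontiers.\<close>

lemma
  assumes domain: "polygonal_domain \<Omega>" and mesh: "mesh \<Omega> \<T>"
  shows mesh_finite: "finite \<T>" and mesh_disjoint: "disjoint \<T>"
    and mesh_subset: "T \<in> \<T> \<Longrightarrow> T \<subseteq> \<Omega>" and mesh_covers: "negligible (\<Omega> - \<Union>\<T>)"
proof -
  have tri: "open_triangle T" if "T \<in> \<T>" for T using mesh that by (simp add: mesh_def)
  have triang: "triangulation (closure ` \<T>)" and cover: "\<Union>(closure ` \<T>) = closure \<Omega>"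
    using mesh by (simp_all add: mesh_def)
  have inj: "inj_on closure \<T>"
    by (rule inj_onI) (metis tri open_triangle_interior_closure)
  have "finite (closure ` \<T>)" using triang by (simp add: triangulation_def)
  then show fin: "finite \<T>" using inj by (rule finite_imageD)
  show "T \<subseteq> \<Omega>" if "T \<in> \<T>"
  proof -
    have "closure T \<subseteq> closure \<Omega>" using cover that by blast
    then have "interior (closure T) \<subseteq> interior (closure \<Omega>)" by (rule interior_mono)
    then show ?thesis
      using open_triangle_interior_closure[OF tri[OF that]] domain by (simp add: polygonal_domain_def)
  qed
  have sub: "closure T \<subseteq> closure T'" if T: "T \<in> \<T>" "T' \<in> \<T>" and meet: "T \<inter> T' \<noteq> {}" for T T'
  proof -
    have face: "(closure T \<inter> closure T') face_of closure T"
      using triang T unfolding triangulation_def by blast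
    have "interior (closure T) \<subseteq> rel_interior (closure T)" by (rule interior_subset_rel_interior)
    then have "T \<subseteq> rel_interior (closure T)" using open_triangle_interior_closure[OF tri[OF T(1)]] by simp
    moreover have "T \<inter> T' \<subseteq> closure T \<inter> closure T'" using closure_subset by blast
    ultimately have "(closure T \<inter> closure T') \<inter> rel_interior (closure T) \<noteq> {}" using meet by blast
    then have "closure T \<inter> closure T' = closure T"
      using face_of_disjoint_rel_interior[OF face] by blast
    then show ?thesis by blast
  qed
  show "disjoint \<T>"
    unfolding disjoint_def
  proof (intro ballI impI, rule ccontr)
    fix T T' assume T: "T \<in> \<T>" "T' \<in> \<T>" "T \<noteq> T'" and meet: "T \<inter> T' \<noteq> {}"
    then have "closure T = closure T'" using sub[of T T'] sub[of T' T] by blast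
    with inj T show False by (auto dest: inj_onD)
  qed
  have "\<Omega> - \<Union>\<T> \<subseteq> (\<Union>T\<in>\<T>. frontier (closure T))"
  proof
    fix z assume z: "z \<in> \<Omega> - \<Union>\<T>"
    then have "z \<in> \<Union>(closure ` \<T>)" unfolding cover using closure_subset by blast
    then obtain T where T: "T \<in> \<T>" "z \<in> closure T" by blast
    then have "z \<in> frontier (closure T)"
      using z open_triangle_interior_closure[OF tri[OF T(1)]] by (auto simp: frontier_def)
    with T(1) show "z \<in> (\<Union>T\<in>\<T>. frontier (closure T))" by blast
  qed
  moreover have "negligible (\<Union>T\<in>\<T>. frontier (closure T))"
  proof (rule negligible_Union)
    show "finite ((\<lambda>T. frontier (closure T)) ` \<T>)" using fin by simp
    show "negligible F" if "F \<in> (\<lambda>T. frontier (closure T)) ` \<T>" for F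
      using that tri by (auto intro!: negligible_convex_frontier convex_simplex open_triangle_closure)
  qed
  ultimately show "negligible (\<Omega> - \<Union>\<T>)" by (rule negligible_subset[rotated])
qed


section \<open>Coercivity\<close>

text \<open>The boundary integral of \<open>x n\<^sub>2 w\<^sup>2\<close> is nonnegative off the outflow part: on the inflow part
  the trace vanishes, and where \<open>n\<^sub>1 \<noteq> 0\<close> there is no inflow.\<close>

lemma outflow_le_boundary_integral:
  assumes domain: "polygonal_domain \<Omega>" and no_inflow0: "\<forall>z\<in>bdry0 \<Omega>. xn2 \<Omega> z \<ge> 0"
    and g: "square_integrable hausdorff1 (frontier \<Omega>) g"
    and inflow: "AE z in hausdorff1. z \<in> bdry_minus \<Omega> \<longrightarrow> g z = 0"
  shows "(L2_norm hausdorff1 (bdry_plus \<Omega>) (\<lambda>z. sqrt (xn2 \<Omega> z) * g z))\<^sup>2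
    \<le> (LINT z:frontier \<Omega>|hausdorff1. xn2 \<Omega> z * (g z)\<^sup>2)"
proof -
  obtain E where "polygonal_boundary \<Omega> E" using polygonal_domain_boundary[OF domain] by blast
  then interpret polygonal_boundary \<Omega> E .
  define n where "n z = indicator (frontier \<Omega>) z * xn2 \<Omega> z" for z :: plane
  obtain B where n: "\<And>z. \<bar>n z\<bar> \<le> B" using bounded_xn2_frontier by (auto simp: n_def)
  have n_meas: "n \<in> borel_measurable hausdorff1"
    unfolding n_def[abs_def] by (rule borel_measurable_xn2_frontier)
  have sets: "frontier \<Omega> \<in> sets borel" by (simp add: borel_closed)
  note [measurable] = sets
  have "integrable hausdorff1 (\<lambda>z. n z * (indicator (frontier \<Omega>) z * g z) * (indicator (frontier \<Omega>) z * g z))"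
    by (rule integrable_mult_square_integrable[OF _ _ n_meas n]) (use square_integrable_indicator[OF g] in auto)
  moreover have "n z * (indicator (frontier \<Omega>) z * g z) * (indicator (frontier \<Omega>) z * g z)
      = indicat_real (frontier \<Omega>) z *\<^sub>R (xn2 \<Omega> z * (g z)\<^sup>2)" for z
    by (simp add: n_def indicator_def power2_eq_square)
  ultimately have int: "set_integrable hausdorff1 (frontier \<Omega>) (\<lambda>z. xn2 \<Omega> z * (g z)\<^sup>2)"
    unfolding set_integrable_def by simp
  have "{z \<in> space borel. z \<in> frontier \<Omega> \<and> n1 \<Omega> z = 0 \<and> 0 \<le> xn2 \<Omega> z} \<in> sets borel" by measurable
  moreover have "bdry_plus \<Omega> = {z \<in> space borel. z \<in> frontier \<Omega> \<and> n1 \<Omega> z = 0 \<and> 0 \<le> xn2 \<Omega> z}"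
    by (auto simp: bdry_plus_def bdry0_def)
  ultimately have plus: "bdry_plus \<Omega> \<in> sets hausdorff1" by simp
  have plus_sub: "bdry_plus \<Omega> \<subseteq> frontier \<Omega>" by (auto simp: bdry_plus_def)
  have "(L2_norm hausdorff1 (bdry_plus \<Omega>) (\<lambda>z. sqrt (xn2 \<Omega> z) * g z))\<^sup>2
      = (LINT z:bdry_plus \<Omega>|hausdorff1. xn2 \<Omega> z * (g z)\<^sup>2)"
    unfolding L2_norm_sq
    by (rule set_integral_cong_on) (auto simp: bdry_plus_def power_mult_distrib)
  also have "\<dots> \<le> (LINT z:frontier \<Omega>|hausdorff1. xn2 \<Omega> z * (g z)\<^sup>2)"
    unfolding set_lebesgue_integral_def
  proof (rule integral_mono_AE)
    show "integrable hausdorff1 (\<lambda>z. indicat_real (bdry_plus \<Omega>) z *\<^sub>R (xn2 \<Omega> z * (g z)\<^sup>2))"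
      using set_integrable_subset[OF int plus plus_sub] by (simp add: set_integrable_def)
    show "integrable hausdorff1 (\<lambda>z. indicat_real (frontier \<Omega>) z *\<^sub>R (xn2 \<Omega> z * (g z)\<^sup>2))"
      using int by (simp add: set_integrable_def)
    show "AE z in hausdorff1. indicat_real (bdry_plus \<Omega>) z *\<^sub>R (xn2 \<Omega> z * (g z)\<^sup>2)
        \<le> indicat_real (frontier \<Omega>) z *\<^sub>R (xn2 \<Omega> z * (g z)\<^sup>2)"
      using inflow
    proof eventually_elim
      case (elim z)
      consider "z \<in> bdry_plus \<Omega>" | "z \<in> bdry_minus \<Omega>" | "z \<in> bdry0 \<Omega>" | "z \<notin> frontier \<Omega>"
        using linorder_le_less_linear[of 0 "xn2 \<Omega> z"] by (auto simp: bdry_plus_def bdry_minus_def)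
      then show ?case
      proof cases
        case 1
        then show ?thesis using plus_sub by (auto simp: indicator_def)
      next
        case 2
        then show ?thesis using elim by simp
      next
        case 3
        then have "0 \<le> xn2 \<Omega> z * (g z)\<^sup>2" using no_inflow0 by simp
        then show ?thesis using plus_sub by (auto simp: indicator_def)
      next
        case 4
        then show ?thesis using plus_sub by (auto simp: indicator_def)
      qed
    qed
  qed
  finally show ?thesis .
qed

lemma integrable_dx_square_on_triangle:
  assumes T: "open_triangle T" and q: "q \<in> polys p" and w: "\<And>z. z \<in> T \<Longrightarrow> w z = q z"
  shows "set_integrable lebesgue T (\<lambda>z. (dx w z)\<^sup>2)"
proof -
  interpret triangle T by unfold_locales (rule T)
  have "continuous_on UNIV (\<lambda>z. (dx q z)\<^sup>2)"
    by (intro continuous_intros polys_continuous[OF polys_dx[OF q]])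
  then have "set_integrable lebesgue T (\<lambda>z. (dx q z)\<^sup>2)" by (rule integrable_I)
  moreover have "indicat_real T z *\<^sub>R (dx q z)\<^sup>2 = indicat_real T z *\<^sub>R (dx w z)\<^sup>2" for z
    using dx_cong_open[OF open_triangle_open[OF T] _ w, of z] by (simp add: indicator_def)
  ultimately show ?thesis unfolding set_integrable_def by (simp only:)
qed

theorem lemma4p2:
  fixes \<Omega> :: "plane set" and \<T> :: "plane set set" and p :: nat
    and C_INV C_inv \<kappa> \<kappa>' :: real
    and \<alpha> \<beta> \<gamma> \<delta> \<tau> :: "plane set \<Rightarrow> real"
    and J :: "real set" and w wt :: "real \<Rightarrow> plane \<Rightarrow> real"
  assumes domain: "polygonal_domain \<Omega>"
    and inflow: "emeasure hausdorff1 (bdry_minus \<Omega>) > 0"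
    \<comment> \<open>no inflow through the part of the boundary where \<open>n\<^sub>1 \<noteq> 0\<close>, on which functions in \<open>H\<^sup>1\<^sub>-\<close> are not constrained\<close>
    and no_inflow0: "\<forall>z\<in>bdry0 \<Omega>. xn2 \<Omega> z \<ge> 0"
    and mesh: "mesh \<Omega> \<T>" "shape_regular \<kappa> \<T>" "locally_quasi_uniform \<kappa>' \<T>"
    and p: "p \<ge> 1"
    and C_INV: "C_INV > 0" "inverse_estimate \<T> p C_INV"
    and C_inv: "C_inv > 0" "trace_inverse_estimate \<T> p C_inv"
    and delta: "\<forall>T\<in>\<T>. \<delta> T =
        max (C_inv\<^sup>2 * (real p)\<^sup>2 * Linf_norm hausdorff1 (elem_bdry_minus T) (xn2 T) / diameter T)
            (2 * (Linf_norm hausdorff1 (frontier T) (n1 T))\<^sup>2 * C_inv ^ 4 * real p ^ 4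
               / (3 * (diameter T)\<^sup>2))"
    and tau: "\<forall>T\<in>\<T>. \<tau> T = (diameter T)\<^sup>2 / (4 * C_INV\<^sup>2 * real p ^ 4)"
    and alpha: "\<forall>T\<in>\<T>. \<alpha> T = 1 / (8 * \<delta> T)"
    and beta: "\<forall>T\<in>\<T>. \<beta> T = 1 / (24 * (\<delta> T)\<^sup>2)"
    and gamma: "\<forall>T\<in>\<T>. \<gamma> T = 1 / (64 * (\<delta> T) ^ 3)"
    and time: "is_interval J" "interior J \<noteq> {}"
    and w: "\<forall>t\<in>J. w t \<in> Vh \<Omega> \<T> p"
    and wt: "\<forall>t\<in>J. wt t \<in> Vh \<Omega> \<T> p"
    and deriv: "\<forall>t\<in>J. \<forall>z\<in>\<Union>\<T>. ((\<lambda>s. w s z) has_real_derivative wt t z) (at t within J)"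
  shows "\<forall>t\<in>J. a_h \<Omega> \<T> \<tau> (\<lambda>T. sym_mat (\<alpha> T) (\<beta> T) (\<gamma> T)) (w t) (wt t) (w t) (wt t)
     \<ge> 1/4 * triple_norm_sq \<Omega> \<T> \<gamma> \<delta> \<tau> (\<lambda>T. sym_mat (\<alpha> T) (\<beta> T) (\<gamma> T)) (w t) (wt t)"
proof
  fix t assume t: "t \<in> J"
  let ?w = "w t" and ?wt = "wt t" and ?A = "\<lambda>T. sym_mat (\<alpha> T) (\<beta> T) (\<gamma> T)"
  let ?g = "bdry_trace \<Omega> (w t)"
  have tri: "open_triangle T" if "T \<in> \<T>" for T using mesh(1) that by (simp add: mesh_def)
  have Vh: "?w \<in> Vh \<Omega> \<T> p" "?wt \<in> Vh \<Omega> \<T> p" using w wt t by auto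
  then have poly: "\<exists>q\<in>polys p. \<forall>z\<in>T. ?w z = q z" "\<exists>q\<in>polys p. \<forall>z\<in>T. ?wt z = q z" if "T \<in> \<T>" for T
    using that by (simp_all add: Vh_def)
  have "?w \<in> H1_minus \<Omega>" using Vh(1) by (simp add: Vh_def)
  then have trace: "has_trace \<Omega> ?w ?g" and g0: "AE z in hausdorff1. z \<in> bdry_minus \<Omega> \<longrightarrow> ?g z = 0"
    by (simp_all add: H1_minus_def)
  note part = mesh_finite[OF domain mesh(1)] mesh_disjoint[OF domain mesh(1)]
    mesh_subset[OF domain mesh(1)] mesh_covers[OF domain mesh(1)]
  have elem: "1/4 * elem_norm_sq T (\<gamma> T * \<delta> T) (\<tau> T) (?A T) ?w ?wt \<le> elem_form T (\<tau> T) (?A T) ?w ?wt"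
    if T: "T \<in> \<T>" for T
  proof -
    interpret triangle T by unfold_locales (rule tri[OF T])
    have "L2_norm lebesgue T (grad v) \<le> C_INV * (real p)\<^sup>2 / diameter T * L2_norm lebesgue T v"
      "L2_norm hausdorff1 (frontier T) v \<le> C_inv * real p / sqrt (diameter T) * L2_norm lebesgue T v"
      if "v \<in> polys p" for v
      using C_INV(2) C_inv(2) T that by (auto simp: inverse_estimate_def trace_inverse_estimate_def)
    then show ?thesis
      by (rule element_coercivity[OF poly[OF T] p C_INV(1) _ _ bspec[OF delta T] bspec[OF tau T]
            bspec[OF alpha T] bspec[OF beta T] bspec[OF gamma T]])
  qed
  have int: "set_integrable lebesgue T (\<lambda>z. (dx ?w z)\<^sup>2)" if "T \<in> \<T>" for T
    using poly(1)[OF that] integrable_dx_square_on_triangle[OF tri[OF that]] by blast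
  have meas: "T \<in> sets lebesgue" if "T \<in> \<T>" for T
    using open_triangle_open[OF tri[OF that]] by (simp add: lmeasurable_open)
  have sum_dx: "(LINT z:\<Omega>|lebesgue. (dx ?w z)\<^sup>2) = (\<Sum>T\<in>\<T>. LINT z:T|lebesgue. (dx ?w z)\<^sup>2)"
    by (rule set_integral_partition[OF part meas int])
  have inner_dx: "L2_inner lebesgue \<Omega> (dx ?w) (dx ?w) = (LINT z:\<Omega>|lebesgue. (dx ?w z)\<^sup>2)"
    unfolding L2_inner_def by (rule set_integral_cong_on) (simp add: power2_eq_square)
  have norm_dx: "(L2_norm lebesgue \<Omega> (dx ?w))\<^sup>2 = (LINT z:\<Omega>|lebesgue. (dx ?w z)\<^sup>2)"
    unfolding L2_norm_sq by simp
  obtain E where E: "polygonal_boundary \<Omega> E" using polygonal_domain_boundary[OF domain] by blast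
  have "L2_inner lebesgue \<Omega> (\<lambda>z. fst z * dy ?w z) ?w = (LINT z:\<Omega>|lebesgue. fst z * dy ?w z * ?w z)"
    unfolding L2_inner_def by (rule set_integral_cong_on) simp
  also have "\<dots> = 1/2 * (LINT z:frontier \<Omega>|hausdorff1. xn2 \<Omega> z * (?g z)\<^sup>2)"
  proof (rule polygonal_boundary.transport_term_eq_trace[OF E trace part])
    show "\<exists>F. polygonal_boundary T F" if "T \<in> \<T>" for T by (rule open_triangle_boundary[OF tri[OF that]])
    show "\<exists>q\<in>C1. \<forall>z\<in>T. ?w z = q z" if "T \<in> \<T>" for T using poly(1)[OF that] polys_C1 by blast
  qed
  finally have transport: "L2_inner lebesgue \<Omega> (\<lambda>z. fst z * dy ?w z) ?w
      = 1/2 * (LINT z:frontier \<Omega>|hausdorff1. xn2 \<Omega> z * (?g z)\<^sup>2)" .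
  have outflow: "(L2_norm hausdorff1 (bdry_plus \<Omega>) (\<lambda>z. sqrt (xn2 \<Omega> z) * ?g z))\<^sup>2
      \<le> (LINT z:frontier \<Omega>|hausdorff1. xn2 \<Omega> z * (?g z)\<^sup>2)"
    using trace by (intro outflow_le_boundary_integral[OF domain no_inflow0 _ g0]) (simp add: has_trace_def)
  let ?B = "(L2_norm hausdorff1 (bdry_plus \<Omega>) (\<lambda>z. sqrt (xn2 \<Omega> z) * ?g z))\<^sup>2"
  have "1/4 * triple_norm_sq \<Omega> \<T> \<gamma> \<delta> \<tau> ?A ?w ?wt
      = 1/4 * ?B + (\<Sum>T\<in>\<T>. 1/4 * elem_norm_sq T (\<gamma> T * \<delta> T) (\<tau> T) (?A T) ?w ?wt)"
    unfolding triple_norm_sq_def elem_norm_sq_def norm_dx sum_dx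
    by (simp only: sum.distrib sum_distrib_left[symmetric]) (simp only: distrib_left ac_simps)
  also have "\<dots> \<le> 1/2 * (LINT z:frontier \<Omega>|hausdorff1. xn2 \<Omega> z * (?g z)\<^sup>2)
      + (\<Sum>T\<in>\<T>. elem_form T (\<tau> T) (?A T) ?w ?wt)"
  proof (rule add_mono[OF _ sum_mono[OF elem]])
    have "0 \<le> ?B" by simp
    with outflow show "1/4 * ?B \<le> 1/2 * (LINT z:frontier \<Omega>|hausdorff1. xn2 \<Omega> z * (?g z)\<^sup>2)" by linarith
  qed
  also have "\<dots> = a_h \<Omega> \<T> \<tau> ?A ?w ?wt ?w ?wt"
    unfolding a_h_def elem_form_def inner_dx sum_dx transport by (simp only: sum.distrib ac_simps)
  finally show "1/4 * triple_norm_sq \<Omega> \<T> \<gamma> \<delta> \<tau> ?A ?w ?wt \<le> a_h \<Omega> \<T> \<tau> ?A ?w ?wt ?w ?wt" .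
qed

end
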